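(* Let $\mathbb{F}_q$ be a finite field of characteristic two, let $\nu\ge 1$ and $n=2\nu$, and let $G$ be one of the $n\times n$ matrices $G_{2\nu}$ or $G_{2(\nu-1)+2}$ over $\mathbb{F}_q$ (defined in the context). Let $$O_n(\mathbb{F}_q,G)=\{\,T\in \mathrm{GL}_n(\mathbb{F}_q): T\,G\,{}^tT\equiv G\,\},$$ let $A=G+{}^tG$, and in $\mathbb{F}_q[X_1,\ldots,X_n]$ put $$P_{n0}=(X_1,\ldots,X_n)\,G\begin{pmatrix}X_1\\ \vdots\\ X_n\end{pmatrix},\qquad P_{nk}=(X_1,\ldots,X_n)\,A\begin{pmatrix}X_1^{q^k}\\ \vdots\\ X_n^{q^k}\end{pmatrix},\quad k=1,2,\ldots.$$ Then $$\mathbb{F}_q(X_1,\ldots,X_n)^{O_n(\mathbb{F}_q,G)}=\mathbb{F}_q(P_{n0},P_{n1},\ldots,P_{n,n-1}).$$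
   Context: A square matrix $(a_{ij})$ is alternate if $a_{ij}=-a_{ji}$ for all $i,j$ and $a_{ii}=0$ for all $i$. For square matrices $M,N$ of the same size, $M\equiv N$ means that $M-N$ is alternate. ${}^tT$ is the transpose of $T$; $I^{(m)}$ is the $m\times m$ identity matrix. The matrices are, in block form (blank entries are zero), $$G_{2\nu}=\begin{pmatrix}0&I^{(\nu)}\\ &0\end{pmatrix},\qquad G_{2(\nu-1)+2}=\begin{pmatrix}0&I^{(\nu-1)}&&\\ &0&&\\ &&\alpha&1\\ &&&\alpha\end{pmatrix},$$ where $\alpha$ is a fixed element of $\mathbb{F}_q\setminus\{x+x^2:x\in\mathbb{F}_q\}$. Action: each $T\in\mathrm{GL}_n(\mathbb{F}_q)$ induces the $\mathbb{F}_q$-automorphism $\sigma_T$ of the rational function field $\mathbb{F}_q(X_1,\ldots,X_n)$ given by $\sigma_T(f(X_1,\ldots,X_n))=f(\sigma_T(X_1),\ldots,\sigma_T(X_n))$ with $(\sigma_T(X_1),\ldots,\sigma_T(X_n))=(X_1,\ldots,X_n)T$. For a subgroup $H\le \mathrm{GL}_n(\mathbb{F}_q)$, $\mathbb{F}_q(X_1,\ldots,X_n)^{H}=\{f:\sigma_T(f)=f\text{ for all }T\in H\}$. *)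

theory Defs
  imports
    "Jordan_Normal_Form.Matrix"
    "HOL-Library.Cardinality"
    "HOL-Library.Poly_Mapping"
    "HOL-Algebra.Generated_Fields"
    "HOL-Algebra.Algebraic_Closure_Type"
begin

section \<open>Polynomials and rational functions\<close>

text \<open>
  Indices start at 0: the variables \<open>X\<^sub>1, \<dots>, X\<^sub>n\<close> are \<open>mvar 0, \<dots>, mvar (n - 1)\<close>.
  The number of variables depends on \<open>n\<close>, so all rational function fields are taken
  inside the rational function field in countably many variables.
\<close>

type_synonym 'a mpoly = "(nat \<Rightarrow>\<^sub>0 nat) \<Rightarrow>\<^sub>0 'a"
type_synonym 'a ratfun = "'a mpoly fract"

definition mconst :: "'a \<Rightarrow> 'a::field mpoly" where
  "mconst c = Poly_Mapping.single 0 c"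

definition mvar :: "nat \<Rightarrow> 'a::field mpoly" where
  "mvar i = Poly_Mapping.single (Poly_Mapping.single i 1) 1"

definition mvar_vec :: "nat \<Rightarrow> 'a::field mpoly vec" where
  "mvar_vec n = vec n mvar"

text \<open>The subfield \<open>F(S)\<close> generated over the constants by a set \<open>S\<close> of rational functions.\<close>

definition field_adjoin :: "'a::field ratfun set \<Rightarrow> 'a ratfun set" where
  "field_adjoin S = generate_field ring_of_type_algebra (range (\<lambda>c. to_fract (mconst c)) \<union> S)"

definition rational_function_field :: "nat \<Rightarrow> 'a::field ratfun set" where
  "rational_function_field n = field_adjoin ((\<lambda>i. to_fract (mvar i)) ` {..<n})"

definition msubst :: "(nat \<Rightarrow> 'a mpoly) \<Rightarrow> 'a::field mpoly \<Rightarrow> 'a mpoly" where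
  "msubst y p = (\<Sum>m\<in>Poly_Mapping.keys p. mconst (Poly_Mapping.lookup p m) *
     (\<Prod>i\<in>Poly_Mapping.keys m. y i ^ Poly_Mapping.lookup m i))"

text \<open>
  \<open>f(y\<^sub>0, y\<^sub>1, \<dots>)\<close>, computed from any representation \<open>f = a / b\<close> whose denominator does not
  vanish under the substitution; see \<open>ratfun_subst_Fract\<close> for independence of the choice.
\<close>

definition ratfun_subst :: "(nat \<Rightarrow> 'a mpoly) \<Rightarrow> 'a::field ratfun \<Rightarrow> 'a ratfun" where
  "ratfun_subst y f = (THE g. \<exists>a b. b \<noteq> 0 \<and> msubst y b \<noteq> 0 \<and>
     f = Fract a b \<and> g = Fract (msubst y a) (msubst y b))"


section \<open>The linear action\<close>

definition GL :: "nat \<Rightarrow> 'a::field mat set" where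
  "GL n = {T \<in> carrier_mat n n. invertible_mat T}"

text \<open>
  The \<open>j\<close>-th entry of the row vector \<open>(X\<^sub>1, \<dots>, X\<^sub>n) T\<close>.  Variables outside the first \<open>n\<close>
  are irrelevant and left unchanged.
\<close>

definition linear_subst :: "nat \<Rightarrow> 'a::field mat \<Rightarrow> nat \<Rightarrow> 'a mpoly" where
  "linear_subst n T j =
     (if j < n then mvar_vec n \<bullet> col (map_mat mconst T) j else mvar j)"

definition \<sigma> :: "nat \<Rightarrow> 'a::field mat \<Rightarrow> 'a ratfun \<Rightarrow> 'a ratfun" where
  "\<sigma> n T = ratfun_subst (linear_subst n T)"

definition invariant_field :: "nat \<Rightarrow> 'a::field mat set \<Rightarrow> 'a ratfun set" where
  "invariant_field n H = {f \<in> rational_function_field n. \<forall>T\<in>H. \<sigma> n T f = f}"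


section \<open>Orthogonal groups in characteristic two\<close>

definition alternate_mat :: "'a::field mat \<Rightarrow> bool" where
  "alternate_mat M \<longleftrightarrow> square_mat M \<and>
     (\<forall>i<dim_row M. \<forall>j<dim_row M. M $$ (i, j) = - M $$ (j, i)) \<and>
     (\<forall>i<dim_row M. M $$ (i, i) = 0)"

definition alt_cong :: "'a::field mat \<Rightarrow> 'a mat \<Rightarrow> bool" (infix \<open>\<equiv>\<^sub>a\<close> 50) where
  "M \<equiv>\<^sub>a N \<longleftrightarrow> alternate_mat (M - N)"

definition G_hyp :: "nat \<Rightarrow> 'a::field mat" where
  "G_hyp \<nu> = four_block_mat (0\<^sub>m \<nu> \<nu>) (1\<^sub>m \<nu>) (0\<^sub>m \<nu> \<nu>) (0\<^sub>m \<nu> \<nu>)"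

definition G_ell :: "nat \<Rightarrow> 'a \<Rightarrow> 'a::field mat" where
  "G_ell \<nu> \<alpha> = four_block_mat
     (G_hyp (\<nu> - 1)) (0\<^sub>m (2 * (\<nu> - 1)) 2)
     (0\<^sub>m 2 (2 * (\<nu> - 1))) (mat_of_rows_list 2 [[\<alpha>, 1], [0, \<alpha>]])"

definition orthogonal_group :: "nat \<Rightarrow> 'a::field mat \<Rightarrow> 'a mat set" where
  "orthogonal_group n G = {T \<in> GL n. T * G * transpose_mat T \<equiv>\<^sub>a G}"

definition P_poly :: "nat \<Rightarrow> 'a::{field,finite} mat \<Rightarrow> nat \<Rightarrow> 'a mpoly" where
  "P_poly n G k =
     (if k = 0 then mvar_vec n \<bullet> (map_mat mconst G *\<^sub>v mvar_vec n)
      else mvar_vec n \<bullet> (map_mat mconst (G + transpose_mat G) *\<^sub>v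
             map_vec (\<lambda>x. x ^ (CARD('a) ^ k)) (mvar_vec n)))"


section \<open>Well-definedness of the action\<close>

lemma mconst_0 [simp]: "mconst 0 = 0"
  and mconst_1 [simp]: "mconst 1 = 1"
  and mconst_add: "mconst (a + b) = mconst a + mconst b"
  and mconst_mult: "mconst (a * b) = mconst a * mconst b"
  by (simp_all add: mconst_def single_add mult_single)

lemma msubst_superset:
  assumes "finite A" "Poly_Mapping.keys p \<subseteq> A"
  shows "msubst y p = (\<Sum>m\<in>A. mconst (Poly_Mapping.lookup p m) *
     (\<Prod>i\<in>Poly_Mapping.keys m. y i ^ Poly_Mapping.lookup m i))"
  unfolding msubst_def
  by (rule sum.mono_neutral_left) (use assms in \<open>auto simp: in_keys_iff\<close>)

lemma msubst_0 [simp]: "msubst y 0 = 0"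
  by (simp add: msubst_def)

lemma msubst_add: "msubst y (p + q) = msubst y p + msubst y q"
proof -
  let ?A = "Poly_Mapping.keys p \<union> Poly_Mapping.keys q"
  have *: "finite ?A" by simp
  have **: "Poly_Mapping.keys (p + q) \<subseteq> ?A" by (rule Poly_Mapping.keys_add)
  show ?thesis
    by (simp add: msubst_superset[OF * **] msubst_superset[OF *, of p]
        msubst_superset[OF *, of q] lookup_add mconst_add algebra_simps sum.distrib)
qed

lemma msubst_single:
  "msubst y (Poly_Mapping.single m c) =
     mconst c * (\<Prod>i\<in>Poly_Mapping.keys m. y i ^ Poly_Mapping.lookup m i)"
  by (subst msubst_superset[of "{m}"]) (auto simp: keys_single)

lemma msubst_mconst [simp]: "msubst y (mconst c) = mconst c"
  unfolding mconst_def by (simp add: msubst_single) (simp add: mconst_def)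

lemma msubst_mvar [simp]: "msubst y (mvar i) = y i"
  by (simp add: mvar_def msubst_single)

lemma monom_superset:
  fixes y :: "nat \<Rightarrow> 'a::field mpoly"
  assumes "finite A" "Poly_Mapping.keys m \<subseteq> A"
  shows "(\<Prod>i\<in>Poly_Mapping.keys m. y i ^ Poly_Mapping.lookup m i) =
    (\<Prod>i\<in>A. y i ^ Poly_Mapping.lookup m i)"
  by (rule prod.mono_neutral_left) (use assms in \<open>auto simp: in_keys_iff\<close>)

lemma monom_add:
  fixes y :: "nat \<Rightarrow> 'a::field mpoly"
  shows "(\<Prod>i\<in>Poly_Mapping.keys (m + m'). y i ^ Poly_Mapping.lookup (m + m') i) =
    (\<Prod>i\<in>Poly_Mapping.keys m. y i ^ Poly_Mapping.lookup m i) *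
    (\<Prod>i\<in>Poly_Mapping.keys m'. y i ^ Poly_Mapping.lookup m' i)"
proof -
  let ?A = "Poly_Mapping.keys m \<union> Poly_Mapping.keys m'"
  have *: "finite ?A" by simp
  have **: "Poly_Mapping.keys (m + m') \<subseteq> ?A" by (rule Poly_Mapping.keys_add)
  show ?thesis
    unfolding monom_superset[OF * **, of y] monom_superset[OF * Un_upper1, of y]
      monom_superset[OF * Un_upper2, of y]
    by (simp add: lookup_add power_add prod.distrib)
qed

lemma poly_mapping_induct_add [case_names zero add]:
  assumes "Q 0" and "\<And>m c p. Q p \<Longrightarrow> Q (Poly_Mapping.single m c + p)"
  shows "Q (p :: 'b \<Rightarrow>\<^sub>0 'c::comm_monoid_add)"
proof (induction p rule: update_induct)
  case const
  show ?case using assms(1) by simp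
next
  case (update p m c)
  have "Poly_Mapping.update m c p = Poly_Mapping.single m c + p"
    using update by (intro poly_mapping_eqI)
      (auto simp: lookup_update lookup_add lookup_single in_keys_iff when_def)
  then show ?case using assms(2) update by metis
qed

lemma msubst_mult: "msubst y (p * q) = msubst y p * msubst y q"
proof (induction p rule: poly_mapping_induct_add)
  case zero
  show ?case by simp
next
  case (add m c p)
  have "msubst y (Poly_Mapping.single m c * q) = msubst y (Poly_Mapping.single m c) * msubst y q"
  proof (induction q rule: poly_mapping_induct_add)
    case zero
    show ?case by simp
  next
    case (add m' c' q)
    have "msubst y (Poly_Mapping.single m c * Poly_Mapping.single m' c') =
        msubst y (Poly_Mapping.single m c) * msubst y (Poly_Mapping.single m' c')"
      by (simp add: mult_single msubst_single monom_add mconst_mult algebra_simps)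
    with add show ?case
      by (simp add: distrib_left msubst_add)
  qed
  with add show ?case
    by (simp add: distrib_right msubst_add)
qed

lemma msubst_1 [simp]: "msubst y 1 = 1"
  using msubst_mconst[of y 1] by simp

lemma ratfun_subst_Fract:
  assumes "b \<noteq> 0" "msubst y b \<noteq> 0"
  shows "ratfun_subst y (Fract a b) = Fract (msubst y a) (msubst y b)"
  unfolding ratfun_subst_def
proof (rule the_equality)
  fix g
  assume "\<exists>a' b'. b' \<noteq> 0 \<and> msubst y b' \<noteq> 0 \<and> Fract a b = Fract a' b' \<and>
    g = Fract (msubst y a') (msubst y b')"
  then obtain a' b' where *: "b' \<noteq> 0" "msubst y b' \<noteq> 0" "Fract a b = Fract a' b'"
    and g: "g = Fract (msubst y a') (msubst y b')" by blast
  from * assms have "a * b' = a' * b" by (simp add: eq_fract)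
  then have "msubst y a * msubst y b' = msubst y a' * msubst y b"
    by (metis msubst_mult)
  with * assms show "g = Fract (msubst y a) (msubst y b)"
    by (simp add: g eq_fract)
qed (use assms in blast)

lemma msubst_sum: "msubst y (sum f A) = (\<Sum>i\<in>A. msubst y (f i))"
  by (induction A rule: infinite_finite_induct) (simp_all add: msubst_add)

lemma msubst_prod: "msubst y (prod f A) = (\<Prod>i\<in>A. msubst y (f i))"
  by (induction A rule: infinite_finite_induct) (simp_all add: msubst_mult)

lemma msubst_power: "msubst y (p ^ k) = msubst y p ^ k"
  by (induction k) (simp_all add: msubst_mult)

lemma msubst_msubst: "msubst y (msubst z p) = msubst (\<lambda>i. msubst y (z i)) p"
  by (simp add: msubst_def[of z p] msubst_def[of _ p] msubst_sum msubst_prod msubst_power msubst_mult)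

lemma mvar_power: "mvar i ^ k = Poly_Mapping.single (Poly_Mapping.single i k) 1"
  by (induction k) (simp_all add: mvar_def mult_single single_add[symmetric])

lemma prod_single_1:
  "finite A \<Longrightarrow> (\<Prod>i\<in>A. Poly_Mapping.single (f i) (1::'a::field)) =
     (Poly_Mapping.single (\<Sum>i\<in>A. f i) 1 :: 'a mpoly)"
  by (induction A rule: finite_induct) (simp_all add: mult_single)

lemma msubst_mvar_id [simp]: "msubst mvar p = p"
proof (induction p rule: poly_mapping_induct_add)
  case (add m c p)
  have "(\<Sum>i\<in>Poly_Mapping.keys m. Poly_Mapping.single i (Poly_Mapping.lookup m i)) = m"
    by (intro poly_mapping_eqI)
      (auto simp: lookup_sum lookup_single when_def sum.delta in_keys_iff)
  then have "msubst mvar (Poly_Mapping.single m c) = Poly_Mapping.single m c"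
    by (simp add: msubst_single mvar_power prod_single_1 mult_single mconst_def)
  with add show ?case by (simp add: msubst_add)
qed simp

lemma linear_subst_eq_sum:
  assumes "T \<in> carrier_mat n n" "j < n"
  shows "linear_subst n T j = (\<Sum>i<n. mvar i * mconst (T $$ (i, j)))"
  using assms by (simp add: linear_subst_def mvar_vec_def scalar_prod_def lessThan_atLeast0)

lemma mconst_sum: "mconst (sum f A) = (\<Sum>i\<in>A. mconst (f i))"
  by (induction A rule: infinite_finite_induct) (simp_all add: mconst_add)

lemma msubst_linear_subst:
  assumes S: "S \<in> carrier_mat n n" and T: "T \<in> carrier_mat n n"
  shows "msubst (linear_subst n S) (linear_subst n T j) = linear_subst n (S * T) j"
proof (cases "j < n")
  case True
  have "msubst (linear_subst n S) (linear_subst n T j) =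
      (\<Sum>i<n. \<Sum>k<n. mvar k * (mconst (S $$ (k, i)) * mconst (T $$ (i, j))))"
    using S T True
    by (simp add: linear_subst_eq_sum msubst_sum msubst_mult sum_distrib_right mult.assoc)
  also have "\<dots> = (\<Sum>k<n. mvar k * mconst (\<Sum>i<n. S $$ (k, i) * T $$ (i, j)))"
    by (subst sum.swap) (simp add: mconst_sum mconst_mult sum_distrib_left)
  also have "\<dots> = linear_subst n (S * T) j"
    using S T True
    by (subst linear_subst_eq_sum[of "S * T"])
      (auto simp: scalar_prod_def lessThan_atLeast0)
  finally show ?thesis .
qed (simp add: linear_subst_def)

lemma linear_subst_one: "linear_subst n (1\<^sub>m n) = (mvar :: nat \<Rightarrow> 'a::field mpoly)"
proof
  fix j
  show "linear_subst n (1\<^sub>m n) j = (mvar j :: 'a mpoly)"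
  proof (cases "j < n")
    case True
    have "linear_subst n (1\<^sub>m n) j = (\<Sum>i<n. if i = j then mvar i else (0 :: 'a mpoly))"
      unfolding linear_subst_eq_sum[OF one_carrier_mat True]
      using True by (intro sum.cong) auto
    with True show ?thesis by simp
  qed (simp add: linear_subst_def)
qed

lemma msubst_linear_subst_eq_0_iff:
  assumes "T \<in> GL n"
  shows "msubst (linear_subst n T) p = 0 \<longleftrightarrow> p = 0"
proof -
  from assms have T: "T \<in> carrier_mat n n" and "invertible_mat T"
    by (auto simp: GL_def)
  then obtain S where TS: "T * S = 1\<^sub>m n" and "S * T = 1\<^sub>m (dim_row S)"
    by (auto simp: invertible_mat_def inverts_mat_def)
  then have "dim_col S = n" "dim_row S = n"
    using T by (metis carrier_matD index_mult_mat index_one_mat)+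
  then have S: "S \<in> carrier_mat n n" and ST: "S * T = 1\<^sub>m n"
    using \<open>S * T = 1\<^sub>m (dim_row S)\<close> by auto
  have "msubst (linear_subst n S) (msubst (linear_subst n T) p) = p"
    by (simp add: msubst_msubst msubst_linear_subst[OF S T] ST linear_subst_one)
  then show ?thesis by (metis msubst_0)
qed

lemma \<sigma>_Fract:
  assumes "T \<in> GL n" "b \<noteq> 0"
  shows "\<sigma> n T (Fract a b) = Fract (msubst (linear_subst n T) a) (msubst (linear_subst n T) b)"
  using assms by (simp add: \<sigma>_def ratfun_subst_Fract msubst_linear_subst_eq_0_iff)

end

theory Submission
  imports Defs "Jordan_Normal_Form.Determinant"
begin

text \<open>
  Let \<open>Q\<close> be the quadratic form with matrix \<open>G\<close>, let
  \<open>A\<close> be the matrix of its polar form, \<open>K\<close> the field of rational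
  functions and \<open>L\<close> the subfield generated by \<open>P\<^sub>n\<^sub>0, \<dots>,
  P\<^sub>n\<^sub>,\<^sub>n\<^sub>-\<^sub>1\<close>. Orthogonal matrices over the finite field
  preserve \<open>Q\<close> and its polar form and commute with Frobenius, so the generators
  are invariant.

  The converse rests on a rigidity statement: if a point \<open>Y\<close> satisfies
  \<open>P\<^sub>n\<^sub>k(Y) = P\<^sub>n\<^sub>k(X)\<close> for all \<open>k < n\<close>,
  then \<open>Y = X T\<close> for an orthogonal matrix \<open>T\<close> over the finite field,
  up to splitting the ring of coefficients into a product. An invariant function therefore
  cannot distinguish \<open>X\<close> from \<open>Y\<close>. This is applied to the generic
  such point. If \<open>a / b\<close> does not lie in \<open>L\<close>, an
  \<open>L\<close>-linear functional on \<open>K\<close> that kills \<open>b\<close> but not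
  \<open>a\<close> yields an ideal \<open>I\<close> of \<open>K[Y]\<close> that contains all
  \<open>P\<^sub>n\<^sub>k(Y) - P\<^sub>n\<^sub>k(X)\<close>, but not \<open>b(X) a(Y) - a(X)
  b(Y)\<close> (lemma \<open>separating_ideal\<close>). For invariant \<open>a / b\<close>
  this is impossible (lemma \<open>invariant_in_relation_ideal\<close>). The ideal
  \<open>I\<close> need not be prime, so the arguments about isometries of quadratic spaces
  are carried out as congruences between matrices over \<open>K[Y]\<close>.

  For the rigidity, let \<open>M\<close> and \<open>C\<close> be the matrices whose rows are
  the vectors of \<open>q\<^sup>i\<close>-th powers of \<open>X\<close> and \<open>Y\<close>.
  The matrix \<open>M\<close> is invertible (lemma \<open>moore_det_nonzero\<close>). The
  relations say that the two families of rows have the same Gram data for \<open>Q\<close>, so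
  \<open>T = M\<^sup>-\<^sup>1 C\<close> is an isometry. Its Frobenius image
  \<open>T\<^sup>(\<^sup>q\<^sup>)\<close> is \<open>R T\<close> for an isometry
  \<open>R\<close> that fixes the vectors of \<open>q\<^sup>i\<close>-th powers of
  \<open>X\<close> with \<open>0 < i < n\<close>, and such an \<open>R\<close> is the identity
  or a reflection. In characteristic two the determinant does not exclude the reflection. The
  Dickson invariant does: it is given by a polynomial with coefficients in the finite field
  and takes idempotent values (lemma \<open>dickson_idempotent\<close>), so \<open>T\<close>
  and \<open>T\<^sup>(\<^sup>q\<^sup>)\<close> have the same invariant, whereas a reflection
  changes it (lemma \<open>mcong_of_dickson\<close>). Hence \<open>t\<^sup>q = t\<close>
  modulo \<open>I\<close> for all entries \<open>t\<close> of \<open>T\<close>. After passing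
  to a larger ideal that still avoids a given element outside of \<open>I\<close>, all entries
  are constants in the finite field (lemma \<open>split_ideal_finite\<close>).
\<close>

section \<open>Congruences modulo an ideal in characteristic two\<close>

text \<open>
  In characteristic two the terms off the diagonal cancel in pairs as soon as \<open>f\<close>
  is symmetric; all the vanishing statements for alternate matrices below come from this
  splitting.
\<close>

lemma sum_square_split:
  fixes f :: "nat \<Rightarrow> nat \<Rightarrow> 'b::comm_monoid_add"
  shows "(\<Sum>i<n. \<Sum>j<n. f i j) = (\<Sum>i<n. f i i) + (\<Sum>j<n. \<Sum>i<j. f i j + f j i)"
proof (induction n)
  case (Suc n)
  have "(\<Sum>i<Suc n. \<Sum>j<Suc n. f i j) =
      (\<Sum>i<n. \<Sum>j<n. f i j) + ((\<Sum>i<n. f i n) + (\<Sum>j<n. f n j) + f n n)"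
    by (simp add: sum.distrib ac_simps)
  also have "\<dots> = (\<Sum>i<Suc n. f i i) + (\<Sum>j<Suc n. \<Sum>i<j. f i j + f j i)"
    by (simp add: Suc.IH sum.distrib ac_simps)
  finally show ?case .
qed simp

definition mat_trace :: "'b::comm_ring_1 mat \<Rightarrow> 'b" where
  "mat_trace B = (\<Sum>i<dim_row B. B $$ (i, i))"

lemma mat_trace_add:
  "B \<in> carrier_mat n n \<Longrightarrow> C \<in> carrier_mat n n \<Longrightarrow> mat_trace (B + C) = mat_trace B + mat_trace C"
  by (auto simp: mat_trace_def sum.distrib)

lemma mat_mult_index:
  fixes B :: "'b::comm_ring_1 mat"
  assumes "B \<in> carrier_mat n n" "C \<in> carrier_mat n n" "i < n" "j < n"
  shows "(B * C) $$ (i, j) = (\<Sum>k<n. B $$ (i, k) * C $$ (k, j))"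
  using assms by (auto simp: scalar_prod_def lessThan_atLeast0)

lemma mat_trace_mult:
  assumes "B \<in> carrier_mat n n" "C \<in> carrier_mat n n"
  shows "mat_trace (B * C) = (\<Sum>i<n. \<Sum>j<n. B $$ (i, j) * C $$ (j, i))"
proof -
  have "dim_row (B * C) = n" using assms by simp
  then show ?thesis
    by (simp only: mat_trace_def) (rule sum.cong; simp add: mat_mult_index[OF assms])
qed

lemma mat_trace_comm:
  assumes "B \<in> carrier_mat n n" "C \<in> carrier_mat n n"
  shows "mat_trace (B * C) = mat_trace (C * B)"
  unfolding mat_trace_mult[OF assms] mat_trace_mult[OF assms(2,1)]
  by (subst sum.swap) (simp add: mult.commute)

lemma mat_trace_transpose:
  "B \<in> carrier_mat n n \<Longrightarrow> mat_trace (transpose_mat B) = mat_trace B"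
  by (simp add: mat_trace_def)

text \<open>
  Computations in a quotient ring \<open>R / I\<close> of characteristic two are written as
  congruences between elements of \<open>R\<close>, because several ideals of the same ring
  are compared later. The number \<open>n\<close> is the size of the matrices.
\<close>

locale ideal_char_two =
  fixes I :: "'r::comm_ring_1 set" and n :: nat
  assumes two: "(1::'r) + 1 = 0"
    and zero_mem [simp]: "0 \<in> I"
    and add_mem: "x \<in> I \<Longrightarrow> y \<in> I \<Longrightarrow> x + y \<in> I"
    and mult_mem: "x \<in> I \<Longrightarrow> r * x \<in> I"
begin

lemma add_self [simp]: "(x::'r) + x = 0"
proof -
  have "x + x = (1 + 1) * x" by (simp add: distrib_right)
  then show ?thesis by (simp only: two mult_zero_left)
qed

lemma add_self_left [simp]: "(x::'r) + (x + y) = y"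
  by (simp add: add.assoc[symmetric])

lemma uminus_char_two [simp]: "- (x::'r) = x"
  by (rule minus_unique) simp

lemma minus_char_two [simp]: "(x::'r) - y = x + y"
  by (simp only: diff_conv_add_uminus uminus_char_two)

lemma mult_mem_right: "x \<in> I \<Longrightarrow> x * r \<in> I"
  using mult_mem[of x r] by (simp add: mult.commute)

lemma sum_mem: "(\<And>i. i \<in> S \<Longrightarrow> f i \<in> I) \<Longrightarrow> sum f S \<in> I"
  by (induction S rule: infinite_finite_induct) (auto intro: add_mem)

lemma power_mem: "x \<in> I \<Longrightarrow> k > 0 \<Longrightarrow> x ^ k \<in> I"
  by (cases k) (auto intro: mult_mem_right)

definition cong :: "'r \<Rightarrow> 'r \<Rightarrow> bool" (infix \<open>\<sim>\<close> 50) where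
  "x \<sim> y \<longleftrightarrow> x + y \<in> I"

lemma cong_refl [simp]: "x \<sim> x"
  by (simp add: cong_def)

lemma cong_sym: "x \<sim> y \<Longrightarrow> y \<sim> x"
  by (simp add: cong_def add.commute)

lemma cong_trans [trans]: "x \<sim> y \<Longrightarrow> y \<sim> z \<Longrightarrow> x \<sim> z"
  using add_mem[of "x + y" "y + z"] by (simp add: cong_def add.assoc)

lemma cong_0_iff: "x \<sim> 0 \<longleftrightarrow> x \<in> I"
  by (simp add: cong_def)

lemma cong_add: "x \<sim> x' \<Longrightarrow> y \<sim> y' \<Longrightarrow> x + y \<sim> x' + y'"
  by (drule (1) add_mem[of "x + x'" "y + y'", folded cong_def]) (simp add: cong_def ac_simps)

lemma cong_mult: "x \<sim> x' \<Longrightarrow> y \<sim> y' \<Longrightarrow> x * y \<sim> x' * y'"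
proof -
  assume "x \<sim> x'" "y \<sim> y'"
  then have "y * (x + x') + x' * (y + y') \<in> I"
    unfolding cong_def by (rule add_mem[OF mult_mem mult_mem])
  moreover have "y * (x + x') + x' * (y + y') = x * y + x' * y'"
    by (simp add: algebra_simps)
  ultimately show ?thesis by (simp add: cong_def)
qed

lemma cong_sum: "(\<And>i. i \<in> S \<Longrightarrow> f i \<sim> g i) \<Longrightarrow> sum f S \<sim> sum g S"
  by (induction S rule: infinite_finite_induct) (auto intro: cong_add)

lemma cong_prod: "(\<And>i. i \<in> S \<Longrightarrow> f i \<sim> g i) \<Longrightarrow> prod f S \<sim> prod g S"
  by (induction S rule: infinite_finite_induct) (auto intro: cong_mult)

lemma cong_power: "x \<sim> y \<Longrightarrow> x ^ k \<sim> y ^ k"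
  by (induction k) (auto intro: cong_mult)

lemma cong_mem: "x \<sim> y \<Longrightarrow> y \<in> I \<Longrightarrow> x \<in> I"
  using add_mem[of "x + y" y] by (simp add: cong_def add.assoc)

abbreviation Mats :: "'r mat set" where "Mats \<equiv> carrier_mat n n"

lemma Mats_mult [simp]: "B \<in> Mats \<Longrightarrow> C \<in> Mats \<Longrightarrow> B * C \<in> Mats"
  by (rule mult_carrier_mat)

lemma one_smult_mat [simp]: "(1::'r) \<cdot>\<^sub>m B = B"
  by auto

definition mcong :: "'r mat \<Rightarrow> 'r mat \<Rightarrow> bool" (infix \<open>\<approx>\<close> 50) where
  "B \<approx> C \<longleftrightarrow> B \<in> Mats \<and> C \<in> Mats \<and> (\<forall>i<n. \<forall>j<n. B $$ (i, j) \<sim> C $$ (i, j))"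

lemma mcong_refl [simp]: "B \<in> Mats \<Longrightarrow> B \<approx> B"
  by (simp add: mcong_def)

lemma mcong_sym: "B \<approx> C \<Longrightarrow> C \<approx> B"
  by (auto simp: mcong_def intro: cong_sym)

lemma mcong_trans [trans]: "B \<approx> C \<Longrightarrow> C \<approx> Z \<Longrightarrow> B \<approx> Z"
  unfolding mcong_def by (blast intro: cong_trans)

lemma mcong_carrier: "B \<approx> C \<Longrightarrow> B \<in> Mats" "B \<approx> C \<Longrightarrow> C \<in> Mats"
  by (auto simp: mcong_def)

lemma mcong_add: "B \<approx> B' \<Longrightarrow> C \<approx> C' \<Longrightarrow> B + C \<approx> B' + C'"
  by (auto simp: mcong_def intro!: cong_add)

lemma mcong_mult: "B \<approx> B' \<Longrightarrow> C \<approx> C' \<Longrightarrow> B * C \<approx> B' * C'"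
  unfolding mcong_def
  by (auto simp: mat_mult_index simp del: index_mult_mat(1) intro!: cong_sum cong_mult)

lemma mcong_transpose: "B \<approx> C \<Longrightarrow> transpose_mat B \<approx> transpose_mat C"
  by (auto simp: mcong_def)

lemma mcong_smult: "x \<sim> y \<Longrightarrow> B \<approx> C \<Longrightarrow> x \<cdot>\<^sub>m B \<approx> y \<cdot>\<^sub>m C"
  by (auto simp: mcong_def intro!: cong_mult)

lemma mcong_trace: "B \<approx> C \<Longrightarrow> mat_trace B \<sim> mat_trace C"
  by (auto simp: mcong_def mat_trace_def intro!: cong_sum)

lemma mcong_det:
  assumes "B \<approx> C" shows "det B \<sim> det C"
proof -
  have *: "signof p * (\<Prod>i = 0..<n. B $$ (i, p i)) \<sim> signof p * (\<Prod>i = 0..<n. C $$ (i, p i))"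
    if p: "p permutes {0..<n}" for p
  proof (intro cong_mult cong_refl cong_prod)
    fix i assume i: "i \<in> {0..<n}"
    then have "p i < n" using p permutes_in_image by fastforce
    with i assms show "B $$ (i, p i) \<sim> C $$ (i, p i)" by (simp add: mcong_def)
  qed
  show ?thesis
    unfolding det_def'[OF mcong_carrier(1)[OF assms]] det_def'[OF mcong_carrier(2)[OF assms]]
    by (rule cong_sum) (use * in auto)
qed

text \<open>
  The usual argument with the adjugate works modulo \<open>I\<close>: the determinants of
  \<open>B\<close> and \<open>C\<close> are inverse to each other, so that \<open>adj
  B\<close> is \<open>det B\<close> times \<open>C\<close>.
\<close>

lemma left_inverse_of_right_inverse:
  assumes B: "B \<in> Mats" and C: "C \<in> Mats" and BC: "B * C \<approx> 1\<^sub>m n"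
  shows "C * B \<approx> 1\<^sub>m n"
proof -
  have adj: "adj_mat B \<in> Mats" "B * adj_mat B = det B \<cdot>\<^sub>m 1\<^sub>m n" "adj_mat B * B = det B \<cdot>\<^sub>m 1\<^sub>m n"
    using adj_mat[OF B] by auto
  have d: "det B * det C \<sim> 1"
    using mcong_det[OF BC] det_mult[OF B C] by simp
  have "adj_mat B \<approx> adj_mat B * (B * C)"
    using mcong_mult[OF mcong_refl[OF adj(1)] mcong_sym[OF BC]] adj(1) by simp
  also have "adj_mat B * (B * C) = det B \<cdot>\<^sub>m C"
    using B C adj
    by (simp add: assoc_mult_mat[symmetric, of _ n n _ n _ n] mult_smult_assoc_mat[of _ n n _ n]
        del: assoc_mult_mat)
  finally have a: "adj_mat B \<approx> det B \<cdot>\<^sub>m C" .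
  have "C * B \<approx> (det B * det C) \<cdot>\<^sub>m (C * B)"
    using mcong_smult[OF cong_sym[OF d] mcong_refl[of "C * B"]] B C by simp
  also have "(det B * det C) \<cdot>\<^sub>m (C * B) = det C \<cdot>\<^sub>m ((det B \<cdot>\<^sub>m C) * B)"
    using B C by (auto simp: algebra_simps)
  also have "\<dots> \<approx> det C \<cdot>\<^sub>m (adj_mat B * B)"
    by (intro mcong_smult mcong_mult mcong_sym[OF a] cong_refl mcong_refl B)
  also have "\<dots> = (det B * det C) \<cdot>\<^sub>m 1\<^sub>m n"
    by (auto simp: adj(3))
  also have "\<dots> \<approx> 1 \<cdot>\<^sub>m 1\<^sub>m n"
    by (intro mcong_smult d mcong_refl) simp
  finally show ?thesis by simp
qed

text \<open>
  Alternate modulo \<open>I\<close>: since \<open>- x = x\<close>, antisymmetry is symmetry,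
  and what separates alternate from symmetric matrices is the condition on the diagonal.
\<close>

definition alt :: "'r mat \<Rightarrow> bool" where
  "alt N \<longleftrightarrow> N \<in> Mats \<and> (\<forall>i<n. N $$ (i, i) \<in> I) \<and> (\<forall>i<n. \<forall>j<n. N $$ (i, j) \<sim> N $$ (j, i))"

lemma alt_carrier: "alt N \<Longrightarrow> N \<in> Mats" by (simp add: alt_def)

lemma altI:
  "transpose_mat N \<approx> N \<Longrightarrow> (\<And>i. i < n \<Longrightarrow> N $$ (i, i) \<in> I) \<Longrightarrow> alt N"
  by (auto simp: alt_def mcong_def intro: cong_sym)

lemma alt_sym: "alt N \<Longrightarrow> transpose_mat N \<approx> N"
  by (auto simp: alt_def mcong_def)

lemma alt_add: "alt N \<Longrightarrow> alt N' \<Longrightarrow> alt (N + N')"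
  by (auto simp: alt_def intro!: add_mem cong_add)

lemma alt_bilinear_mem:
  assumes N: "alt N" and s: "\<And>i j. i < n \<Longrightarrow> j < n \<Longrightarrow> s i j \<sim> s j i"
  shows "(\<Sum>i<n. \<Sum>j<n. N $$ (i, j) * s i j) \<in> I"
  unfolding sum_square_split
proof (rule add_mem; (rule sum_mem)+)
  fix i assume "i \<in> {..<n}"
  then show "N $$ (i, i) * s i i \<in> I" using N by (auto simp: alt_def intro: mult_mem_right)
next
  fix i j assume "j \<in> {..<n}" "i \<in> {..<j}"
  then have ij: "i < n" "j < n" by auto
  have "N $$ (i, j) * s i j \<sim> N $$ (j, i) * s j i"
    using N s ij by (intro cong_mult) (auto simp: alt_def)
  then show "N $$ (i, j) * s i j + N $$ (j, i) * s j i \<in> I" by (simp add: cong_def)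
qed

text \<open>
  An alternate and a symmetric matrix are orthogonal for the trace form. This is the source of
  all identities for the Dickson invariant.
\<close>

lemma alt_trace_mem:
  assumes "alt N" and "transpose_mat S \<approx> S"
  shows "mat_trace (N * S) \<in> I"
proof -
  have S: "S \<in> Mats" using mcong_carrier[OF assms(2)] by simp
  show ?thesis
    unfolding mat_trace_mult[OF alt_carrier[OF assms(1)] S]
  proof (rule alt_bilinear_mem[OF assms(1)])
    fix i j assume "i < n" "j < n"
    then show "S $$ (j, i) \<sim> S $$ (i, j)"
      using assms(2) S by (auto simp: mcong_def)
  qed
qed

lemma transpose_triple:
  assumes "P \<in> Mats" "B \<in> Mats" "R \<in> Mats"
  shows "transpose_mat (P * B * R) = transpose_mat R * transpose_mat B * transpose_mat P"
  using assms by (simp add: transpose_mult[of _ n n _ n] assoc_mult_mat[of _ n n _ n _ n])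

lemma alt_congruence:
  assumes N: "alt N" and P: "P \<in> Mats"
  shows "alt (P * N * transpose_mat P)"
proof -
  have NC: "N \<in> Mats" using N by (rule alt_carrier)
  have "transpose_mat (P * N * transpose_mat P) = P * transpose_mat N * transpose_mat P"
    using P NC by (simp only: transpose_triple transpose_carrier_mat transpose_transpose)
  also have "\<dots> \<approx> P * N * transpose_mat P"
    using P by (intro mcong_mult mcong_refl alt_sym N) auto
  finally have sym: "transpose_mat (P * N * transpose_mat P) \<approx> P * N * transpose_mat P" .
  have "(P * N * transpose_mat P) $$ (i, i) \<in> I" if i: "i < n" for i
  proof -
    have "(P * N * transpose_mat P) $$ (i, i) = (\<Sum>l<n. (P * N) $$ (i, l) * P $$ (i, l))"
      using P NC i by (subst mat_mult_index[of _ n]) auto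
    also have "\<dots> = (\<Sum>l<n. \<Sum>k<n. N $$ (k, l) * (P $$ (i, k) * P $$ (i, l)))"
    proof (rule sum.cong[OF refl])
      fix l assume "l \<in> {..<n}"
      then have "(P * N) $$ (i, l) = (\<Sum>k<n. P $$ (i, k) * N $$ (k, l))"
        using mat_mult_index[OF P NC i] by simp
      then show "(P * N) $$ (i, l) * P $$ (i, l) =
          (\<Sum>k<n. N $$ (k, l) * (P $$ (i, k) * P $$ (i, l)))"
        by (simp only: sum_distrib_right) (simp only: ac_simps)
    qed
    also have "\<dots> = (\<Sum>k<n. \<Sum>l<n. N $$ (k, l) * (P $$ (i, k) * P $$ (i, l)))"
      by (rule sum.swap)
    also have "\<dots> \<in> I"
      by (rule alt_bilinear_mem[OF N]) (simp add: mult.commute)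
    finally show ?thesis .
  qed
  with sym show ?thesis by (intro altI)
qed

lemma trace_square:
  assumes "B \<in> Mats"
  shows "mat_trace B * mat_trace B = mat_trace (B * B)"
proof -
  have "mat_trace B * mat_trace B = (\<Sum>i<n. \<Sum>j<n. B $$ (i, i) * B $$ (j, j))"
    using assms by (simp add: mat_trace_def sum_product)
  also have "\<dots> = (\<Sum>i<n. B $$ (i, i) * B $$ (i, i))"
    unfolding sum_square_split by (simp add: mult.commute)
  also have "\<dots> = mat_trace (B * B)"
    unfolding mat_trace_mult[OF assms assms] sum_square_split by (simp add: mult.commute)
  finally show ?thesis .
qed

end


section \<open>Isometries of a quadratic form and the Dickson invariant\<close>

context ideal_char_two begin

lemmas mat_distribs =
  assoc_mult_mat[of _ n n _ n _ n] add_mult_distrib_mat[of _ n n _ _ n]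
  mult_add_distrib_mat[of _ n n _ n] left_mult_one_mat[of _ n n] right_mult_one_mat[of _ n n]
  left_mult_zero_mat[where nr = n and n = n and nc = n] right_mult_zero_mat[where nr = n and n = n and nc = n]
  right_add_zero_mat[of _ n n]

lemmas mat_transposes = transpose_mult[of _ n n _ n] transpose_add[of _ n n]

lemma mat_add_self: "B \<in> Mats \<Longrightarrow> B + B = 0\<^sub>m n n"
  by auto

lemma mat_add_cancel: "B \<in> Mats \<Longrightarrow> C \<in> Mats \<Longrightarrow> B + (B + C) = C"
  by auto

lemma mcong_add_swap: "B + C \<approx> 0\<^sub>m n n \<Longrightarrow> B \<in> Mats \<Longrightarrow> C \<in> Mats \<Longrightarrow> B \<approx> C"
  unfolding mcong_def cong_def by auto

lemma isometry_of_alt: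
  assumes G: "G \<in> Mats" and T: "T \<in> Mats" and E: "E \<in> Mats"
    and alt: "alt (T * G * transpose_mat T + E)"
  shows "T * (G + transpose_mat G) * transpose_mat T \<approx> E + transpose_mat E"
proof -
  let ?N = "T * G * transpose_mat T + E"
  have N: "?N \<in> Mats" using G T E by simp
  have "?N + transpose_mat ?N \<approx> ?N + ?N"
    by (intro mcong_add mcong_refl N alt_sym alt)
  also have "?N + ?N = 0\<^sub>m n n" by (rule mat_add_self[OF N])
  also have "?N + transpose_mat ?N =
      T * (G + transpose_mat G) * transpose_mat T + (E + transpose_mat E)"
  proof -
    have "transpose_mat ?N = T * transpose_mat G * transpose_mat T + transpose_mat E"
      using G T E by (simp add: mat_transposes mat_distribs)
    moreover have "T * (G + transpose_mat G) * transpose_mat T =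
        T * G * transpose_mat T + T * transpose_mat G * transpose_mat T"
      using G T by (simp add: mat_distribs)
    ultimately show ?thesis
      using G T E by (intro eq_matI) (auto simp del: index_mult_mat(1))
  qed
  finally show ?thesis
    by (rule mcong_add_swap) (use G T E in simp_all)
qed
end

text \<open>
  \<open>G\<close> is the matrix of a quadratic form and \<open>A\<close> that of its polar
  form. As \<open>A\<close> is its own inverse, \<open>P = A G A\<close> is the matrix of the
  form transported to the dual space, and \<open>P\<close> plus its transpose is the inverse
  of \<open>A\<close>.
\<close>

locale form_char_two = ideal_char_two I n
  for I :: "'r::comm_ring_1 set" and n :: nat +
  fixes G A P :: "'r mat"
  defines "A \<equiv> G + transpose_mat G" and "P \<equiv> A * G * A"
  assumes G [simp]: "G \<in> Mats" and A_square: "A * A = 1\<^sub>m n"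
begin

lemma A [simp]: "A \<in> Mats" and P [simp]: "P \<in> Mats"
  by (simp_all add: A_def P_def)

lemma transpose_A: "transpose_mat A = A"
  by (simp add: A_def mat_transposes comm_add_mat[of _ n n])

lemma A_square_left: "B \<in> Mats \<Longrightarrow> A * (A * B) = B"
  by (simp add: assoc_mult_mat[of _ n n _ n _ n, symmetric] A_square del: assoc_mult_mat)

lemma transpose_G: "transpose_mat G = G + A"
  by (simp add: A_def mat_add_cancel)

lemma transpose_P: "transpose_mat P = P + A"
proof -
  have "transpose_mat P = A * (G + A) * A"
    by (simp only: P_def transpose_triple transpose_A transpose_G A G)
  then show ?thesis by (simp add: P_def mat_distribs A_square)
qed

definition isom :: "'r mat \<Rightarrow> bool" where
  "isom T \<longleftrightarrow> T \<in> Mats \<and> alt (T * G * transpose_mat T + G)"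

text \<open>
  The Dickson invariant as a polynomial in the entries of \<open>T\<close>. For isometries it
  is the scalar by which \<open>T\<close> moves a generator of the centre of the even Clifford
  algebra. On isometries, \<open>P\<close> may be replaced by any matrix \<open>J\<close> for
  which \<open>J\<close> plus its transpose is \<open>A\<close>, because this changes
  \<open>P\<close> by a symmetric matrix.
\<close>

definition dickson :: "'r mat \<Rightarrow> 'r" where
  "dickson T = mat_trace ((T * G * transpose_mat T + G) * P)"

lemma isom_bilinear: "isom T \<Longrightarrow> T * A * transpose_mat T \<approx> A"
  unfolding isom_def A_def using isometry_of_alt[of G T G] by auto

lemma isom_left_inverse:
  assumes "isom T"
  shows "A * transpose_mat T * A * T \<approx> 1\<^sub>m n"
proof (rule left_inverse_of_right_inverse)
  show T: "T \<in> Mats" using assms by (simp add: isom_def)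
  show "A * transpose_mat T * A \<in> Mats" using T by simp
  have "T * (A * transpose_mat T * A) = T * A * transpose_mat T * A"
    using T by (simp add: mat_distribs)
  also have "\<dots> \<approx> A * A"
    by (intro mcong_mult isom_bilinear assms mcong_refl A)
  finally show "T * (A * transpose_mat T * A) \<approx> 1\<^sub>m n" by (simp add: A_square)
qed

text \<open>
  Put \<open>g = G A\<close> and \<open>h = T g T\<^sup>-\<^sup>1\<close>, so that the
  invariant is the trace of \<open>(h + g) g\<close> and the powers of \<open>h\<close> and
  \<open>g\<close> have the same traces. Orthogonality of alternate and symmetric matrices is
  used twice: it reduces the square of the invariant, which consists of traces of words of
  length four in \<open>g\<close> and \<open>h\<close>, to the traces of \<open>h h g\<close>
  and \<open>g g g\<close>, and it then expresses the former by the trace of \<open>h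
  g\<close> and those of powers of \<open>h\<close>.
\<close>

lemma dickson_idempotent:
  assumes "isom T"
  shows "dickson T * dickson T \<sim> dickson T"
proof -
  have T [simp]: "T \<in> Mats" using assms by (simp add: isom_def)
  define H where "H = T * G * transpose_mat T"
  have H [simp]: "H \<in> Mats" by (simp add: H_def)
  define N where "N = H + G"
  have N [simp]: "N \<in> Mats" by (simp add: N_def)
  have altN: "alt N" using assms by (simp add: isom_def N_def H_def)
  define g where "g = G * A"
  define h where "h = H * A"
  have gh [simp]: "g \<in> Mats" "h \<in> Mats" by (simp_all add: g_def h_def)
  have NA: "N * A = h + g" by (simp add: N_def g_def h_def mat_distribs)
  have "N * P = (N * A) * g" by (simp add: P_def g_def mat_distribs)
  then have NP: "N * P = (h + g) * g" by (simp only: NA)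
  have D: "dickson T = mat_trace (h * g) + mat_trace (g * g)"
    unfolding dickson_def H_def[symmetric] N_def[symmetric] NP by (simp add: mat_distribs mat_trace_add[of _ n])
  have D2: "dickson T * dickson T = mat_trace ((N * P) * (N * P))"
    unfolding dickson_def H_def[symmetric] N_def[symmetric] by (simp add: trace_square)
  (* N is symmetric and its congruence transform by P is alternate; the transpose of P is P + A. *)
  have "mat_trace (N * (P * N * transpose_mat P)) \<in> I"
    by (intro alt_trace_mem alt_sym alt_congruence altN P)
  also have "N * (P * N * transpose_mat P) = (N * P) * (N * P) + (N * P) * (N * A)"
    by (simp add: transpose_P mat_distribs)
  finally have e1: "mat_trace ((N * P) * (N * P)) \<sim> mat_trace ((N * P) * (N * A))"
    by (simp add: cong_def mat_trace_add[of _ n])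
  have e2: "mat_trace ((N * P) * (N * A)) = mat_trace (h * (h * g)) + mat_trace (g * (g * g))"
  proof -
    have "mat_trace ((N * P) * (N * A)) = mat_trace ((h + g) * ((h + g) * g))"
      unfolding NP NA by (rule mat_trace_comm[of _ n]) simp_all
    moreover have "mat_trace (h * (g * g)) = mat_trace (g * (h * g))"
      using mat_trace_comm[of "h * g" n g] by (simp add: mat_distribs)
    ultimately show ?thesis by (simp add: mat_distribs mat_trace_add[of _ n] ac_simps)
  qed
  (* H A H^t is symmetric, and H^t is H + A modulo I. *)
  have "mat_trace (N * (A * (H * A * transpose_mat H) * A)) \<in> I"
    by (rule alt_trace_mem[OF altN]) (simp add: transpose_A mat_transposes mat_distribs)
  moreover have "mat_trace (N * (A * (H * A * transpose_mat H) * A)) \<sim>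
      mat_trace (N * (A * (H * A * (H + A)) * A))"
  proof -
    have "transpose_mat H = transpose_mat (N + G)"
      by (simp add: N_def comm_add_mat[of G n n] assoc_add_mat[of _ n n] mat_add_self)
    also have "\<dots> = transpose_mat N + (G + A)"
      by (simp add: mat_transposes transpose_G)
    also have "\<dots> \<approx> N + (G + A)"
      by (intro mcong_add alt_sym altN mcong_refl) simp
    also have "N + (G + A) = H + A"
      using H G A unfolding N_def
      by (intro eq_matI) (auto simp: ac_simps simp del: H G A index_mult_mat(1))
    finally show ?thesis by (intro mcong_trace mcong_mult mcong_refl) simp_all
  qed
  moreover have "mat_trace (N * (A * (H * A * (H + A)) * A)) =
      mat_trace (h * (h * h)) + mat_trace (h * h) + mat_trace (h * (h * g)) + mat_trace (h * g)"
  proof -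
    have "N * (A * (H * A * (H + A)) * A) = (N * A) * (h * h + h)"
      unfolding h_def by (simp add: mat_distribs A_square)
    moreover have "mat_trace (g * (h * h)) = mat_trace (h * (h * g))" "mat_trace (g * h) = mat_trace (h * g)"
      using mat_trace_comm[of g n "h * h"] mat_trace_comm[of g n h] by (simp_all add: mat_distribs)
    ultimately show ?thesis by (simp add: NA mat_distribs mat_trace_add[of _ n] ac_simps)
  qed
  ultimately have e3: "mat_trace (h * (h * h)) + mat_trace (h * h) + mat_trace (h * (h * g)) + mat_trace (h * g) \<in> I"
    using cong_mem cong_sym by metis
  define S where "S = A * transpose_mat T * A"
  have S [simp]: "S \<in> Mats" by (simp add: S_def)
  have ST: "S * T \<approx> 1\<^sub>m n" unfolding S_def by (rule isom_left_inverse[OF assms])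
  (* S is the inverse of T modulo I, so h and g are conjugate. *)
  have h_conj: "h = T * g * S"
    by (simp add: h_def H_def g_def S_def mat_distribs A_square_left)
  have "mat_trace (h * h) = mat_trace ((S * T) * g * ((S * T) * g))"
    using mat_trace_comm[of "T * g * S * T * g" n S] by (simp add: h_conj mat_distribs)
  also have "\<dots> \<sim> mat_trace (1\<^sub>m n * g * (1\<^sub>m n * g))"
    by (intro mcong_trace mcong_mult mcong_refl ST) simp_all
  finally have e4: "mat_trace (h * h) \<sim> mat_trace (g * g)" by (simp add: mat_distribs)
  have "mat_trace (h * (h * h)) = mat_trace ((S * T) * g * ((S * T) * g * ((S * T) * g)))"
    using mat_trace_comm[of "T * g * S * T * g * S * T * g" n S] by (simp add: h_conj mat_distribs)
  also have "\<dots> \<sim> mat_trace (1\<^sub>m n * g * (1\<^sub>m n * g * (1\<^sub>m n * g)))"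
    by (intro mcong_trace mcong_mult mcong_refl ST) simp_all
  finally have e5: "mat_trace (h * (h * h)) \<sim> mat_trace (g * (g * g))" by (simp add: mat_distribs)
  have "dickson T * dickson T + dickson T =
     (mat_trace ((N * P) * (N * P)) + mat_trace ((N * P) * (N * A))) +
     (mat_trace (h * (h * h)) + mat_trace (h * h) + mat_trace (h * (h * g)) + mat_trace (h * g)) +
     (mat_trace (h * h) + mat_trace (g * g)) + (mat_trace (h * (h * h)) + mat_trace (g * (g * g)))"
    unfolding D2 unfolding D e2 by (simp add: ac_simps)
  also have "\<dots> \<in> I"
    using e1 e3 e4 e5 unfolding cong_def by (blast intro: add_mem)
  finally show ?thesis by (simp add: cong_def)
qed

end


section \<open>Isometries that agree on a hyperplane\<close>

context ideal_char_two begin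

lemma alt_trace: "alt N \<Longrightarrow> mat_trace N \<in> I"
  by (auto simp: alt_def mat_trace_def intro!: sum_mem)

lemma mcong_smult_zero: "c \<in> I \<Longrightarrow> B \<in> Mats \<Longrightarrow> c \<cdot>\<^sub>m B \<approx> 0\<^sub>m n n"
  by (auto simp: mcong_def cong_def intro: mult_mem_right)

lemma mat_trace_smult: "B \<in> Mats \<Longrightarrow> mat_trace (c \<cdot>\<^sub>m B) = c * mat_trace B"
  by (auto simp: mat_trace_def sum_distrib_left)

lemma transpose_smult: "transpose_mat (c \<cdot>\<^sub>m B) = c \<cdot>\<^sub>m transpose_mat B"
  by auto

text \<open>
  The matrix unit at position \<open>(0, 0)\<close>. Multiplication with it turns rows,
  columns and scalars into square matrices, which keeps all products within one size.
\<close>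

definition corner :: "'r mat" where
  "corner = mat n n (\<lambda>(i, j). if i = 0 \<and> j = 0 then 1 else 0)"

lemma corner [simp]: "corner \<in> Mats" "transpose_mat corner = corner"
  by (auto simp: corner_def)

lemma corner_mult_index:
  assumes "B \<in> Mats" "i < n" "j < n"
  shows "(corner * B) $$ (i, j) = (if i = 0 then B $$ (0, j) else 0)"
    and "(B * corner) $$ (i, j) = (if j = 0 then B $$ (i, 0) else 0)"
proof -
  have "(\<Sum>k<n. corner $$ (i, k) * B $$ (k, j)) = (\<Sum>k<n. if k = 0 then (if i = 0 then B $$ (0, j) else 0) else 0)"
    using assms by (intro sum.cong) (auto simp: corner_def)
  then show "(corner * B) $$ (i, j) = (if i = 0 then B $$ (0, j) else 0)"
    using mat_mult_index[OF corner(1) assms] assms by simp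
  have "(\<Sum>k<n. B $$ (i, k) * corner $$ (k, j)) = (\<Sum>k<n. if k = 0 then (if j = 0 then B $$ (i, 0) else 0) else 0)"
    using assms by (intro sum.cong) (auto simp: corner_def)
  then show "(B * corner) $$ (i, j) = (if j = 0 then B $$ (i, 0) else 0)"
    using mat_mult_index[OF assms(1) corner(1) assms(2,3)] assms by simp
qed

lemma corner_sandwich:
  assumes B: "B \<in> Mats" and left: "corner * B = B" and right: "B * corner = B"
  shows "B = mat_trace B \<cdot>\<^sub>m corner"
proof (cases "n = 0")
  case False
  have z: "B $$ (i, j) = 0" if "i < n" "j < n" "i \<noteq> 0 \<or> j \<noteq> 0" for i j
    using corner_mult_index[OF B that(1,2)] that left right by auto
  have "mat_trace B = (\<Sum>i<n. if i = 0 then B $$ (0, 0) else 0)"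
    unfolding mat_trace_def using B z by (intro sum.cong) auto
  then have "mat_trace B = B $$ (0, 0)" using False by simp
  then show ?thesis using B z by (intro eq_matI) (auto simp: corner_def)
next
  case True
  then show ?thesis
    using carrier_matD[OF B] carrier_matD[OF corner(1)] by (intro eq_matI) auto
qed

end

context form_char_two begin

text \<open>
  By the hypothesis on the rows, \<open>T\<close> and \<open>T'\<close> differ by a map of
  rank one, \<open>T' = T + z u\<close>, where \<open>z\<close> is the first column of
  \<open>M\<^sup>-\<^sup>1\<close>; so \<open>T' T\<^sup>-\<^sup>1\<close> is the identity or
  an orthogonal reflection whose mirror consists of the rows annihilated by \<open>z\<close>,
  and the Dickson invariant tells them apart. Without division this reads as follows. Let
  \<open>c\<close> be the polar form of the first row of \<open>M T\<close> with
  \<open>u\<close>, and let \<open>s\<close> be the value of the dual form at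
  \<open>z\<close>. The isometry conditions give that \<open>u\<close> is \<open>c\<close>
  times a fixed vector \<open>y\<close>, that \<open>c\<close> is the value of the form at
  \<open>u\<close>, hence that \<open>c = c\<^sup>2 s\<close>. The invariants differ by
  \<open>c s\<close>. If they agree, then \<open>c s = 0\<close>, so \<open>c = 0\<close> and
  \<open>u = 0\<close>.
\<close>

lemma mcong_of_dickson:
  assumes isom: "isom T" "isom T'"
    and M: "M \<in> Mats" "M' \<in> Mats" "M' * M = 1\<^sub>m n" "M * M' = 1\<^sub>m n"
    and rows: "\<And>i j. 0 < i \<Longrightarrow> i < n \<Longrightarrow> j < n \<Longrightarrow> (M * T) $$ (i, j) = (M * T') $$ (i, j)"
    and D: "dickson T \<sim> dickson T'"
  shows "T' \<approx> T"
proof -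
  have T [simp]: "T \<in> Mats" "T' \<in> Mats" using isom by (auto simp: isom_def)
  note M(1,2) [simp]
  (* All nonzero entries of U are in its first row, which is u; those of Z are in its first column z. *)
  define U where "U = M * T + M * T'"
  define Z where "Z = M' * corner"
  have UZ [simp]: "U \<in> Mats" "Z \<in> Mats" by (simp_all add: U_def Z_def)
  have eU: "corner * U = U"
  proof (rule eq_matI)
    fix i j assume "i < dim_row U" "j < dim_col U"
    then have ij: "i < n" "j < n" using UZ(1) by auto
    have "U $$ (i, j) = 0" if "i \<noteq> 0"
      using rows[of i j] that ij carrier_matD[OF Mats_mult[OF M(1) T(1)]]
        carrier_matD[OF Mats_mult[OF M(1) T(2)]]
      by (simp add: U_def del: index_mult_mat(1))
    then show "(corner * U) $$ (i, j) = U $$ (i, j)"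
      using corner_mult_index(1)[OF UZ(1) ij] ij by auto
  qed (use carrier_matD[OF corner(1)] carrier_matD[OF UZ(1)] in simp_all)
  have Ue: "transpose_mat U * corner = transpose_mat U"
    using arg_cong[OF eU, of transpose_mat] by (simp add: mat_transposes)
  have eU_left: "corner * (U * B) = U * B" if "B \<in> Mats" for B
    using assoc_mult_mat[OF corner(1) UZ(1) that] by (simp only: eU)
  have ee: "corner * corner = corner"
  proof (rule eq_matI)
    fix i j assume "i < dim_row corner" "j < dim_col corner"
    then have ij: "i < n" "j < n" by (simp_all add: corner_def)
    show "(corner * corner) $$ (i, j) = corner $$ (i, j)"
      unfolding corner_mult_index(1)[OF corner(1) ij] using ij by (simp add: corner_def)
  qed simp_all
  have Ze: "Z * corner = Z" "corner * transpose_mat Z = transpose_mat Z"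
    by (simp_all add: Z_def mat_transposes mat_distribs ee assoc_mult_mat[symmetric, of _ n n _ n _ n] del: assoc_mult_mat)
  have MZ: "M * Z = corner"
    unfolding Z_def using M by (simp add: assoc_mult_mat[symmetric, of _ n n _ n _ n] left_mult_one_mat[of _ n n] del: assoc_mult_mat)
  have ZM: "transpose_mat Z * transpose_mat M = corner"
    using arg_cong[OF MZ, of transpose_mat] by (simp add: mat_transposes)
  have T': "T' = T + Z * U"
  proof -
    have "Z * U = M' * (corner * U)" by (simp add: Z_def mat_distribs)
    also have "\<dots> = M' * U" by (simp only: eU)
    also have "\<dots> = (M' * M) * T + (M' * M) * T'" by (simp add: U_def mat_distribs)
    also have "\<dots> = T + T'" by (simp add: M mat_distribs)
    finally show ?thesis by (simp add: mat_add_cancel)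
  qed
  have T't: "transpose_mat T' = transpose_mat T + transpose_mat U * transpose_mat Z"
    by (simp add: T' mat_transposes)
  let ?Tt = "transpose_mat T" and ?Ut = "transpose_mat U" and ?Zt = "transpose_mat Z"
    and ?Mt = "transpose_mat M"
  (* The polar form is alternating, so u is orthogonal to itself. *)
  have UAU: "U * A * ?Ut = 0\<^sub>m n n"
  proof -
    have "U * A * ?Ut = mat_trace (U * A * ?Ut) \<cdot>\<^sub>m corner"
      by (rule corner_sandwich) (simp_all add: mat_distribs Ue eU_left)
    moreover have "U * A * ?Ut = U * G * ?Ut + transpose_mat (U * G * ?Ut)"
      by (simp add: A_def mat_distribs mat_transposes)
    then have "mat_trace (U * A * ?Ut) = 0"
      by (simp add: mat_trace_add[of _ n] mat_trace_transpose[of _ n])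
    moreover have "0 \<cdot>\<^sub>m corner = 0\<^sub>m n n"
      by (rule eq_matI) (simp_all add: corner_def)
    ultimately show ?thesis by simp
  qed
  define V where "V = M * T * A * ?Ut"
  have V [simp]: "V \<in> Mats" by (simp add: V_def)
  have Vt: "transpose_mat V = U * A * ?Tt * ?Mt"
    by (simp add: V_def mat_transposes mat_distribs transpose_A)
  define c where "c = mat_trace V"
  define s where "s = mat_trace (?Zt * P * Z)"
  have Ve: "V * corner = V" by (simp add: V_def mat_distribs Ue)
  (* Both T and T' preserve the polar form: u is orthogonal to all rows of M T except the first. *)
  have V_c: "V \<approx> c \<cdot>\<^sub>m corner"
  proof -
    have "M * (T * A * ?Tt + T' * A * transpose_mat T') * ?Mt \<approx> M * (A + A) * ?Mt"
      by (intro mcong_mult mcong_add isom_bilinear isom mcong_refl) simp_all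
    also have "M * (A + A) * ?Mt = 0\<^sub>m n n"
      by (simp add: mat_add_self left_mult_zero_mat[of _ n n] right_mult_zero_mat[of _ n n])
    also have "T * A * ?Tt + T' * A * transpose_mat T' =
        Z * U * A * ?Tt + T * A * ?Ut * ?Zt + Z * (U * A * ?Ut) * ?Zt"
      by (simp add: T' T't mat_distribs mat_transposes assoc_add_mat[of _ n n] mat_add_cancel)
    also have "M * \<dots> * ?Mt = (M * Z) * (U * A * ?Tt * ?Mt) + V * (?Zt * ?Mt)"
      by (simp add: UAU V_def mat_distribs)
    also have "\<dots> = corner * transpose_mat V + V * corner"
      by (simp only: Vt MZ ZM)
    finally have z: "corner * transpose_mat V + V * corner \<approx> 0\<^sub>m n n" .
    have off: "V $$ (i, 0) \<in> I" if "0 < i" "i < n" for i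
    proof -
      have "(corner * transpose_mat V + V * corner) $$ (i, 0) = V $$ (i, 0)"
        using that carrier_matD[OF Mats_mult[OF V corner(1)]]
        by (simp add: corner_mult_index del: index_mult_mat(1))
      moreover have "0 < n" using that by simp
      then have "(corner * transpose_mat V + V * corner) $$ (i, 0) \<sim> 0\<^sub>m n n $$ (i, 0)"
        using z that(2) unfolding mcong_def by blast
      ultimately show ?thesis using that by (simp add: cong_0_iff)
    qed
    have zero: "V $$ (i, j) = 0" if "i < n" "0 < j" "j < n" for i j
      using corner_mult_index(2)[OF V that(1,3)] Ve that by simp
    have "c = (\<Sum>i<n. if i = 0 then V $$ (0, 0) else 0)"
      unfolding c_def mat_trace_def using zero by (intro sum.cong) (auto simp: carrier_matD[OF V])
    then have "c = V $$ (0, 0)" if "0 < n" using that by simp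
    then have "V $$ (i, j) \<sim> (c \<cdot>\<^sub>m corner) $$ (i, j)" if "i < n" "j < n" for i j
      using off[of i] zero[of i j] that
      by (cases "i = 0"; cases "j = 0") (simp_all add: cong_def corner_def)
    then show ?thesis by (simp add: mcong_def)
  qed
  have TAU: "T * A * ?Ut \<approx> c \<cdot>\<^sub>m Z"
  proof -
    have "T * A * ?Ut = (M' * M) * T * A * ?Ut" by (simp add: M mat_distribs)
    also have "\<dots> = M' * V" by (simp add: V_def mat_distribs)
    also have "\<dots> \<approx> M' * (c \<cdot>\<^sub>m corner)" by (intro mcong_mult V_c mcong_refl) simp
    also have "\<dots> = c \<cdot>\<^sub>m Z" by (simp add: Z_def mult_smult_distrib[of _ n n _ n])
    finally show ?thesis .
  qed
  define y where "y = ?Tt * A * Z"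
  have y [simp]: "y \<in> Mats" by (simp add: y_def)
  have Ut: "?Ut \<approx> c \<cdot>\<^sub>m y"
  proof -
    have "?Ut = A * (1\<^sub>m n) * (A * ?Ut)" by (simp add: mat_distribs A_square_left)
    also have "\<dots> \<approx> A * (A * ?Tt * A * T) * (A * ?Ut)"
      by (intro mcong_mult mcong_sym[OF isom_left_inverse] isom mcong_refl) simp_all
    also have "\<dots> = ?Tt * A * (T * A * ?Ut)" by (simp add: mat_distribs A_square_left)
    also have "\<dots> \<approx> ?Tt * A * (c \<cdot>\<^sub>m Z)" by (intro mcong_mult TAU mcong_refl) simp
    also have "\<dots> = c \<cdot>\<^sub>m y" by (simp add: y_def mult_smult_distrib[of _ n n _ n])
    finally show ?thesis .
  qed
  have U_y: "U \<approx> c \<cdot>\<^sub>m transpose_mat y"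
    using mcong_transpose[OF Ut] by (simp add: transpose_smult)
  define N where "N = T * G * ?Tt + G"
  define N' where "N' = T' * G * transpose_mat T' + G"
  have N [simp]: "N \<in> Mats" "N' \<in> Mats" by (simp_all add: N_def N'_def)
  have alt: "alt N" "alt N'" using isom by (auto simp: isom_def N_def N'_def)
  have NN: "N + N' = Z * U * G * ?Tt + T * G * ?Ut * ?Zt + Z * (U * G * ?Ut) * ?Zt"
  proof -
    have "N + N' = T * G * ?Tt + T' * G * transpose_mat T'"
      unfolding N_def N'_def
      using carrier_matD[of "T * G * ?Tt" n n] carrier_matD[of "T' * G * transpose_mat T'" n n]
        carrier_matD[OF G]
      by (intro eq_matI) (auto simp: ac_simps simp del: index_mult_mat(1))
    also have "\<dots> = Z * U * G * ?Tt + T * G * ?Ut * ?Zt + Z * (U * G * ?Ut) * ?Zt"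
      by (simp add: T' T't mat_distribs mat_transposes assoc_add_mat[of _ n n] mat_add_cancel)
    finally show ?thesis .
  qed
  (* The two isometry conditions differ by an alternate matrix, which has trace 0 modulo I. *)
  have cQ: "c \<sim> mat_trace (U * G * ?Ut)"
  proof -
    have "mat_trace (M * (N + N') * ?Mt) \<in> I"
      by (intro alt_trace alt_congruence alt_add alt M)
    also have "M * (N + N') * ?Mt = (M * Z) * U * G * ?Tt * ?Mt + M * T * G * ?Ut * (?Zt * ?Mt)
        + (M * Z) * U * G * ?Ut * (?Zt * ?Mt)"
      unfolding NN by (simp add: mat_distribs)
    also have "\<dots> = U * G * ?Tt * ?Mt + M * T * G * ?Ut + U * G * ?Ut"
      by (simp add: MZ ZM eU Ue mat_distribs assoc_mult_mat[symmetric, of corner n n U n])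
    also have "mat_trace \<dots> = mat_trace (transpose_mat (U * G * ?Tt * ?Mt)) + mat_trace (M * T * G * ?Ut)
        + mat_trace (U * G * ?Ut)"
      by (simp add: mat_trace_add[of _ n] mat_trace_transpose[of _ n])
    also have "transpose_mat (U * G * ?Tt * ?Mt) = M * T * G * ?Ut + V"
      by (simp add: V_def mat_transposes transpose_G mat_distribs)
    finally show ?thesis
      by (simp add: c_def cong_def mat_trace_add[of _ n] ac_simps)
  qed
  have yGy: "mat_trace (transpose_mat y * G * y) \<sim> s"
  proof -
    have "mat_trace ((?Zt * A) * N * transpose_mat (?Zt * A)) \<in> I"
      by (intro alt_trace alt_congruence alt) simp
    also have "(?Zt * A) * N * transpose_mat (?Zt * A) = transpose_mat y * G * y + ?Zt * P * Z"
      by (simp add: N_def y_def P_def mat_transposes mat_distribs transpose_A)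
    finally show ?thesis by (simp add: s_def cong_def mat_trace_add[of _ n])
  qed
  (* The form at u is c^2 times the form at y, which is the dual form at z. *)
  have Q: "mat_trace (U * G * ?Ut) \<sim> c * (c * s)"
  proof -
    have "mat_trace (U * G * ?Ut) \<sim> mat_trace ((c \<cdot>\<^sub>m transpose_mat y) * G * (c \<cdot>\<^sub>m y))"
      by (intro mcong_trace mcong_mult Ut U_y mcong_refl G)
    also have "\<dots> = c * (c * mat_trace (transpose_mat y * G * y))"
      by (simp add: mult_smult_distrib[of _ n n _ n] mult_smult_assoc_mat[of _ n n _ n] mat_trace_smult)
    also have "\<dots> \<sim> c * (c * s)" by (intro cong_mult yGy cong_refl)
    finally show ?thesis .
  qed
  have tr1: "mat_trace (Z * U * G * ?Tt * P) + mat_trace (T * G * ?Ut * ?Zt * P) \<in> I"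
  proof -
    have "mat_trace (Z * U * G * ?Tt * P) = mat_trace (U * G * ?Tt * P * Z)"
      using mat_trace_comm[of Z n "U * G * ?Tt * P"] by (simp add: mat_distribs)
    moreover have "mat_trace (T * G * ?Ut * ?Zt * P) = mat_trace (transpose_mat P * Z * U * transpose_mat G * ?Tt)"
      using mat_trace_transpose[of "T * G * ?Ut * ?Zt * P" n] by (simp add: mat_transposes mat_distribs)
    moreover have "\<dots> = mat_trace (U * transpose_mat G * ?Tt * (P + A) * Z)"
      using mat_trace_comm[of "(P + A) * Z" n "U * transpose_mat G * ?Tt"] by (simp add: mat_distribs transpose_P)
    moreover have "U * transpose_mat G * ?Tt * (P + A) * Z =
        U * G * ?Tt * P * Z + (U * A * ?Tt) * P * Z + U * transpose_mat G * y"
      by (simp add: transpose_G y_def mat_distribs assoc_add_mat[of _ n n])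
    ultimately have "mat_trace (Z * U * G * ?Tt * P) + mat_trace (T * G * ?Ut * ?Zt * P) =
        mat_trace ((U * A * ?Tt) * P * Z) + mat_trace (U * transpose_mat G * y)"
      by (simp add: mat_trace_add[of _ n] ac_simps)
    also have "\<dots> \<sim> mat_trace ((c \<cdot>\<^sub>m ?Zt) * P * Z) + mat_trace ((c \<cdot>\<^sub>m transpose_mat y) * transpose_mat G * y)"
    proof -
      have "U * A * ?Tt \<approx> c \<cdot>\<^sub>m ?Zt"
        using mcong_transpose[OF TAU] by (simp add: mat_transposes transpose_A transpose_smult mat_distribs)
      then show ?thesis by (intro cong_add mcong_trace mcong_mult U_y mcong_refl) simp_all
    qed
    also have "\<dots> = c * s + c * mat_trace (transpose_mat y * transpose_mat G * y)"
      by (simp add: s_def mult_smult_assoc_mat[of _ n n _ n] mat_trace_smult)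
    also have "mat_trace (transpose_mat y * transpose_mat G * y) = mat_trace (transpose_mat y * G * y)"
      using mat_trace_transpose[of "transpose_mat y * G * y" n] by (simp add: mat_transposes mat_distribs)
    also have "c * s + c * mat_trace (transpose_mat y * G * y) \<sim> c * s + c * s"
      by (intro cong_add cong_mult yGy cong_refl)
    also have "c * s + c * s = 0" by simp
    finally show ?thesis by (simp add: cong_def)
  qed
  have tr2: "mat_trace (Z * (U * G * ?Ut) * ?Zt * P) = mat_trace (U * G * ?Ut) * s"
  proof -
    have "U * G * ?Ut = mat_trace (U * G * ?Ut) \<cdot>\<^sub>m corner"
      by (rule corner_sandwich) (simp_all add: mat_distribs Ue eU_left)
    moreover have "mat_trace (Z * (U * G * ?Ut) * ?Zt * P) = mat_trace ((U * G * ?Ut) * (?Zt * P * Z))"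
      using mat_trace_comm[of Z n "(U * G * ?Ut) * ?Zt * P"] by (simp add: mat_distribs)
    ultimately have "mat_trace (Z * (U * G * ?Ut) * ?Zt * P) =
        mat_trace ((mat_trace (U * G * ?Ut) \<cdot>\<^sub>m corner) * (?Zt * P * Z))"
      by simp
    also have "\<dots> = mat_trace (U * G * ?Ut) * mat_trace (corner * ?Zt * P * Z)"
      by (simp add: mult_smult_assoc_mat[of _ n n _ n] mat_trace_smult mat_distribs)
    finally show ?thesis by (simp add: Ze s_def)
  qed
  have cs: "c * s \<in> I"
  proof -
    have "dickson T + dickson T' = mat_trace ((N + N') * P)"
      by (simp only: dickson_def N_def[symmetric] N'_def[symmetric])
        (simp add: mat_distribs mat_trace_add[of _ n])
    also have "(N + N') * P = Z * U * G * ?Tt * P + T * G * ?Ut * ?Zt * P + Z * (U * G * ?Ut) * ?Zt * P"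
      unfolding NN by (simp add: mat_distribs)
    also have "mat_trace \<dots> = (mat_trace (Z * U * G * ?Tt * P) + mat_trace (T * G * ?Ut * ?Zt * P))
        + mat_trace (U * G * ?Ut) * s"
      by (simp add: mat_trace_add[of _ n] tr2)
    finally have "mat_trace (U * G * ?Ut) * s \<sim> dickson T + dickson T'"
      using tr1 by (simp add: cong_def ac_simps)
    then have "mat_trace (U * G * ?Ut) * s \<in> I"
      using D by (auto simp: cong_def[of "dickson T"] intro: cong_mem)
    then show ?thesis by (rule cong_mem[OF cong_mult[OF cQ cong_refl]])
  qed
  have "c \<in> I"
    by (rule cong_mem[OF cong_trans[OF cQ Q]]) (rule mult_mem[OF cs])
  then have "U \<approx> 0\<^sub>m n n"
    by (intro mcong_trans[OF U_y] mcong_smult_zero) simp_all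
  then have "T' \<approx> T + Z * 0\<^sub>m n n"
    unfolding T' by (intro mcong_add mcong_mult mcong_refl) simp_all
  then show ?thesis by (simp add: right_mult_zero_mat[of _ n n] right_add_zero_mat[of _ n n])
qed

end


section \<open>Frobenius and the transition matrix\<close>

lemma finite_field_power_card:
  fixes x :: "'a::{field,finite}"
  shows "x ^ CARD('a) = x"
proof (cases "x = 0")
  case False
  have "(\<Prod>y\<in>UNIV - {0}. x * y) = x ^ (CARD('a) - 1) * \<Prod>(UNIV - {0})"
    by (simp add: prod.distrib)
  then have "x * (\<Prod>y\<in>UNIV - {0}. x * y) = x ^ Suc (CARD('a) - 1) * \<Prod>(UNIV - {0})"
    by (simp only: power_Suc mult.assoc)
  also have "Suc (CARD('a) - 1) = CARD('a)" using finite_UNIV_card_ge_0[where 'a = 'a] by simp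
  also have "(\<Prod>y\<in>UNIV - {0}. x * y) = \<Prod>(UNIV - {0})"
    by (rule prod.reindex_bij_witness[of _ "\<lambda>y. y / x" "\<lambda>y. x * y"]) (use False in auto)
  finally show ?thesis by simp
qed (simp add: finite_UNIV_card_ge_0)

text \<open>
  The polynomial \<open>(x + 1)\<^sup>q - x\<^sup>q - 1\<close> has degree less than
  \<open>q\<close> and vanishes at all \<open>q\<close> elements of the field.
\<close>

lemma card_choose_eq_0:
  assumes "0 < k" "k < CARD('a)"
  shows "of_nat (CARD('a) choose k) = (0 :: 'a::{field,finite})"
proof -
  let ?q = "CARD('a)"
  define p :: "'a poly" where "p = (\<Sum>i\<in>{0<..<?q}. monom (of_nat (?q choose i)) i)"
  have coeff: "coeff p i = (if i \<in> {0<..<?q} then of_nat (?q choose i) else 0)" for i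
    by (simp add: p_def coeff_sum)
  have "poly p x = 0" for x
  proof -
    have q: "{..?q} = insert 0 (insert ?q {0<..<?q})"
      by (auto simp: finite_UNIV_card_ge_0)
    have "(x + 1) ^ ?q = (\<Sum>i\<le>?q. of_nat (?q choose i) * x ^ i)"
      by (simp add: binomial_ring)
    also have "\<dots> = 1 + x ^ ?q + poly p x"
      unfolding q p_def using finite_UNIV_card_ge_0[where 'a = 'a] by (simp add: poly_sum poly_monom)
    finally show ?thesis by (simp add: finite_field_power_card)
  qed
  moreover have "degree p < ?q"
    by (rule degree_lessI) (auto simp: coeff finite_UNIV_card_ge_0)
  ultimately have "p = 0"
    using card_poly_roots_bound[of p] by (fastforce simp: not_less[symmetric])
  with coeff[of k] assms show ?thesis by simp
qed

lemma frobenius_add: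
  fixes x y :: "'r::comm_ring_1"
  assumes "CHAR('a::{field,finite}) = 2" and "(1::'r) + 1 = 0"
  shows "(x + y) ^ CARD('a) = x ^ CARD('a) + y ^ CARD('a)"
proof -
  let ?q = "CARD('a)"
  have q: "{..?q} = insert 0 (insert ?q {0<..<?q})"
    by (auto simp: finite_UNIV_card_ge_0)
  have "of_nat (?q choose i) = (0::'r)" if "i \<in> {0<..<?q}" for i
  proof -
    have "CHAR('a) dvd (?q choose i)"
      using card_choose_eq_0[of i] that by (simp only: of_nat_eq_0_iff_char_dvd) auto
    then obtain m where "(?q choose i) = 2 * m" using assms(1) by (auto simp: dvd_def)
    then show ?thesis using assms(2) by (simp add: numeral_eq_Suc)
  qed
  then have "(\<Sum>i\<in>{0<..<?q}. of_nat (?q choose i) * x ^ i * y ^ (?q - i)) = 0"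
    by (intro sum.neutral) auto
  then show ?thesis
    unfolding binomial_ring q using finite_UNIV_card_ge_0[where 'a = 'a] by (simp add: ac_simps)
qed

context form_char_two begin

lemma dickson_power: "isom T \<Longrightarrow> k > 0 \<Longrightarrow> dickson T ^ k \<sim> dickson T"
proof (induction k)
  case (Suc k)
  show ?case
  proof (cases "k = 0")
    case False
    have "dickson T ^ Suc k \<sim> dickson T * dickson T"
      using Suc False by (auto intro!: cong_mult)
    also have "\<dots> \<sim> dickson T" by (rule dickson_idempotent[OF Suc.prems(1)])
    finally show ?thesis .
  qed simp
qed simp

context
  fixes q :: nat
  assumes q: "q > 0" and frob: "\<And>x y :: 'r. (x + y) ^ q = x ^ q + y ^ q"
    and G_fixed: "\<And>i j. i < n \<Longrightarrow> j < n \<Longrightarrow> G $$ (i, j) ^ q = G $$ (i, j)"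
begin

abbreviation Frob :: "'r mat \<Rightarrow> 'r mat" where
  "Frob \<equiv> map_mat (\<lambda>x. x ^ q)"

lemma frob_sum: "(\<Sum>i\<in>S. f i :: 'r) ^ q = (\<Sum>i\<in>S. f i ^ q)"
  by (induction S rule: infinite_finite_induct) (use q in \<open>simp_all add: frob zero_power\<close>)

lemma Frob_mult:
  assumes "B \<in> Mats" "C \<in> Mats" shows "Frob (B * C) = Frob B * Frob C"
proof (rule eq_matI)
  fix i j assume "i < dim_row (Frob B * Frob C)" "j < dim_col (Frob B * Frob C)"
  then have ij: "i < n" "j < n" using assms by auto
  have "Frob (B * C) $$ (i, j) = (\<Sum>k<n. B $$ (i, k) * C $$ (k, j)) ^ q"
    using ij assms mat_mult_index[OF assms ij] by simp
  also have "\<dots> = (\<Sum>k<n. Frob B $$ (i, k) * Frob C $$ (k, j))"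
    using ij assms by (simp add: frob_sum power_mult_distrib)
  also have "\<dots> = (Frob B * Frob C) $$ (i, j)"
    using mat_mult_index[of "Frob B" n "Frob C" i j] assms ij by simp
  finally show "Frob (B * C) $$ (i, j) = (Frob B * Frob C) $$ (i, j)" .
qed (use assms in simp_all)

lemma Frob_add: "B \<in> Mats \<Longrightarrow> C \<in> Mats \<Longrightarrow> Frob (B + C) = Frob B + Frob C"
  by (auto simp: frob)

lemma Frob_transpose: "Frob (transpose_mat B) = transpose_mat (Frob B)"
  by auto

lemma Frob_G: "Frob G = G"
  by (rule eq_matI) (use carrier_matD[OF G] G_fixed in auto)

lemma Frob_A: "Frob A = A"
  by (simp add: A_def Frob_add Frob_transpose Frob_G)

lemma Frob_P: "Frob P = P"
  by (simp add: P_def Frob_mult Frob_A Frob_G)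

lemma Frob_trace: "B \<in> Mats \<Longrightarrow> mat_trace (Frob B) = mat_trace B ^ q"
  by (auto simp: mat_trace_def frob_sum intro!: sum.cong)

lemma Frob_alt: "alt N \<Longrightarrow> alt (Frob N)"
  using q by (auto simp: alt_def intro!: power_mem cong_power)

lemma Frob_isom:
  assumes "isom T" shows "isom (Frob T)" "dickson (Frob T) = dickson T ^ q"
proof -
  have T [simp]: "T \<in> Mats" using assms by (simp add: isom_def)
  have F: "Frob (T * G * transpose_mat T + G) = Frob T * G * transpose_mat (Frob T) + G"
    by (simp add: Frob_add Frob_mult Frob_transpose Frob_G)
  have "alt (Frob (T * G * transpose_mat T + G))"
    by (rule Frob_alt) (use assms in \<open>simp add: isom_def\<close>)
  then show "isom (Frob T)"
    unfolding F isom_def by simp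
  have "dickson (Frob T) = mat_trace (Frob ((T * G * transpose_mat T + G) * P))"
    by (simp add: dickson_def Frob_mult F Frob_P)
  then show "dickson (Frob T) = dickson T ^ q"
    by (simp add: dickson_def Frob_trace)
qed

text \<open>
  Row \<open>i + 1\<close> of \<open>M\<close> and \<open>C\<close> is the Frobenius image of
  row \<open>i\<close>. Applying Frobenius to \<open>M T = C\<close> therefore shows that
  \<open>M T\<close> and \<open>M T\<^sup>(\<^sup>q\<^sup>)\<close> agree in all rows but the
  first. The two isometries have the same Dickson invariant, as it is a polynomial with
  coefficients fixed by Frobenius and takes idempotent values.
\<close>

lemma transition_frobenius_fixed:
  assumes M: "M \<in> Mats" "M' \<in> Mats" "M' * M = 1\<^sub>m n" "M * M' = 1\<^sub>m n" and C: "C \<in> Mats"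
    and M_rows: "\<And>i j. Suc i < n \<Longrightarrow> j < n \<Longrightarrow> M $$ (Suc i, j) = M $$ (i, j) ^ q"
    and C_rows: "\<And>i j. Suc i < n \<Longrightarrow> j < n \<Longrightarrow> C $$ (Suc i, j) = C $$ (i, j) ^ q"
    and alt: "alt (C * G * transpose_mat C + M * G * transpose_mat M)"
  shows "isom (M' * C)" and "Frob (M' * C) \<approx> M' * C"
proof -
  define T where "T = M' * C"
  note M(1,2) [simp] C [simp]
  have T [simp]: "T \<in> Mats" by (simp add: T_def)
  have MT: "M * T = C"
    using M(4) by (simp add: T_def assoc_mult_mat[symmetric, of _ n n _ n _ n] mat_distribs(4) del: assoc_mult_mat)
  have "alt (M' * (C * G * transpose_mat C + M * G * transpose_mat M) * transpose_mat M')"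
    by (intro alt_congruence alt) simp
  also have "M' * (C * G * transpose_mat C + M * G * transpose_mat M) * transpose_mat M' =
      T * G * transpose_mat T + (M' * M) * G * transpose_mat (M' * M)"
    by (simp add: T_def mat_transposes mat_distribs)
  finally have isom: "isom T" by (simp add: M(3) isom_def mat_distribs)
  then show "isom (M' * C)" by (simp add: T_def)
  have "Frob T \<approx> T"
  proof (rule mcong_of_dickson[OF isom Frob_isom(1)[OF isom] M])
    fix i j assume ij: "0 < i" "i < n" "j < n"
    then obtain k where k: "i = Suc k" by (cases i) auto
    have "(M * Frob T) $$ (i, j) = (\<Sum>l<n. M $$ (i, l) * Frob T $$ (l, j))"
      by (rule mat_mult_index) (use ij in simp_all)
    also have "\<dots> = (\<Sum>l<n. Frob M $$ (k, l) * Frob T $$ (l, j))"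
      using ij k M_rows carrier_matD[OF M(1)] by (intro sum.cong) auto
    also have "\<dots> = (Frob M * Frob T) $$ (k, j)"
      by (rule mat_mult_index[symmetric]) (use ij k in simp_all)
    also have "Frob M * Frob T = Frob C" by (simp add: Frob_mult[symmetric] MT)
    also have "Frob C $$ (k, j) = C $$ (i, j)"
      using ij k C_rows carrier_matD[OF C] by auto
    finally show "(M * T) $$ (i, j) = (M * Frob T) $$ (i, j)" by (simp add: MT)
  next
    show "dickson T \<sim> dickson (Frob T)"
      unfolding Frob_isom(2)[OF isom] by (rule cong_sym[OF dickson_power[OF isom q]])
  qed
  then show "Frob (M' * C) \<approx> M' * C" by (simp add: T_def)
qed

end
end


section \<open>Constant entries modulo a larger ideal, and linear functionals\<close>

lemma prod_minus_finite_field: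
  fixes \<kappa> :: "'a::{field,finite} \<Rightarrow> 'r::idom"
  assumes inj: "inj \<kappa>" and mult: "\<And>a b. \<kappa> (a * b) = \<kappa> a * \<kappa> b" and one: "\<kappa> 1 = 1"
  shows "(\<Prod>a\<in>UNIV. t - \<kappa> a) = t ^ CARD('a) - t"
proof -
  let ?q = "CARD('a)"
  have q: "?q > 1" using card_mono[of "UNIV :: 'a set" "{0, 1}"] by simp
  have pow: "\<kappa> (a ^ k) = \<kappa> a ^ k" for a k by (induction k) (simp_all add: mult one)
  define p where "p = (\<Prod>a\<in>UNIV. [:- \<kappa> a, 1:])"
  define r where "r = (monom 1 ?q - [:0, 1:] :: 'r poly)"
  have degp: "degree p = ?q" by (simp add: p_def degree_prod_eq_sum_degree)
  have lcp: "lead_coeff p = 1" unfolding p_def lead_coeff_prod by simp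
  have cr: "coeff r i = (if i = ?q then 1 else 0) - (if i = 1 then 1 else 0)" for i
    by (auto simp: r_def coeff_pCons split: nat.splits)
  have "degree (p - r) < ?q"
  proof (rule degree_lessI, goal_cases)
    case 2
    show ?case
    proof (intro allI impI)
      fix k assume "k \<ge> ?q"
      then show "coeff (p - r) k = 0"
        using degp lcp q by (cases "k = ?q") (auto simp: cr coeff_eq_0)
    qed
  qed (use q in simp)
  moreover have "poly (p - r) x = 0" if rx: "x \<in> range \<kappa>" for x
  proof -
    obtain a where x: "x = \<kappa> a" using rx by blast
    have "poly p x = 0" by (auto simp: p_def poly_prod x)
    moreover have "poly r x = 0" by (simp add: r_def poly_monom x pow[symmetric] finite_field_power_card)
    ultimately show ?thesis by simp
  qed
  then have "p - r \<noteq> 0 \<Longrightarrow> card (range \<kappa>) \<le> degree (p - r)"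
    by (intro order.trans[OF card_mono card_poly_roots_bound] poly_roots_finite) auto
  ultimately have "p - r = 0" using card_image[OF inj] by fastforce
  then have "poly p t = poly r t" by simp
  then show ?thesis by (simp add: p_def r_def poly_prod poly_monom)
qed

lemma ideal_char_two_colon:
  assumes "ideal_char_two I"
  shows "ideal_char_two {p. p * e \<in> I}"
proof -
  interpret ideal_char_two I by fact
  show ?thesis
    by unfold_locales (auto simp: two distrib_right mult.assoc intro: add_mem mult_mem)
qed

text \<open>
  For \<open>e\<^sub>a = 1 + (t + a)\<^sup>q\<^sup>-\<^sup>1\<close> the product \<open>(t +
  a) e\<^sub>a\<close> is \<open>t\<^sup>q + t\<close>, so \<open>t\<close> is the constant
  \<open>a\<close> modulo the ideal quotient \<open>(I : e\<^sub>a)\<close>. If all these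
  ideals contained \<open>u\<close>, then \<open>u\<close> would agree modulo \<open>I\<close>
  with its product with all the \<open>(t + a)\<^sup>q\<^sup>-\<^sup>1\<close>. This product
  is \<open>u (t\<^sup>q - t)\<^sup>q\<^sup>-\<^sup>1\<close>, which lies in \<open>I\<close>.
\<close>

lemma split_ideal:
  fixes \<kappa> :: "'a::{field,finite} \<Rightarrow> 'r::idom"
  assumes I: "ideal_char_two I" and char: "CHAR('a) = 2" and inj: "inj \<kappa>"
    and mult: "\<And>a b. \<kappa> (a * b) = \<kappa> a * \<kappa> b" and one: "\<kappa> 1 = 1"
    and u: "u \<notin> I" and t: "t ^ CARD('a) + t \<in> I"
  shows "\<exists>J a. ideal_char_two J \<and> I \<subseteq> J \<and> u \<notin> J \<and> t + \<kappa> a \<in> J"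
proof -
  interpret ideal_char_two I by fact
  let ?q = "CARD('a)"
  have q: "?q > 1" using card_mono[of "UNIV :: 'a set" "{0, 1}"] by simp
  have pow: "\<kappa> (a ^ k) = \<kappa> a ^ k" for a k by (induction k) (simp_all add: mult one)
  define e where "e a = 1 + (t + \<kappa> a) ^ (?q - 1)" for a
  have "\<exists>a. u * e a \<notin> I"
  proof (rule ccontr)
    assume "\<nexists>a. u * e a \<notin> I"
    then have e: "u \<sim> u * (t + \<kappa> a) ^ (?q - 1)" for a
      by (simp add: cong_def e_def distrib_left)
    have "u \<sim> u * (\<Prod>a\<in>S. (t + \<kappa> a) ^ (?q - 1))" for S
    proof (induction S rule: infinite_finite_induct)
      case (insert a S)
      have "u \<sim> u * (\<Prod>a\<in>S. (t + \<kappa> a) ^ (?q - 1))" by fact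
      also have "\<dots> \<sim> u * (t + \<kappa> a) ^ (?q - 1) * (\<Prod>a\<in>S. (t + \<kappa> a) ^ (?q - 1))"
        by (intro cong_mult e cong_refl)
      finally show ?case using insert by (simp add: mult.assoc)
    qed auto
    have prod: "(\<Prod>a\<in>UNIV. t + \<kappa> a) = t ^ ?q + t"
      using prod_minus_finite_field[OF inj mult one, of t] by simp
    have "u \<sim> u * (\<Prod>a\<in>UNIV. (t + \<kappa> a) ^ (?q - 1))" by fact
    also have "(\<Prod>a\<in>UNIV. (t + \<kappa> a) ^ (?q - 1)) = (t ^ ?q + t) ^ (?q - 1)"
      by (simp only: prod_power_distrib[symmetric] prod)
    also have "u * (t ^ ?q + t) ^ (?q - 1) \<sim> 0"
      unfolding cong_0_iff by (intro mult_mem power_mem t) (use q in simp)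
    finally show False using u by (simp add: cong_0_iff)
  qed
  then obtain a where a: "u * e a \<notin> I" by blast
  let ?J = "{p. p * e a \<in> I}"
  have "(t + \<kappa> a) * e a = (t + \<kappa> a) + (t + \<kappa> a) ^ ?q"
    using q by (simp add: e_def distrib_left power_eq_if)
  also have "\<dots> = t ^ ?q + t"
    unfolding frobenius_add[OF char two] by (simp add: pow[symmetric] finite_field_power_card ac_simps)
  finally have "t + \<kappa> a \<in> ?J" using t by simp
  moreover have "I \<subseteq> ?J" by (auto intro: mult_mem_right)
  ultimately show ?thesis using a ideal_char_two_colon[OF I] by blast
qed

lemma split_ideal_finite:
  fixes \<kappa> :: "'a::{field,finite} \<Rightarrow> 'r::idom"
  assumes char: "CHAR('a) = 2" and inj: "inj \<kappa>"
    and mult: "\<And>a b. \<kappa> (a * b) = \<kappa> a * \<kappa> b" and one: "\<kappa> 1 = 1"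
    and S: "finite S"
    and I: "ideal_char_two I" and u: "u \<notin> I" and t: "\<And>t. t \<in> S \<Longrightarrow> t ^ CARD('a) + t \<in> I"
  shows "\<exists>J. ideal_char_two J \<and> I \<subseteq> J \<and> u \<notin> J \<and> (\<forall>t\<in>S. \<exists>a. t + \<kappa> a \<in> J)"
  using S I u t
proof (induction S arbitrary: I rule: finite_induct)
  case (insert x S)
  obtain J a where J: "ideal_char_two J" "I \<subseteq> J" "u \<notin> J" "x + \<kappa> a \<in> J"
    using split_ideal[OF insert.prems(1) char inj mult one insert.prems(2), of x] insert.prems(3) by blast
  obtain J' where J': "ideal_char_two J'" "J \<subseteq> J'" "u \<notin> J'" "\<forall>t\<in>S. \<exists>a. t + \<kappa> a \<in> J'"
    using insert.IH[OF J(1,3)] insert.prems(3) J(2) by blast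
  then have "\<forall>t\<in>insert x S. \<exists>a. t + \<kappa> a \<in> J'" using J(4) by blast
  with J J' show ?case by (intro exI[of _ J']) auto
qed auto

text \<open>
  Take an \<open>L\<close>-subspace \<open>W\<close> that is maximal among those containing
  \<open>b\<close> but not \<open>a\<close>. By maximality \<open>W\<close> and
  \<open>a\<close> span the whole field, and \<open>\<phi>\<close> reads off the coefficient
  of \<open>a\<close>.
\<close>

lemma exists_linear_functional:
  fixes L :: "'k::field set"
  assumes L: "1 \<in> L" "\<And>x y. x \<in> L \<Longrightarrow> y \<in> L \<Longrightarrow> x + y \<in> L" "\<And>x y. x \<in> L \<Longrightarrow> y \<in> L \<Longrightarrow> x * y \<in> L"
    "\<And>x. x \<in> L \<Longrightarrow> - x \<in> L" "\<And>x. x \<in> L \<Longrightarrow> x \<noteq> 0 \<Longrightarrow> inverse x \<in> L"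
    and ab: "\<And>l. l \<in> L \<Longrightarrow> a \<noteq> l * b"
  obtains \<phi> :: "'k \<Rightarrow> 'k" where "\<And>x y. \<phi> (x + y) = \<phi> x + \<phi> y"
    "\<And>l x. l \<in> L \<Longrightarrow> \<phi> (l * x) = l * \<phi> x" "\<phi> b = 0" "\<phi> a = 1"
proof -
  have L0: "0 \<in> L" using L(2)[OF L(1) L(4)[OF L(1)]] by simp
  define \<S> where "\<S> = {W. b \<in> W \<and> a \<notin> W \<and> (\<forall>x\<in>W. \<forall>y\<in>W. x + y \<in> W) \<and> (\<forall>l\<in>L. \<forall>x\<in>W. l * x \<in> W)}"
  have "\<exists>W\<in>\<S>. \<forall>W'\<in>\<S>. W \<subseteq> W' \<longrightarrow> W' = W"
  proof (rule subset_Zorn_nonempty)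
    have "(\<lambda>l. l * b) ` L \<in> \<S>"
    proof -
      have "1 * b \<in> (\<lambda>l. l * b) ` L" using L(1) by (rule imageI)
      moreover have "l * b + l' * b \<in> (\<lambda>l. l * b) ` L" if "l \<in> L" "l' \<in> L" for l l'
        using imageI[OF L(2)[OF that], of "\<lambda>l. l * b"] by (simp only: distrib_right)
      moreover have "l * (l' * b) \<in> (\<lambda>l. l * b) ` L" if "l \<in> L" "l' \<in> L" for l l'
        using imageI[OF L(3)[OF that], of "\<lambda>l. l * b"] by (simp only: mult.assoc)
      moreover have "a \<notin> (\<lambda>l. l * b) ` L" using ab by blast
      ultimately show ?thesis unfolding \<S>_def by simp
    qed
    then show "\<S> \<noteq> {}" by blast
  next
    fix \<C> assume C: "\<C> \<noteq> {}" "subset.chain \<S> \<C>"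
    then have CS: "W \<in> \<S>" if "W \<in> \<C>" for W
      using that by (auto simp: subset.chain_def)
    have "x + y \<in> \<Union>\<C>" if xy: "x \<in> \<Union>\<C>" "y \<in> \<Union>\<C>" for x y
    proof -
      obtain V W where x: "x \<in> V" "V \<in> \<C>" and y: "y \<in> W" "W \<in> \<C>" using xy by blast
      have "V \<subseteq> W \<or> W \<subseteq> V"
        using C(2) x(2) y(2) by (auto simp: subset.chain_def)
      then obtain U where U: "U \<in> \<C>" "x \<in> U" "y \<in> U" using x y by blast
      then have "x + y \<in> U" using CS[OF U(1)] by (simp add: \<S>_def)
      with U(1) show ?thesis by (rule UnionI)
    qed
    moreover have "l * x \<in> \<Union>\<C>" if l: "l \<in> L" and x: "x \<in> \<Union>\<C>" for l x
    proof -
      obtain W where W: "W \<in> \<C>" "x \<in> W" using x by blast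
      then have "l * x \<in> W" using CS[OF W(1)] l by (simp add: \<S>_def)
      with W(1) show ?thesis by (rule UnionI)
    qed
    moreover have "b \<in> \<Union>\<C>"
    proof -
      obtain W where "W \<in> \<C>" using C(1) by blast
      with CS show ?thesis by (intro UnionI[of W]) (simp_all add: \<S>_def)
    qed
    moreover have "a \<notin> \<Union>\<C>" using CS by (auto simp: \<S>_def)
    ultimately show "\<Union>\<C> \<in> \<S>"
      unfolding \<S>_def mem_Collect_eq by (intro conjI ballI)
  qed
  then obtain W where W: "W \<in> \<S>" and max: "\<And>W'. W' \<in> \<S> \<Longrightarrow> W \<subseteq> W' \<Longrightarrow> W' = W" by blast
  have Wp: "b \<in> W" "a \<notin> W" "\<And>x y. x \<in> W \<Longrightarrow> y \<in> W \<Longrightarrow> x + y \<in> W" "\<And>l x. l \<in> L \<Longrightarrow> x \<in> W \<Longrightarrow> l * x \<in> W"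
    using W by (auto simp: \<S>_def)
  have W0: "0 \<in> W" using Wp(4)[OF L0 Wp(1)] by simp
  have Wneg: "- x \<in> W" if "x \<in> W" for x using Wp(4)[OF L(4)[OF L(1)] that] by simp
  have ex: "\<exists>l\<in>L. x - l * a \<in> W" for x
  proof (cases "x \<in> W")
    case True
    then show ?thesis using L0 by (auto intro: bexI[of _ 0])
  next
    case False
    let ?W = "{w + l * x |w l. w \<in> W \<and> l \<in> L}"
    have sub: "W \<subseteq> ?W"
    proof
      fix w assume "w \<in> W"
      with L0 have "w + 0 * x \<in> ?W" by blast
      then show "w \<in> ?W" by simp
    qed
    have "0 + 1 * x \<in> ?W" using W0 L(1) by blast
    then have "x \<in> ?W" by simp
    with False have "?W \<noteq> W" by blast
    then have notin: "?W \<notin> \<S>" using max[OF _ sub] by blast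
    have bW: "b \<in> ?W" using sub Wp(1) by (rule subsetD)
    have addW: "y + z \<in> ?W" if "y \<in> ?W" "z \<in> ?W" for y z
    proof -
      from that obtain w l w' l' where y: "w \<in> W" "l \<in> L" "y = w + l * x"
        and z: "w' \<in> W" "l' \<in> L" "z = w' + l' * x" by blast
      have "y + z = (w + w') + (l + l') * x" by (simp add: y(3) z(3) algebra_simps)
      moreover have "w + w' \<in> W" by (rule Wp(3)[OF y(1) z(1)])
      moreover have "l + l' \<in> L" by (rule L(2)[OF y(2) z(2)])
      ultimately show ?thesis by blast
    qed
    have multW: "l * y \<in> ?W" if "l \<in> L" "y \<in> ?W" for l y
    proof -
      from that(2) obtain w l' where y: "w \<in> W" "l' \<in> L" "y = w + l' * x" by blast
      have "l * y = l * w + (l * l') * x" by (simp add: y(3) algebra_simps)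
      moreover have "l * w \<in> W" by (rule Wp(4)[OF that(1) y(1)])
      moreover have "l * l' \<in> L" by (rule L(3)[OF that(1) y(2)])
      ultimately show ?thesis by blast
    qed
    have "a \<in> ?W"
    proof (rule ccontr)
      assume na: "a \<notin> ?W"
      have "?W \<in> \<S>"
        unfolding \<S>_def by (rule CollectI, intro conjI ballI bW na addW multW)
      with notin show False by (rule notE)
    qed
    then obtain w l where wl: "w \<in> W" "l \<in> L" "a = w + l * x" by blast
    then have l: "l \<noteq> 0" using Wp(2) by auto
    have "x - inverse l * a = inverse l * (- w)" using l by (simp add: wl(3) field_simps)
    also have "\<dots> \<in> W" by (intro Wp(4) L(5) wl l Wneg)
    finally show ?thesis using L(5)[OF wl(2) l] by blast
  qed
  have unique: "l = l'" if "l \<in> L" "l' \<in> L" "x - l * a \<in> W" "x - l' * a \<in> W" for x l l'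
  proof (rule ccontr)
    assume "l \<noteq> l'"
    have "(x - l * a) + - (x - l' * a) \<in> W" by (intro Wp(3) Wneg that)
    then have d: "(l' - l) * a \<in> W" by (simp add: algebra_simps)
    have "l' - l \<in> L" using L(2)[OF that(2) L(4)[OF that(1)]] by simp
    then have "inverse (l' - l) * ((l' - l) * a) \<in> W" using \<open>l \<noteq> l'\<close> by (intro Wp(4) L(5) d) auto
    moreover have "inverse (l' - l) * ((l' - l) * a) = a"
      using \<open>l \<noteq> l'\<close> by (simp add: mult.assoc[symmetric])
    ultimately show False using Wp(2) by simp
  qed
  define \<phi> where "\<phi> x = (THE l. l \<in> L \<and> x - l * a \<in> W)" for x
  have phi: "\<phi> x = l" if "l \<in> L" "x - l * a \<in> W" for x l
    unfolding \<phi>_def by (rule the_equality) (use that unique in blast)+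
  have phi': "\<phi> x \<in> L" "x - \<phi> x * a \<in> W" for x
  proof -
    obtain l where l: "l \<in> L" "x - l * a \<in> W" using ex by blast
    then show "\<phi> x \<in> L" "x - \<phi> x * a \<in> W" by (simp_all only: phi[OF l])
  qed
  show thesis
  proof (rule that[of \<phi>])
    fix x y
    have "(x - \<phi> x * a) + (y - \<phi> y * a) \<in> W" by (intro Wp(3) phi')
    then show "\<phi> (x + y) = \<phi> x + \<phi> y"
      by (intro phi L(2) phi') (simp add: algebra_simps)
  next
    fix l x assume l: "l \<in> L"
    have "l * (x - \<phi> x * a) \<in> W" by (intro Wp(4) l phi')
    then show "\<phi> (l * x) = l * \<phi> x"
      by (intro phi L(3) l phi') (simp add: algebra_simps)
  qed (rule phi; use L0 L(1) W0 Wp(1) in simp)+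
qed


section \<open>The generators are invariant\<close>

lemma field_adjoin_closed:
  fixes S :: "'a::field ratfun set"
  shows field_adjoin_one: "1 \<in> field_adjoin S"
    and field_adjoin_const: "to_fract (mconst c) \<in> field_adjoin S"
    and field_adjoin_incl: "s \<in> S \<Longrightarrow> s \<in> field_adjoin S"
    and field_adjoin_add: "x \<in> field_adjoin S \<Longrightarrow> y \<in> field_adjoin S \<Longrightarrow> x + y \<in> field_adjoin S"
    and field_adjoin_mult: "x \<in> field_adjoin S \<Longrightarrow> y \<in> field_adjoin S \<Longrightarrow> x * y \<in> field_adjoin S"
    and field_adjoin_uminus: "x \<in> field_adjoin S \<Longrightarrow> - x \<in> field_adjoin S"
    and field_adjoin_inverse: "x \<in> field_adjoin S \<Longrightarrow> x \<noteq> 0 \<Longrightarrow> inverse x \<in> field_adjoin S"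
    and field_adjoin_induct: "x \<in> field_adjoin S \<Longrightarrow> (\<And>c. Q (to_fract (mconst c))) \<Longrightarrow>
      (\<And>s. s \<in> S \<Longrightarrow> Q s) \<Longrightarrow> (\<And>x y. Q x \<Longrightarrow> Q y \<Longrightarrow> Q (x + y)) \<Longrightarrow> (\<And>x y. Q x \<Longrightarrow> Q y \<Longrightarrow> Q (x * y)) \<Longrightarrow>
      (\<And>x. Q x \<Longrightarrow> Q (- x)) \<Longrightarrow> (\<And>x. Q x \<Longrightarrow> x \<noteq> 0 \<Longrightarrow> Q (inverse x)) \<Longrightarrow> Q x"
proof -
  let ?R = "ring_of_type_algebra :: 'a ratfun ring"
  interpret R: field ?R by (rule field_from_type_algebra)
  have ops: "\<one>\<^bsub>?R\<^esub> = 1" "\<zero>\<^bsub>?R\<^esub> = 0" "(\<oplus>\<^bsub>?R\<^esub>) = (+)" "(\<otimes>\<^bsub>?R\<^esub>) = (*)" "carrier ?R = UNIV"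
    by (auto simp: ring_of_type_algebra_def)
  have neg: "\<ominus>\<^bsub>?R\<^esub> x = - x" for x
    by (rule R.minus_equality) (simp_all add: ops)
  have inv: "inv\<^bsub>?R\<^esub> x = inverse x" if "x \<noteq> 0" for x
    by (rule R.comm_inv_char) (use that in \<open>simp_all add: ops\<close>)
  note intros = generate_field.intros[where R = ?R and H = "range (\<lambda>c. to_fract (mconst c)) \<union> S"]
  show "1 \<in> field_adjoin S" "to_fract (mconst c) \<in> field_adjoin S" "s \<in> S \<Longrightarrow> s \<in> field_adjoin S"
    "x \<in> field_adjoin S \<Longrightarrow> y \<in> field_adjoin S \<Longrightarrow> x + y \<in> field_adjoin S"
    "x \<in> field_adjoin S \<Longrightarrow> y \<in> field_adjoin S \<Longrightarrow> x * y \<in> field_adjoin S"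
    "x \<in> field_adjoin S \<Longrightarrow> - x \<in> field_adjoin S"
    "x \<in> field_adjoin S \<Longrightarrow> x \<noteq> 0 \<Longrightarrow> inverse x \<in> field_adjoin S"
    unfolding field_adjoin_def
    using intros(1) intros(2)[of "to_fract (mconst c)"] intros(2)[of s] intros(3)[of x]
      intros(4)[of x] intros(5,6)[of x y]
    by (simp_all add: ops neg inv)
  assume x: "x \<in> field_adjoin S" and Q: "\<And>c. Q (to_fract (mconst c))"
      "\<And>s. s \<in> S \<Longrightarrow> Q s" "\<And>x y. Q x \<Longrightarrow> Q y \<Longrightarrow> Q (x + y)" "\<And>x y. Q x \<Longrightarrow> Q y \<Longrightarrow> Q (x * y)"
      "\<And>x. Q x \<Longrightarrow> Q (- x)" "\<And>x. Q x \<Longrightarrow> x \<noteq> 0 \<Longrightarrow> Q (inverse x)"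
  from x[unfolded field_adjoin_def] show "Q x"
  proof (induction rule: generate_field.induct)
    case one
    then show ?case using Q(1)[of 1] by (simp add: ops)
  next
    case (incl h)
    then show ?case using Q(1,2) by auto
  next
    case (m_inv h)
    then show ?case using Q(6) by (simp add: ops inv)
  qed (use Q(3-5) in \<open>simp_all add: ops neg\<close>)
qed

lemma field_adjoin_sum:
  "(\<And>i. i \<in> I \<Longrightarrow> f i \<in> field_adjoin S) \<Longrightarrow> sum f I \<in> field_adjoin S"
proof (induction I rule: infinite_finite_induct)
  case (insert i I)
  then show ?case by (simp add: field_adjoin_add)
qed (use field_adjoin_const[of 0 S] in simp_all)

lemma field_adjoin_power: "x \<in> field_adjoin S \<Longrightarrow> x ^ k \<in> field_adjoin S"
  by (induction k) (auto intro: field_adjoin_one field_adjoin_mult)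

lemma comm_ring_hom_msubst: "comm_ring_hom (msubst y)"
  by unfold_locales (simp_all add: msubst_add msubst_mult)

lemma comm_ring_hom_to_fract: "comm_ring_hom to_fract"
  by unfold_locales simp_all

lemma comm_ring_hom_mconst: "comm_ring_hom mconst"
  by unfold_locales (simp_all add: mconst_add mconst_mult)

lemma \<sigma>_hom:
  assumes T: "T \<in> GL n"
  shows \<sigma>_add: "\<sigma> n T (f + g) = \<sigma> n T f + \<sigma> n T g"
    and \<sigma>_mult: "\<sigma> n T (f * g) = \<sigma> n T f * \<sigma> n T g"
    and \<sigma>_uminus: "\<sigma> n T (- f) = - \<sigma> n T f"
    and \<sigma>_inverse: "\<sigma> n T (inverse f) = inverse (\<sigma> n T f)"
    and \<sigma>_to_fract: "\<sigma> n T (to_fract p) = to_fract (msubst (linear_subst n T) p)"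
proof -
  interpret h: comm_ring_hom "msubst (linear_subst n T)" by (rule comm_ring_hom_msubst)
  obtain a b where f: "f = Fract a b" "b \<noteq> 0" by (cases f)
  obtain c d where g: "g = Fract c d" "d \<noteq> 0" by (cases g)
  note nz = msubst_linear_subst_eq_0_iff[OF T]
  note [simp] = f(2) g(2) \<sigma>_Fract[OF T] nz
  show "\<sigma> n T (f + g) = \<sigma> n T f + \<sigma> n T g"
    by (simp add: f(1) g(1) h.hom_add h.hom_mult)
  show "\<sigma> n T (f * g) = \<sigma> n T f * \<sigma> n T g"
    by (simp add: f(1) g(1) h.hom_add h.hom_mult)
  show "\<sigma> n T (- f) = - \<sigma> n T f"
    by (simp add: f(1) h.hom_uminus)
  show "\<sigma> n T (to_fract p) = to_fract (msubst (linear_subst n T) p)"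
    by (simp add: to_fract_def)
  show "\<sigma> n T (inverse f) = inverse (\<sigma> n T f)"
  proof (cases "a = 0")
    case True
    then have "f = 0" by (simp add: f eq_fract Zero_fract_def)
    moreover have "\<sigma> n T 0 = 0" using \<sigma>_Fract[OF T, of 1 0] by (simp add: Zero_fract_def[symmetric])
    ultimately show ?thesis by simp
  qed (simp add: f(1))
qed

lemma comm_ring_hom_frobenius:
  assumes "CHAR('a::{field,finite}) = 2" and "(1::'r::comm_ring_1) + 1 = 0"
  shows "comm_ring_hom (\<lambda>x::'r. x ^ (CARD('a) ^ k))"
proof -
  have q: "CARD('a) > 0" by (simp add: finite_UNIV_card_ge_0)
  have "(x + y) ^ (CARD('a) ^ k) = x ^ (CARD('a) ^ k) + y ^ (CARD('a) ^ k)" for x y :: 'r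
    by (induction k) (simp_all add: power_mult mult.commute[of "CARD('a)"] frobenius_add[OF assms])
  then show ?thesis
    by unfold_locales (simp_all add: power_mult_distrib zero_power q)
qed

lemma finite_field_power_card_power:
  fixes x :: "'a::{field,finite}" shows "x ^ (CARD('a) ^ k) = x"
  by (induction k) (simp_all add: power_mult finite_field_power_card)

lemma bilinear_congruence:
  fixes T N :: "'r::comm_ring_1 mat"
  assumes [simp]: "T \<in> carrier_mat n n" "N \<in> carrier_mat n n" "x \<in> carrier_vec n" "z \<in> carrier_vec n"
  shows "(transpose_mat T *\<^sub>v x) \<bullet> (N *\<^sub>v (transpose_mat T *\<^sub>v z)) = x \<bullet> ((T * N * transpose_mat T) *\<^sub>v z)"
proof -
  have "(transpose_mat T *\<^sub>v x) \<bullet> (N *\<^sub>v (transpose_mat T *\<^sub>v z)) =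
      x \<bullet> (T *\<^sub>v (N *\<^sub>v (transpose_mat T *\<^sub>v z)))"
    by (rule transpose_vec_mult_scalar[of _ n n]) (auto intro!: mult_mat_vec_carrier[of _ n n])
  also have "T *\<^sub>v (N *\<^sub>v (transpose_mat T *\<^sub>v z)) = (T * N * transpose_mat T) *\<^sub>v z"
    by (simp add: assoc_mult_mat_vec[of _ n n _ n] mult_carrier_mat[of _ n n] mult_mat_vec_carrier[of _ n n])
  finally show ?thesis .
qed

lemma bilinear_sum:
  fixes N :: "'r::comm_ring_1 mat"
  assumes "N \<in> carrier_mat n n" "x \<in> carrier_vec n" "z \<in> carrier_vec n"
  shows "x \<bullet> (N *\<^sub>v z) = (\<Sum>i<n. \<Sum>j<n. N $$ (i, j) * (x $ i * z $ j))"
  using assms by (auto simp: scalar_prod_def lessThan_atLeast0 sum_distrib_left ac_simps intro!: sum.cong)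

lemma (in comm_ring_hom) hom_scalar_prod:
  "dim_vec u = dim_vec v \<Longrightarrow> hom (u \<bullet> v) = map_vec hom u \<bullet> map_vec hom v"
  by (simp add: scalar_prod_def hom_distribs)

lemma hom_P_poly:
  fixes hom :: "'a::{field,finite} mpoly \<Rightarrow> 'r::comm_ring_1"
  assumes hom: "comm_ring_hom hom" and G: "G \<in> carrier_mat n n"
  defines "x \<equiv> vec n (\<lambda>i. hom (mvar i))"
  shows "hom (P_poly n G 0) = x \<bullet> (map_mat (hom \<circ> mconst) G *\<^sub>v x)"
    and "k > 0 \<Longrightarrow> hom (P_poly n G k) = x \<bullet> (map_mat (hom \<circ> mconst) (G + transpose_mat G) *\<^sub>v
      map_vec (\<lambda>y. y ^ (CARD('a) ^ k)) x)"
proof -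
  interpret comm_ring_hom hom by fact
  have *: "hom (mvar_vec n \<bullet> (map_mat mconst N *\<^sub>v z)) = x \<bullet> (map_mat (hom \<circ> mconst) N *\<^sub>v map_vec hom z)"
    if "N \<in> carrier_mat n n" "z \<in> carrier_vec n" for N z
  proof -
    have "map_vec hom (mvar_vec n) = x" by (auto simp: x_def mvar_vec_def)
    moreover have "map_vec hom (map_mat mconst N *\<^sub>v z) = map_mat hom (map_mat mconst N) *\<^sub>v map_vec hom z"
      by (rule mult_mat_vec_hom) (use that in auto)
    moreover have "map_mat hom (map_mat mconst N) = map_mat (hom \<circ> mconst) N" by auto
    ultimately show ?thesis
      using that by (subst hom_scalar_prod) (auto simp: mvar_vec_def)
  qed
  have X: "mvar_vec n \<in> carrier_vec n" by (simp add: mvar_vec_def)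
  have 1: "map_vec hom (mvar_vec n) = x" by (auto simp: x_def mvar_vec_def)
  have 2: "map_vec hom (map_vec (\<lambda>x. x ^ (CARD('a) ^ k)) (mvar_vec n)) = map_vec (\<lambda>y. y ^ (CARD('a) ^ k)) x" for k
    by (auto simp: x_def mvar_vec_def hom_distribs)
  show "hom (P_poly n G 0) = x \<bullet> (map_mat (hom \<circ> mconst) G *\<^sub>v x)"
    using *[OF G X] by (simp add: P_poly_def 1)
  show "hom (P_poly n G k) = x \<bullet> (map_mat (hom \<circ> mconst) (G + transpose_mat G) *\<^sub>v
      map_vec (\<lambda>y. y ^ (CARD('a) ^ k)) x)" if "k > 0"
    using *[of "G + transpose_mat G" "map_vec (\<lambda>x. x ^ (CARD('a) ^ k)) (mvar_vec n)"] G X that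
    by (simp add: P_poly_def 2)
qed

lemma one_add_one_char_two:
  assumes "CHAR('a::field) = 2"
  shows "(1::'a) + 1 = 0" and "(1::'a mpoly) + 1 = 0" and "(1::'a ratfun) + 1 = 0"
proof -
  show field: "(1::'a) + 1 = 0"
    using of_nat_CHAR[where 'a = 'a] by (simp add: assms)
  have "(1::'a mpoly) + 1 = mconst (1 + 1)" by (simp only: mconst_add mconst_1)
  then show mpoly: "(1::'a mpoly) + 1 = 0" by (simp only: field mconst_0)
  have "(1::'a ratfun) + 1 = to_fract (1 + 1)" by (simp only: to_fract_add to_fract_1)
  then show "(1::'a ratfun) + 1 = 0" by (simp only: mpoly to_fract_0)
qed

text \<open>
  Both normal forms have a polar matrix that is an involution in characteristic two.
\<close>

locale char_two_form =
  fixes n :: nat and G :: "'a::{field,finite} mat"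
  assumes char: "CHAR('a) = 2" and G_carrier: "G \<in> carrier_mat n n"
    and polar_square: "(G + transpose_mat G) * (G + transpose_mat G) = 1\<^sub>m n"
begin

lemmas two = one_add_one_char_two[OF char]

sublocale base: form_char_two "{0::'a}" n G "G + transpose_mat G"
    "(G + transpose_mat G) * G * (G + transpose_mat G)"
  by unfold_locales (use two(1) G_carrier polar_square in auto)

lemma minus_mat_eq_plus: "B \<in> carrier_mat n n \<Longrightarrow> C \<in> carrier_mat n n \<Longrightarrow> B - C = (B + C :: 'a mat)"
  by (rule eq_matI) auto

lemma alternate_mat_iff:
  assumes "N \<in> carrier_mat n n"
  shows "alternate_mat N \<longleftrightarrow> base.alt N"
  using assms unfolding alternate_mat_def base.alt_def base.cong_def
  by (auto simp: eq_neg_iff_add_eq_0 simp del: base.uminus_char_two)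

lemma alt_cong_iff:
  assumes "T \<in> carrier_mat n n"
  shows "T * G * transpose_mat T \<equiv>\<^sub>a G \<longleftrightarrow> base.isom T"
  using assms G_carrier unfolding alt_cong_def base.isom_def
  by (simp add: minus_mat_eq_plus alternate_mat_iff)

lemma orthogonal_iff: "T \<in> orthogonal_group n G \<longleftrightarrow> T \<in> GL n \<and> base.isom T"
  unfolding orthogonal_group_def GL_def using alt_cong_iff by auto

lemma orthogonal_isom:
  assumes "T \<in> orthogonal_group n G"
  shows "T \<in> GL n" "T \<in> carrier_mat n n" "base.isom T"
  using assms by (auto simp: orthogonal_iff base.isom_def)

lemma alt_map_mat:
  fixes \<kappa> :: "'a \<Rightarrow> 'r::comm_ring_1"
  assumes N: "base.alt N" and "comm_ring_hom \<kappa>" and "ideal_char_two J"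
  shows "ideal_char_two.alt J n (map_mat \<kappa> N)"
proof -
  interpret \<kappa>: comm_ring_hom \<kappa> by fact
  interpret J: ideal_char_two J n by fact
  have NC [simp]: "N \<in> carrier_mat n n" using N by (rule base.alt_carrier)
  show ?thesis
    unfolding J.alt_def
  proof (intro conjI allI impI)
    fix i assume i: "i < n"
    then have "N $$ (i, i) = 0" using N by (simp add: base.alt_def)
    with i show "map_mat \<kappa> N $$ (i, i) \<in> J" using carrier_matD[OF NC] by simp
  next
    fix i j assume ij: "i < n" "j < n"
    then have "N $$ (i, j) + N $$ (j, i) = 0" using N by (simp add: base.alt_def base.cong_def)
    then have "\<kappa> (N $$ (i, j)) + \<kappa> (N $$ (j, i)) = 0"
      by (simp only: \<kappa>.hom_add[symmetric] \<kappa>.hom_zero)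
    with ij show "J.cong (map_mat \<kappa> N $$ (i, j)) (map_mat \<kappa> N $$ (j, i))"
      using carrier_matD[OF NC] by (simp add: J.cong_def)
  qed simp
qed

text \<open>
  The entries of \<open>T\<close> are fixed by Frobenius, so the vector of the
  \<open>q\<^sup>k\<close>-th powers of the variables is transformed by the same matrix
  \<open>T\<close> as the variables; \<open>T\<close> preserves the quadratic and the polar
  form.
\<close>

lemma P_poly_invariant:
  assumes T: "T \<in> orthogonal_group n G"
  shows "msubst (linear_subst n T) (P_poly n G k) = P_poly n G k"
proof -
  note Tc = orthogonal_isom(2)[OF T] and isom = orthogonal_isom(3)[OF T]
  interpret h: comm_ring_hom "msubst (linear_subst n T)" by (rule comm_ring_hom_msubst)
  interpret c: comm_ring_hom "mconst :: 'a \<Rightarrow> 'a mpoly" by (rule comm_ring_hom_mconst)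
  interpret R: ideal_char_two "{0 :: 'a mpoly}" n by unfold_locales (rule two(2), auto)
  let ?T = "map_mat mconst T" and ?G = "map_mat mconst G" and ?A = "map_mat mconst (G + transpose_mat G)"
  let ?X = "mvar_vec n :: 'a mpoly vec"
  have [simp]: "?T \<in> carrier_mat n n" "?G \<in> carrier_mat n n" "?A \<in> carrier_mat n n" "?X \<in> carrier_vec n"
    using Tc G_carrier by (auto simp: mvar_vec_def)
  have mc: "msubst (linear_subst n T) \<circ> mconst = (mconst :: 'a \<Rightarrow> _)" "msubst mvar \<circ> mconst = (mconst :: 'a \<Rightarrow> _)"
    by auto
  have X: "vec n (\<lambda>i. msubst mvar (mvar i :: 'a mpoly)) = ?X" by (simp add: mvar_vec_def)
  have x: "vec n (\<lambda>i. msubst (linear_subst n T) (mvar i)) = transpose_mat ?T *\<^sub>v ?X"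
    using Tc by (intro eq_vecI)
      (auto simp: linear_subst_def intro!: comm_scalar_prod[of _ n] simp: mvar_vec_def simp del: col_map_mat)
  show ?thesis
  proof (cases "k = 0")
    case True
    have "msubst (linear_subst n T) (P_poly n G 0) = ?X \<bullet> ((?T * ?G * transpose_mat ?T) *\<^sub>v ?X)"
      unfolding hom_P_poly(1)[OF h.comm_ring_hom_axioms G_carrier] mc x by (rule bilinear_congruence[of _ n]) (use Tc G_carrier in \<open>simp_all add: mvar_vec_def\<close>)
    also have "?T * ?G * transpose_mat ?T = map_mat mconst (T * G * transpose_mat T)"
      using Tc G_carrier by (simp add: c.mat_hom_mult[of _ n n _ n] map_mat_transpose)
    finally have e1: "msubst (linear_subst n T) (P_poly n G 0) = ?X \<bullet> (map_mat mconst (T * G * transpose_mat T) *\<^sub>v ?X)" .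
    have e2: "P_poly n G 0 = ?X \<bullet> (?G *\<^sub>v ?X)"
      using hom_P_poly(1)[OF comm_ring_hom_msubst[of mvar] G_carrier] unfolding mc X by simp
    have alt: "R.alt (map_mat mconst (T * G * transpose_mat T + G))"
      by (rule alt_map_mat[OF _ c.comm_ring_hom_axioms R.ideal_char_two_axioms])
        (use isom in \<open>simp add: base.isom_def\<close>)
    define N where "N = T * G * transpose_mat T"
    have NC: "N \<in> carrier_mat n n" using Tc G_carrier by (simp add: N_def)
    have NG: "map_mat mconst (N + G) = map_mat mconst N + ?G"
      using carrier_matD[OF NC] carrier_matD[OF G_carrier] by (intro eq_matI) (simp_all add: mconst_add)
    have "?X \<bullet> (map_mat mconst (N + G) *\<^sub>v ?X) = ?X \<bullet> (map_mat mconst N *\<^sub>v ?X) + ?X \<bullet> (?G *\<^sub>v ?X)"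
      unfolding NG using NC G_carrier
      by (subst add_mult_distrib_mat_vec[of _ n n]; (subst scalar_prod_add_distrib[of _ n])?)
        (auto simp: mvar_vec_def intro!: mult_mat_vec_carrier[of _ n n])
    then have "msubst (linear_subst n T) (P_poly n G 0) + P_poly n G 0 =
        ?X \<bullet> (map_mat mconst (N + G) *\<^sub>v ?X)"
      using arg_cong2[OF e1 e2, of "(+)"] by (simp only: N_def)
    also have "\<dots> = 0"
      using R.alt_bilinear_mem[OF alt, of "\<lambda>i j. ?X $ i * ?X $ j"] R.alt_carrier[OF alt]
      unfolding N_def by (subst bilinear_sum[of _ n]) (simp_all add: mult.commute mvar_vec_def)
    finally show ?thesis
      unfolding True by (simp only: R.minus_char_two[symmetric] eq_iff_diff_eq_0[symmetric])
  next
    case False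
    interpret F: comm_ring_hom "\<lambda>x :: 'a mpoly. x ^ (CARD('a) ^ k)"
      by (rule comm_ring_hom_frobenius[OF char two(2)])
    have "map_vec (\<lambda>y. y ^ (CARD('a) ^ k)) (transpose_mat ?T *\<^sub>v ?X) =
        map_mat (\<lambda>y. y ^ (CARD('a) ^ k)) (transpose_mat ?T) *\<^sub>v map_vec (\<lambda>y. y ^ (CARD('a) ^ k)) ?X"
      by (rule F.mult_mat_vec_hom[of _ n n]) (use Tc in simp_all)
    also have "map_mat (\<lambda>y. y ^ (CARD('a) ^ k)) (transpose_mat ?T) = transpose_mat ?T"
      using Tc by (intro eq_matI) (auto simp: c.hom_power[symmetric] finite_field_power_card_power)
    finally have Fx: "map_vec (\<lambda>y. y ^ (CARD('a) ^ k)) (transpose_mat ?T *\<^sub>v ?X) =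
        transpose_mat ?T *\<^sub>v map_vec (\<lambda>y. y ^ (CARD('a) ^ k)) ?X" .
    have "msubst (linear_subst n T) (P_poly n G k) =
        ?X \<bullet> ((?T * ?A * transpose_mat ?T) *\<^sub>v map_vec (\<lambda>y. y ^ (CARD('a) ^ k)) ?X)"
    proof -
      have "msubst (linear_subst n T) (P_poly n G k) = (transpose_mat ?T *\<^sub>v ?X) \<bullet>
          (?A *\<^sub>v (transpose_mat ?T *\<^sub>v map_vec (\<lambda>y. y ^ (CARD('a) ^ k)) ?X))"
        using hom_P_poly(2)[OF h.comm_ring_hom_axioms G_carrier, of k] False by (simp only: mc x Fx)
      also have "\<dots> = ?X \<bullet> ((?T * ?A * transpose_mat ?T) *\<^sub>v map_vec (\<lambda>y. y ^ (CARD('a) ^ k)) ?X)"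
        by (rule bilinear_congruence[of _ n]) (use Tc G_carrier in \<open>simp_all add: mvar_vec_def\<close>)
      finally show ?thesis .
    qed
    also have "?T * ?A * transpose_mat ?T = map_mat mconst (T * (G + transpose_mat G) * transpose_mat T)"
      using Tc G_carrier by (simp add: c.mat_hom_mult[of _ n n _ n] map_mat_transpose)
    also have "T * (G + transpose_mat G) * transpose_mat T = G + transpose_mat G"
    proof (rule eq_matI)
      let ?L = "T * (G + transpose_mat G) * transpose_mat T"
      fix i j assume "i < dim_row (G + transpose_mat G)" "j < dim_col (G + transpose_mat G)"
      then have ij: "i < n" "j < n" using G_carrier by auto
      have "\<forall>i<n. \<forall>j<n. ?L $$ (i, j) + (G + transpose_mat G) $$ (i, j) \<in> {0}"
        using base.isom_bilinear[OF isom] unfolding base.mcong_def base.cong_def by (elim conjE)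
      from this[rule_format, OF ij] have "?L $$ (i, j) + (G + transpose_mat G) $$ (i, j) = 0"
        by (rule singletonD)
      then show "?L $$ (i, j) = (G + transpose_mat G) $$ (i, j)"
        by (simp only: base.minus_char_two[symmetric] eq_iff_diff_eq_0[symmetric])
    qed (use carrier_matD[OF Tc] carrier_matD[OF G_carrier] in simp_all)
    also have "?X \<bullet> (?A *\<^sub>v map_vec (\<lambda>y. y ^ (CARD('a) ^ k)) ?X) = P_poly n G k"
      using hom_P_poly(2)[OF comm_ring_hom_msubst[of mvar] G_carrier, of k] False unfolding mc X by simp
    finally show ?thesis .
  qed
qed

lemma P_poly_in_rational_function_field: "to_fract (P_poly n G k) \<in> rational_function_field n"
proof -
  interpret h: comm_ring_hom "to_fract :: 'a mpoly \<Rightarrow> _" by (rule comm_ring_hom_to_fract)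
  let ?x = "vec n (\<lambda>i. to_fract (mvar i :: 'a mpoly))"
  have x: "to_fract (mvar i :: 'a mpoly) \<in> rational_function_field n" if "i < n" for i
    unfolding rational_function_field_def using that by (intro field_adjoin_incl) auto
  have *: "?x \<bullet> (map_mat (to_fract \<circ> mconst) N *\<^sub>v z) \<in> rational_function_field n"
    if "N \<in> carrier_mat n n" "z \<in> carrier_vec n" "\<And>i. i < n \<Longrightarrow> vec_index z i \<in> rational_function_field n" for N z
    using that x unfolding rational_function_field_def
    by (subst bilinear_sum[of _ n])
      (auto intro!: field_adjoin_sum field_adjoin_mult field_adjoin_const)
  show ?thesis
  proof (cases "k = 0")
    case True
    then show ?thesis
      using hom_P_poly(1)[OF h.comm_ring_hom_axioms G_carrier] *[OF G_carrier, of ?x] x by simp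
  next
    case False
    then have "to_fract (P_poly n G k) = ?x \<bullet> (map_mat (to_fract \<circ> mconst) (G + transpose_mat G) *\<^sub>v
        map_vec (\<lambda>y. y ^ (CARD('a) ^ k)) ?x)"
      by (intro hom_P_poly(2)[OF h.comm_ring_hom_axioms G_carrier]) simp
    also have "\<dots> \<in> rational_function_field n"
      using G_carrier x by (intro *) (auto simp: rational_function_field_def intro: field_adjoin_power)
    finally show ?thesis .
  qed
qed

lemma field_adjoin_subset_invariant_field:
  "field_adjoin ((\<lambda>k. to_fract (P_poly n G k)) ` K) \<subseteq> invariant_field n (orthogonal_group n G)"
proof
  fix f assume "f \<in> field_adjoin ((\<lambda>k. to_fract (P_poly n G k)) ` K)"
  then have "f \<in> rational_function_field n \<and> (\<forall>T\<in>orthogonal_group n G. \<sigma> n T f = f)"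
  proof (rule field_adjoin_induct)
    fix s assume "s \<in> (\<lambda>k. to_fract (P_poly n G k)) ` K"
    then show "s \<in> rational_function_field n \<and> (\<forall>T\<in>orthogonal_group n G. \<sigma> n T s = s)"
      using P_poly_in_rational_function_field P_poly_invariant orthogonal_isom(1)
      by (auto simp: \<sigma>_to_fract)
  qed (use orthogonal_isom(1) in \<open>auto simp: rational_function_field_def \<sigma>_to_fract \<sigma>_add \<sigma>_mult \<sigma>_uminus \<sigma>_inverse
      intro: field_adjoin_add field_adjoin_mult field_adjoin_uminus field_adjoin_inverse field_adjoin_const\<close>)
  then show "f \<in> invariant_field n (orthogonal_group n G)" by (simp add: invariant_field_def)
qed

end


section \<open>The ring \<open>K[Y]\<close> and the Moore determinant\<close>

text \<open>
  Polynomials in the first \<open>n\<close> variables, as the fixed points of the ring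
  endomorphism that kills the other variables; closure under ring operations is then
  immediate.
\<close>

definition in_vars :: "nat \<Rightarrow> 'a::field mpoly \<Rightarrow> bool" where
  "in_vars n p \<longleftrightarrow> msubst (\<lambda>i. if i < n then mvar i else 0) p = p"

lemma in_vars_mconst: "in_vars n (mconst c)"
  and in_vars_mvar: "i < n \<Longrightarrow> in_vars n (mvar i)"
  and in_vars_add: "in_vars n p \<Longrightarrow> in_vars n r \<Longrightarrow> in_vars n (p + r)"
  and in_vars_mult: "in_vars n p \<Longrightarrow> in_vars n r \<Longrightarrow> in_vars n (p * r)"
  by (simp_all add: in_vars_def msubst_add msubst_mult)

lemma in_vars_uminus: "in_vars n p \<Longrightarrow> in_vars n (- p)"
proof -
  assume "in_vars n p"
  then have "in_vars n (mconst (- 1) * p)" by (intro in_vars_mult in_vars_mconst)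
  moreover have "mconst (- 1 :: 'a) + 1 = 0"
    using mconst_add[of "- 1 :: 'a" 1] by simp
  then have "mconst (- 1 :: 'a) = - 1" by (simp only: eq_neg_iff_add_eq_0)
  ultimately show ?thesis by simp
qed

lemma in_vars_induct [consumes 1, case_names const var add mult]:
  assumes p: "in_vars n p" and const: "\<And>c. Q (mconst c)" and var: "\<And>i. i < n \<Longrightarrow> Q (mvar i)"
    and add: "\<And>p r. Q p \<Longrightarrow> Q r \<Longrightarrow> Q (p + r)" and mult: "\<And>p r. Q p \<Longrightarrow> Q r \<Longrightarrow> Q (p * r)"
  shows "Q p"
proof -
  let ?y = "\<lambda>i. if i < n then mvar i else 0 :: 'a mpoly"
  have Q0: "Q 0" and Q1: "Q 1" using const[of 0] const[of 1] by simp_all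
  have Q_sum: "Q (sum f S)" if "\<And>i. i \<in> S \<Longrightarrow> Q (f i)" for f and S :: "'i set"
    using that by (induction S rule: infinite_finite_induct) (auto intro: Q0 add)
  have Q_prod: "Q (prod f S)" if "\<And>i. i \<in> S \<Longrightarrow> Q (f i)" for f and S :: "nat set"
    using that by (induction S rule: infinite_finite_induct) (auto intro: Q1 mult)
  have Q_power: "Q (r ^ k)" if "Q r" for r k
    using that by (induction k) (auto intro: Q1 mult)
  have "Q (?y i)" for i using var Q0 by auto
  then have "Q (msubst ?y p)"
    unfolding msubst_def by (intro Q_sum mult const Q_prod Q_power)
  with p show ?thesis by (simp add: in_vars_def)
qed

lemma rational_function_field_cases:
  assumes "f \<in> rational_function_field n"
  obtains a b where "in_vars n a" "in_vars n b" "b \<noteq> 0" "f = Fract a b"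
proof -
  have "\<exists>a b. in_vars n a \<and> in_vars n b \<and> b \<noteq> 0 \<and> f = Fract a b"
    using assms unfolding rational_function_field_def
  proof (rule field_adjoin_induct)
    fix c :: 'a
    show "\<exists>a b. in_vars n a \<and> in_vars n b \<and> b \<noteq> 0 \<and> to_fract (mconst c) = Fract a b"
      by (rule exI[of _ "mconst c"], rule exI[of _ 1])
        (use in_vars_mconst[of n c] in_vars_mconst[of n 1] in \<open>auto simp: to_fract_def\<close>)
  next
    fix s :: "'a ratfun" assume "s \<in> (\<lambda>i. to_fract (mvar i)) ` {..<n}"
    then show "\<exists>a b. in_vars n a \<and> in_vars n b \<and> b \<noteq> 0 \<and> s = Fract a b"
      using in_vars_mvar[of _ n] in_vars_mconst[of n 1] by (fastforce simp: to_fract_def)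
  next
    fix x y :: "'a ratfun"
    assume "\<exists>a b. in_vars n a \<and> in_vars n b \<and> b \<noteq> 0 \<and> x = Fract a b"
      "\<exists>a b. in_vars n a \<and> in_vars n b \<and> b \<noteq> 0 \<and> y = Fract a b"
    then obtain a b c d where *: "in_vars n a" "in_vars n b" "b \<noteq> 0" "x = Fract a b"
      "in_vars n c" "in_vars n d" "d \<noteq> 0" "y = Fract c d" by blast
    show "\<exists>a b. in_vars n a \<and> in_vars n b \<and> b \<noteq> 0 \<and> x + y = Fract a b"
      by (rule exI[of _ "a * d + c * b"], rule exI[of _ "b * d"])
        (use * in \<open>auto intro: in_vars_add in_vars_mult\<close>)
    show "\<exists>a b. in_vars n a \<and> in_vars n b \<and> b \<noteq> 0 \<and> x * y = Fract a b"
      by (rule exI[of _ "a * c"], rule exI[of _ "b * d"]) (use * in \<open>auto intro: in_vars_mult\<close>)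
  next
    fix x :: "'a ratfun"
    assume "\<exists>a b. in_vars n a \<and> in_vars n b \<and> b \<noteq> 0 \<and> x = Fract a b"
    then obtain a b where *: "in_vars n a" "in_vars n b" "b \<noteq> 0" "x = Fract a b" by blast
    show "\<exists>a b. in_vars n a \<and> in_vars n b \<and> b \<noteq> 0 \<and> - x = Fract a b"
      by (rule exI[of _ "- a"], rule exI[of _ b]) (use * in \<open>auto intro: in_vars_uminus\<close>)
    show "\<exists>a b. in_vars n a \<and> in_vars n b \<and> b \<noteq> 0 \<and> inverse x = Fract a b" if "x \<noteq> 0"
      by (rule exI[of _ b], rule exI[of _ a]) (use * that in \<open>auto simp: Zero_fract_def eq_fract\<close>)
  qed
  then show thesis using that by blast
qed

definition mpoly_map :: "('a::zero \<Rightarrow> 'b::zero) \<Rightarrow> ((nat \<Rightarrow>\<^sub>0 nat) \<Rightarrow>\<^sub>0 'a) \<Rightarrow> (nat \<Rightarrow>\<^sub>0 nat) \<Rightarrow>\<^sub>0 'b" where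
  "mpoly_map = Poly_Mapping.map"

lemma comm_ring_hom_mpoly_map:
  fixes \<kappa> :: "'a::field \<Rightarrow> 'k::field"
  assumes "comm_ring_hom \<kappa>"
  shows "comm_ring_hom (mpoly_map \<kappa>)"
    and mpoly_map_single: "mpoly_map \<kappa> (Poly_Mapping.single m c) = Poly_Mapping.single m (\<kappa> c)"
proof -
  interpret comm_ring_hom \<kappa> by fact
  have lookup: "Poly_Mapping.lookup (mpoly_map \<kappa> p) m = \<kappa> (Poly_Mapping.lookup p m)" for p m
    by (simp add: mpoly_map_def map.rep_eq when_def)
  have add: "mpoly_map \<kappa> (p + r) = mpoly_map \<kappa> p + mpoly_map \<kappa> r" for p r
    by (rule poly_mapping_eqI) (simp add: lookup lookup_add hom_add)
  have zero: "mpoly_map \<kappa> 0 = 0" by (rule poly_mapping_eqI) (simp add: lookup)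
  show single: "mpoly_map \<kappa> (Poly_Mapping.single m c) = Poly_Mapping.single m (\<kappa> c)" for m c
    by (rule poly_mapping_eqI) (simp add: lookup lookup_single when_def)
  have mult1: "mpoly_map \<kappa> (Poly_Mapping.single m c * r) = mpoly_map \<kappa> (Poly_Mapping.single m c) * mpoly_map \<kappa> r" for m c r
    by (induction r rule: poly_mapping_induct_add)
      (simp_all add: zero distrib_left add mult_single single hom_mult)
  have mult: "mpoly_map \<kappa> (p * r) = mpoly_map \<kappa> p * mpoly_map \<kappa> r" for p r
    by (induction p rule: poly_mapping_induct_add) (simp_all add: zero distrib_right add mult1)
  have one: "mpoly_map \<kappa> 1 = 1" using single[of 0 1] by simp
  show "comm_ring_hom (mpoly_map \<kappa>)"
    by unfold_locales (simp_all add: add mult zero one)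
qed

text \<open>
  The \<open>K\<close>-linear map from \<open>K[Y]\<close> to \<open>K\<close> that sends a
  monomial in \<open>Y\<close> to the value of \<open>\<phi>\<close> at the same monomial in
  \<open>X\<close>.
\<close>

definition apply_functional :: "('a::field ratfun \<Rightarrow> 'a ratfun) \<Rightarrow> 'a ratfun mpoly \<Rightarrow> 'a ratfun" where
  "apply_functional \<phi> p = (\<Sum>m\<in>Poly_Mapping.keys p. Poly_Mapping.lookup p m * \<phi> (to_fract (Poly_Mapping.single m 1)))"

lemma apply_functional_superset:
  assumes "finite S" "Poly_Mapping.keys p \<subseteq> S"
  shows "apply_functional \<phi> p = (\<Sum>m\<in>S. Poly_Mapping.lookup p m * \<phi> (to_fract (Poly_Mapping.single m 1)))"
  unfolding apply_functional_def
  by (rule sum.mono_neutral_left) (use assms in \<open>auto simp: in_keys_iff\<close>)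

lemma apply_functional_add: "apply_functional \<phi> (p + r) = apply_functional \<phi> p + apply_functional \<phi> r"
proof -
  let ?S = "Poly_Mapping.keys p \<union> Poly_Mapping.keys r"
  have "Poly_Mapping.keys (p + r) \<subseteq> ?S" by (rule Poly_Mapping.keys_add)
  then show ?thesis
    by (simp add: apply_functional_superset[of ?S] lookup_add distrib_right sum.distrib)
qed

lemma apply_functional_0: "apply_functional \<phi> 0 = 0"
  by (simp add: apply_functional_def)

lemma apply_functional_single:
  "apply_functional \<phi> (Poly_Mapping.single m c) = c * \<phi> (to_fract (Poly_Mapping.single m 1))"
  by (subst apply_functional_superset[of "{m}"]) (auto simp: keys_single)

lemma apply_functional_mconst: "apply_functional \<phi> (mconst c * p) = c * apply_functional \<phi> p"
  by (induction p rule: poly_mapping_induct_add)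
    (simp_all add: apply_functional_0 distrib_left apply_functional_add mconst_def mult_single
      apply_functional_single mult.assoc)

text \<open>
  The polynomial \<open>p(Y)\<close>: the variables of the outer polynomial ring over
  \<open>K\<close> are a second copy of those of \<open>K\<close>.
\<close>

definition coeff_embed :: "'a::field mpoly \<Rightarrow> 'a ratfun mpoly" where
  "coeff_embed = mpoly_map (to_fract \<circ> mconst)"

lemma comm_ring_hom_const: "comm_ring_hom (to_fract \<circ> mconst :: 'a::field \<Rightarrow> 'a ratfun)"
  by unfold_locales (simp_all add: mconst_add mconst_mult)

lemma comm_ring_hom_coeff_embed: "comm_ring_hom coeff_embed"
  unfolding coeff_embed_def by (rule comm_ring_hom_mpoly_map[OF comm_ring_hom_const])

lemma coeff_embed_single: "coeff_embed (Poly_Mapping.single m c) = Poly_Mapping.single m (to_fract (mconst c))"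
  unfolding coeff_embed_def by (simp add: mpoly_map_single[OF comm_ring_hom_const])

context
  fixes \<phi> :: "'a::field ratfun \<Rightarrow> 'a ratfun" and L :: "'a ratfun set"
  assumes add: "\<And>x y. \<phi> (x + y) = \<phi> x + \<phi> y"
    and scale: "\<And>l x. l \<in> L \<Longrightarrow> \<phi> (l * x) = l * \<phi> x"
    and const: "\<And>c. to_fract (mconst c) \<in> L"
begin

lemma apply_functional_single_coeff_embed:
  "apply_functional \<phi> (Poly_Mapping.single m c * coeff_embed p) = c * \<phi> (to_fract (Poly_Mapping.single m 1 * p))"
proof (induction p rule: poly_mapping_induct_add)
  case zero
  interpret e: comm_ring_hom "coeff_embed :: 'a mpoly \<Rightarrow> _" by (rule comm_ring_hom_coeff_embed)
  have "\<phi> 0 + \<phi> 0 = \<phi> 0 + 0" using add[of 0 0] by simp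
  then have "\<phi> 0 = 0" by (simp only: add_left_cancel)
  then show ?case by (simp add: apply_functional_0)
next
  case (add m' d p)
  interpret e: comm_ring_hom "coeff_embed :: 'a mpoly \<Rightarrow> _" by (rule comm_ring_hom_coeff_embed)
  have "Poly_Mapping.single (m + m') d = mconst d * Poly_Mapping.single (m + m') 1"
    by (simp add: mconst_def mult_single)
  then have "\<phi> (to_fract (Poly_Mapping.single (m + m') d)) =
      to_fract (mconst d) * \<phi> (to_fract (Poly_Mapping.single (m + m') 1))"
    by (simp add: scale const)
  then show ?case
    using add by (simp add: e.hom_add distrib_left apply_functional_add coeff_embed_single mult_single
      apply_functional_single \<open>\<And>x y. \<phi> (x + y) = \<phi> x + \<phi> y\<close> mult.assoc)
qed

text \<open>
  If \<open>p(X)\<close> lies in \<open>L\<close>, then multiplication by \<open>p(Y)\<close>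
  has the same effect under the functional as multiplication by the scalar
  \<open>p(X)\<close>; so \<open>p(Y) - p(X)\<close> generates an ideal in its kernel.
\<close>

lemma apply_functional_coeff_embed_scale:
  assumes "to_fract p \<in> L"
  shows "apply_functional \<phi> (r * coeff_embed p) = to_fract p * apply_functional \<phi> r"
proof (induction r rule: poly_mapping_induct_add)
  case (add m c r)
  have "\<phi> (to_fract (Poly_Mapping.single m 1 * p)) = to_fract p * \<phi> (to_fract (Poly_Mapping.single m 1))"
    by (simp only: mult.commute[of _ p] to_fract_mult scale[OF assms])
  with add show ?case
    by (simp add: distrib_right distrib_left apply_functional_add apply_functional_single_coeff_embed
        apply_functional_single mult.left_commute)
qed (simp add: apply_functional_0)

end

lemma linear_form_inject:
  fixes c d :: "nat \<Rightarrow> 'a::field"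
  assumes "(\<Sum>j<n. mconst (c j) * mvar j) = (\<Sum>j<n. mconst (d j) * mvar j)" "i < n"
  shows "c i = d i"
proof -
  have "Poly_Mapping.lookup (\<Sum>j<n. mconst (c j) * mvar j) (Poly_Mapping.single i 1) = c i" for c :: "nat \<Rightarrow> 'a"
  proof -
    have eq: "Poly_Mapping.single j (1::nat) = Poly_Mapping.single i 1 \<longleftrightarrow> j = i" for j :: nat
      by (metis lookup_single_eq lookup_single_not_eq zero_neq_one)
    have "Poly_Mapping.lookup (\<Sum>j<n. mconst (c j) * mvar j) (Poly_Mapping.single i 1) =
        (\<Sum>j<n. if j = i then c j else 0)"
      unfolding lookup_sum
      by (intro sum.cong) (simp_all add: mconst_def mvar_def mult_single lookup_single when_def eq[unfolded One_nat_def])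
    then show ?thesis using assms(2) by simp
  qed
  with assms(1) show ?thesis by metis
qed

text \<open>
  The Moore determinant. A linear relation between the rows gives a nonzero polynomial of
  degree at most \<open>q\<^sup>n\<^sup>-\<^sup>1\<close> that is additive and vanishes at all
  variables, hence at all \<open>q\<^sup>n\<close> linear forms with coefficients in the
  finite field.
\<close>

lemma moore_det_nonzero:
  assumes char: "CHAR('a::{field,finite}) = 2"
  shows "det (mat n n (\<lambda>(i, j). to_fract (mvar j :: 'a mpoly) ^ (CARD('a) ^ i))) \<noteq> 0"
    (is "det ?M \<noteq> 0")
proof
  let ?q = "CARD('a)"
  have q: "?q > 1" using card_mono[of "UNIV :: 'a set" "{0, 1}"] by simp
  assume "det ?M = 0"
  then have "det (transpose_mat ?M) = 0" by (simp add: det_transpose[of _ n])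
  then obtain v where v: "v \<in> carrier_vec n" "v \<noteq> 0\<^sub>v n" "transpose_mat ?M *\<^sub>v v = 0\<^sub>v n"
    using det_0_iff_vec_prod_zero_field[of "transpose_mat ?M" n] by auto
  define p where "p = (\<Sum>i<n. monom (vec_index v i) (?q ^ i))"
  have "\<exists>i<n. vec_index v i \<noteq> 0" using v(1,2) by (auto simp: vec_eq_iff)
  then obtain k where k: "k < n" "vec_index v k \<noteq> 0" by blast
  have "coeff p (?q ^ k) = (\<Sum>i<n. if i = k then vec_index v i else 0)"
    unfolding p_def coeff_sum by (intro sum.cong) (use q in \<open>auto simp: power_inject_exp\<close>)
  then have "p \<noteq> 0" using k by auto
  have deg: "degree p \<le> ?q ^ (n - 1)"
    unfolding p_def
  proof (rule degree_sum_le)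
    fix i assume "i \<in> {..<n}"
    then have "?q ^ i \<le> ?q ^ (n - 1)" using q by (intro power_increasing) auto
    then show "degree (monom (vec_index v i) (?q ^ i)) \<le> ?q ^ (n - 1)"
      using degree_monom_le order.trans by blast
  qed simp
  note two = one_add_one_char_two(3)[OF char]
  define lin where "lin c = to_fract (\<Sum>j<n. mconst (c j) * mvar j)" for c :: "nat \<Rightarrow> 'a"
  have root: "poly p (lin c) = 0" for c
  proof -
    have "lin c ^ (?q ^ i) = (\<Sum>j<n. to_fract (mconst (c j)) * ?M $$ (i, j))" if "i < n" for i
    proof -
      interpret F: comm_ring_hom "\<lambda>x :: 'a ratfun. x ^ (?q ^ i)"
        by (rule comm_ring_hom_frobenius[OF char two])
      interpret t: comm_ring_hom "to_fract :: 'a mpoly \<Rightarrow> _" by (rule comm_ring_hom_to_fract)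
      interpret c: comm_ring_hom "mconst :: 'a \<Rightarrow> _" by (rule comm_ring_hom_mconst)
      have "lin c ^ (?q ^ i) = (\<Sum>j<n. to_fract (mconst (c j ^ (?q ^ i))) * to_fract (mvar j) ^ (?q ^ i))"
        unfolding lin_def t.hom_sum F.hom_sum
        by (simp add: power_mult_distrib t.hom_power[symmetric] c.hom_power[symmetric])
      then show ?thesis using that by (simp add: finite_field_power_card_power)
    qed
    then have "poly p (lin c) = (\<Sum>i<n. \<Sum>j<n. to_fract (mconst (c j)) * (?M $$ (i, j) * vec_index v i))"
      by (simp add: p_def poly_sum poly_monom sum_distrib_left ac_simps)
    also have "\<dots> = (\<Sum>j<n. to_fract (mconst (c j)) * (\<Sum>i<n. ?M $$ (i, j) * vec_index v i))"
      by (subst sum.swap) (simp add: sum_distrib_left)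
    also have "\<dots> = 0"
    proof (intro sum.neutral ballI)
      fix j assume j: "j \<in> {..<n}"
      have "vec_index (transpose_mat ?M *\<^sub>v v) j = (\<Sum>i<n. ?M $$ (i, j) * vec_index v i)"
        using j v(1) by (simp add: scalar_prod_def lessThan_atLeast0)
      then show "to_fract (mconst (c j)) * (\<Sum>i<n. ?M $$ (i, j) * vec_index v i) = 0"
        using v(3) j by simp
    qed
    finally show ?thesis .
  qed
  let ?C = "{..<n} \<rightarrow>\<^sub>E (UNIV :: 'a set)"
  have "inj_on lin ?C"
  proof (rule inj_onI)
    fix c d assume cd: "c \<in> ?C" "d \<in> ?C" "lin c = lin d"
    have "c i = d i" if "i < n" for i
      by (rule linear_form_inject[OF cd(3)[unfolded lin_def to_fract_eq_iff] that])
    then show "c = d" using cd by (intro PiE_ext[of c "{..<n}" _ d]) auto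
  qed
  then have "card (lin ` ?C) = ?q ^ n" by (simp add: card_image card_PiE)
  moreover have "card (lin ` ?C) \<le> card {x. poly p x = 0}"
    using root by (intro card_mono[OF poly_roots_finite[OF \<open>p \<noteq> 0\<close>]] image_subsetI) simp
  moreover have "card {x. poly p x = 0} \<le> degree p" by (rule card_poly_roots_bound[OF \<open>p \<noteq> 0\<close>])
  moreover have "?q ^ (n - 1) < ?q ^ n" using q k(1) by (intro power_strict_increasing) auto
  ultimately show False using deg by linarith
qed


section \<open>Invariants lie in the generated field\<close>

lemma (in ideal_char_two) alt_mcong:
  assumes "alt N" and "N \<approx> N'"
  shows "alt N'"
  unfolding alt_def
proof (intro conjI allI impI)
  have e: "N' $$ (i, j) \<sim> N $$ (i, j)" if "i < n" "j < n" for i j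
    using assms(2) that by (auto simp: mcong_def intro: cong_sym)
  show "N' \<in> Mats" by (rule mcong_carrier(2)[OF assms(2)])
  show "N' $$ (i, i) \<in> I" if "i < n" for i
    using cong_mem[OF e[OF that that]] assms(1) that by (simp add: alt_def)
  show "N' $$ (i, j) \<sim> N' $$ (j, i)" if "i < n" "j < n" for i j
  proof -
    have "N' $$ (i, j) \<sim> N $$ (i, j)" by (rule e[OF that])
    also have "N $$ (i, j) \<sim> N $$ (j, i)" using assms(1) that by (simp add: alt_def)
    also have "N $$ (j, i) \<sim> N' $$ (j, i)" by (rule cong_sym[OF e[OF that(2,1)]])
    finally show ?thesis .
  qed
qed

lemma (in comm_ring_hom) map_mat_add:
  "B \<in> carrier_mat n n \<Longrightarrow> C \<in> carrier_mat n n \<Longrightarrow> map_mat hom (B + C) = map_mat hom B + map_mat hom C"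
  by (intro eq_matI) (auto simp: hom_add)

lemma congruence_entry:
  fixes B N :: "'r::comm_ring_1 mat"
  assumes "B \<in> carrier_mat n n" "N \<in> carrier_mat n n" "i < n" "j < n"
  shows "(B * N * transpose_mat B) $$ (i, j) = row B i \<bullet> (N *\<^sub>v row B j)"
proof -
  have "(B * N * transpose_mat B) $$ (i, j) = (B * (N * transpose_mat B)) $$ (i, j)"
    using assms by (simp add: assoc_mult_mat[of _ n n _ n _ n])
  also have "\<dots> = row B i \<bullet> col (N * transpose_mat B) j"
    using assms by auto
  also have "col (N * transpose_mat B) j = N *\<^sub>v row B j"
    using assms by (intro eq_vecI) auto
  finally show ?thesis .
qed

definition frobenius_rows :: "nat \<Rightarrow> nat \<Rightarrow> (nat \<Rightarrow> 'r::comm_ring_1) \<Rightarrow> 'r mat" where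
  "frobenius_rows q n x = mat n n (\<lambda>(i, j). x j ^ (q ^ i))"

lemma frobenius_rows_carrier [simp]: "frobenius_rows q n x \<in> carrier_mat n n"
  by (simp add: frobenius_rows_def)

context char_two_form begin

context
  fixes hom :: "'a mpoly \<Rightarrow> 'r::comm_ring_1"
  assumes hom: "comm_ring_hom hom" and two_r: "(1::'r) + 1 = 0"
begin

interpretation hom: comm_ring_hom hom by (rule hom)

lemma comm_ring_hom_comp_mconst: "comm_ring_hom (hom \<circ> mconst)"
  by unfold_locales (simp_all add: mconst_add mconst_mult hom.hom_add hom.hom_mult)

text \<open>
  Frobenius fixes the entries of \<open>G\<close>, so it can be pulled out of the quadratic
  and the polar form; the Gram data of the rows become powers of \<open>P\<^sub>n\<^sub>0,
  \<dots>, P\<^sub>n\<^sub>,\<^sub>n\<^sub>-\<^sub>1\<close> evaluated at one vector.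
\<close>

lemma frobenius_rows_gram:
  defines "B \<equiv> frobenius_rows (CARD('a)) n (\<lambda>j. hom (mvar j))" and "\<kappa> \<equiv> hom \<circ> mconst"
  shows "i < n \<Longrightarrow> (B * map_mat \<kappa> G * transpose_mat B) $$ (i, i) = hom (P_poly n G 0) ^ (CARD('a) ^ i)"
    and "i < j \<Longrightarrow> j < n \<Longrightarrow> (B * map_mat \<kappa> G * transpose_mat B) $$ (i, j) +
      (B * map_mat \<kappa> G * transpose_mat B) $$ (j, i) = hom (P_poly n G (j - i)) ^ (CARD('a) ^ i)"
proof -
  interpret \<kappa>: comm_ring_hom \<kappa> unfolding \<kappa>_def by (rule comm_ring_hom_comp_mconst)
  let ?q = "CARD('a)"
  let ?x = "vec n (\<lambda>i. hom (mvar i))"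
  have [simp]: "B \<in> carrier_mat n n" "map_mat \<kappa> G \<in> carrier_mat n n" using G_carrier by (simp_all add: B_def)
  have row: "row B i = map_vec (\<lambda>y. y ^ (?q ^ i)) ?x" if "i < n" for i
    using that by (auto simp: B_def frobenius_rows_def)
  have fixed: "map_mat (\<lambda>y. y ^ (?q ^ i)) (map_mat \<kappa> N) = map_mat \<kappa> N" for i N
    by (intro eq_matI) (simp_all add: \<kappa>.hom_power[symmetric] finite_field_power_card_power)
  have frob: "(map_vec (\<lambda>y. y ^ (?q ^ i)) u) \<bullet> (map_mat \<kappa> N *\<^sub>v map_vec (\<lambda>y. y ^ (?q ^ i)) v) =
      (u \<bullet> (map_mat \<kappa> N *\<^sub>v v)) ^ (?q ^ i)"
    if "u \<in> carrier_vec n" "v \<in> carrier_vec n" "N \<in> carrier_mat n n" for u v N i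
  proof -
    interpret F: comm_ring_hom "\<lambda>y :: 'r. y ^ (?q ^ i)"
      by (rule comm_ring_hom_frobenius[OF char two_r])
    have "map_vec (\<lambda>y. y ^ (?q ^ i)) (map_mat \<kappa> N *\<^sub>v v) = map_mat \<kappa> N *\<^sub>v map_vec (\<lambda>y. y ^ (?q ^ i)) v"
      using F.mult_mat_vec_hom[of "map_mat \<kappa> N" n n v] that by (simp only: fixed map_carrier_mat)
    then show ?thesis using F.hom_scalar_prod[of u "map_mat \<kappa> N *\<^sub>v v"] that by simp
  qed
  show "(B * map_mat \<kappa> G * transpose_mat B) $$ (i, i) = hom (P_poly n G 0) ^ (?q ^ i)" if "i < n"
    using that G_carrier
    by (simp add: congruence_entry[of _ n] row frob hom_P_poly(1)[OF hom G_carrier] \<kappa>_def[symmetric])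
  show "(B * map_mat \<kappa> G * transpose_mat B) $$ (i, j) +
      (B * map_mat \<kappa> G * transpose_mat B) $$ (j, i) = hom (P_poly n G (j - i)) ^ (?q ^ i)" if ij: "i < j" "j < n"
  proof -
    have i: "i < n" using ij by simp
    let ?u = "row B i" and ?v = "row B j"
    have uv: "?u \<in> carrier_vec n" "?v \<in> carrier_vec n" by (simp_all add: row_carrier_vec[of _ n] i ij)
    have "?v \<bullet> (map_mat \<kappa> G *\<^sub>v ?u) = (transpose_mat (map_mat \<kappa> G) *\<^sub>v ?v) \<bullet> ?u"
      by (rule transpose_vec_mult_scalar[symmetric, of _ n n]) (simp_all add: uv)
    also have "\<dots> = ?u \<bullet> (map_mat \<kappa> (transpose_mat G) *\<^sub>v ?v)"
      using G_carrier uv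
      by (subst comm_scalar_prod[of _ n]) (auto simp: map_mat_transpose intro!: mult_mat_vec_carrier[of _ n n])
    finally have "?u \<bullet> (map_mat \<kappa> G *\<^sub>v ?v) + ?v \<bullet> (map_mat \<kappa> G *\<^sub>v ?u) =
        ?u \<bullet> (map_mat \<kappa> G *\<^sub>v ?v) + ?u \<bullet> (map_mat \<kappa> (transpose_mat G) *\<^sub>v ?v)"
      by simp
    also have "\<dots> = ?u \<bullet> (map_mat \<kappa> (G + transpose_mat G) *\<^sub>v ?v)"
    proof -
      have "map_mat \<kappa> (G + transpose_mat G) = map_mat \<kappa> G + map_mat \<kappa> (transpose_mat G)"
        using carrier_matD[OF G_carrier] by (intro eq_matI) (simp_all add: \<kappa>.hom_add)
      then show ?thesis
        using G_carrier uv by (simp add: add_mult_distrib_mat_vec[of _ n n] scalar_prod_add_distrib[of _ n]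
          mult_mat_vec_carrier[of _ n n])
    qed
    finally have e: "?u \<bullet> (map_mat \<kappa> G *\<^sub>v ?v) + ?v \<bullet> (map_mat \<kappa> G *\<^sub>v ?u) =
        ?u \<bullet> (map_mat \<kappa> (G + transpose_mat G) *\<^sub>v ?v)" .
    have rv: "?v = map_vec (\<lambda>y. y ^ (?q ^ i)) (map_vec (\<lambda>y. y ^ (?q ^ (j - i))) ?x)"
      using ij unfolding row[OF ij(2)]
      by (intro eq_vecI) (simp_all add: power_mult[symmetric] power_add[symmetric])
    have "?u \<bullet> (map_mat \<kappa> (G + transpose_mat G) *\<^sub>v ?v) =
        (?x \<bullet> (map_mat \<kappa> (G + transpose_mat G) *\<^sub>v map_vec (\<lambda>y. y ^ (?q ^ (j - i))) ?x)) ^ (?q ^ i)"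
      unfolding rv row[OF i] by (rule frob) (use G_carrier in simp_all)
    also have "\<dots> = hom (P_poly n G (j - i)) ^ (?q ^ i)"
      using ij hom_P_poly(2)[OF hom G_carrier, of "j - i"] by (simp add: \<kappa>_def)
    finally show ?thesis
      using e ij i by (simp add: congruence_entry[of _ n])
  qed
qed

end

lemma two_ratfun_mpoly: "(1 :: 'a ratfun mpoly) + 1 = 0"
proof -
  have "(1 :: 'a ratfun mpoly) + 1 = mconst (1 + 1)" by (simp only: mconst_add mconst_1)
  then show ?thesis by (simp only: two(3) mconst_0)
qed

abbreviation P_field :: "'a ratfun set" where
  "P_field \<equiv> field_adjoin ((\<lambda>k. to_fract (P_poly n G k)) ` {..<n})"

text \<open>
  The polynomial \<open>p(X)\<close>, as a scalar of \<open>K[Y]\<close>.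
\<close>

definition scalar_embed :: "'a mpoly \<Rightarrow> 'a ratfun mpoly" where
  "scalar_embed p = mconst (to_fract p)"

definition const_embed :: "'a \<Rightarrow> 'a ratfun mpoly" where
  "const_embed = scalar_embed \<circ> mconst"

lemma comm_ring_hom_scalar_embed: "comm_ring_hom scalar_embed"
  by unfold_locales (simp_all add: scalar_embed_def mconst_add mconst_mult)

lemma comm_ring_hom_const_embed: "comm_ring_hom const_embed"
  unfolding const_embed_def
  by (rule comm_ring_hom_comp_mconst[OF comm_ring_hom_scalar_embed two_ratfun_mpoly])

lemma coeff_embed_comp_mconst: "coeff_embed \<circ> mconst = const_embed"
  by (auto simp: const_embed_def scalar_embed_def coeff_embed_single mconst_def)

lemma inj_mconst: "inj (mconst :: 'k::field \<Rightarrow> 'k mpoly)"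
proof (rule injI)
  fix c d :: 'k assume "mconst c = mconst d"
  then have "Poly_Mapping.lookup (mconst c) 0 = Poly_Mapping.lookup (mconst d) 0" by simp
  then show "c = d" by (simp add: mconst_def)
qed

lemma inj_const_embed: "inj const_embed"
  by (rule injI) (simp add: const_embed_def scalar_embed_def inj_eq[OF inj_mconst])

sublocale \<iota>: comm_ring_hom scalar_embed by (rule comm_ring_hom_scalar_embed)
sublocale \<kappa>: comm_ring_hom const_embed by (rule comm_ring_hom_const_embed)
sublocale \<eta>: comm_ring_hom "coeff_embed :: 'a mpoly \<Rightarrow> _" by (rule comm_ring_hom_coeff_embed)

text \<open>
  Choose an \<open>L\<close>-linear \<open>\<phi>\<close> with \<open>\<phi> b = 0\<close> and
  \<open>\<phi> a = 1\<close>. The ideal is the largest one on which the extension of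
  \<open>\<phi>\<close> to \<open>K[Y]\<close> vanishes. The functional takes the nonzero
  value \<open>b\<close> at \<open>b(X) a(Y) - a(X) b(Y)\<close>.
\<close>

lemma separating_ideal:
  assumes b: "b \<noteq> 0" and not: "Fract a b \<notin> P_field"
  obtains I where "ideal_char_two I"
    and "\<And>k. k < n \<Longrightarrow> coeff_embed (P_poly n G k) + scalar_embed (P_poly n G k) \<in> I"
    and "scalar_embed b * coeff_embed a + scalar_embed a * coeff_embed b \<notin> I"
proof -
  have independent: "to_fract a \<noteq> l * to_fract b" if "l \<in> P_field" for l
  proof
    assume "to_fract a = l * to_fract b"
    then have "Fract a b = l" using b by (simp add: Fract_conv_to_fract)
    with not that show False by simp
  qed
  obtain \<phi> where \<phi>: "\<And>x y. \<phi> (x + y) = \<phi> x + \<phi> y"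
    "\<And>l x. l \<in> P_field \<Longrightarrow> \<phi> (l * x) = l * \<phi> x" "\<phi> (to_fract b) = 0" "\<phi> (to_fract a) = 1"
  proof (rule exists_linear_functional[of P_field "to_fract a" "to_fract b"])
    show "1 \<in> P_field" by (rule field_adjoin_one)
    show "x + y \<in> P_field" "x * y \<in> P_field" if "x \<in> P_field" "y \<in> P_field" for x y
      using that by (rule field_adjoin_add, rule field_adjoin_mult)
    show "- x \<in> P_field" if "x \<in> P_field" for x using that by (rule field_adjoin_uminus)
    show "inverse x \<in> P_field" if "x \<in> P_field" "x \<noteq> 0" for x using that by (rule field_adjoin_inverse)
    show "to_fract a \<noteq> l * to_fract b" if "l \<in> P_field" for l using that by (rule independent)
  qed (rule that)
  let ?\<Phi> = "apply_functional \<phi>"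
  define I where "I = {p. \<forall>r. ?\<Phi> (r * p) = 0}"
  have idealI: "ideal_char_two I"
  proof
    show "(1 :: 'a ratfun mpoly) + 1 = 0" by (rule two_ratfun_mpoly)
    show "0 \<in> I" by (simp add: I_def apply_functional_0)
    show "x + y \<in> I" if "x \<in> I" "y \<in> I" for x y
      using that by (simp add: I_def distrib_left apply_functional_add)
    show "r * x \<in> I" if "x \<in> I" for x r
    proof -
      have "?\<Phi> (s * (r * x)) = ?\<Phi> ((s * r) * x)" for s by (simp only: mult.assoc)
      then show ?thesis using that by (simp add: I_def)
    qed
  qed
  have P_rel: "coeff_embed (P_poly n G k) + scalar_embed (P_poly n G k) \<in> I" if "k < n" for k
  proof -
    have P: "to_fract (P_poly n G k) \<in> P_field" using that by (intro field_adjoin_incl) simp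
    have "?\<Phi> (r * (coeff_embed (P_poly n G k) + scalar_embed (P_poly n G k))) = 0" for r
    proof -
      have "?\<Phi> (r * (coeff_embed (P_poly n G k) + scalar_embed (P_poly n G k))) =
          to_fract (P_poly n G k) * ?\<Phi> r + to_fract (P_poly n G k) * ?\<Phi> r"
      proof -
        have "?\<Phi> (r * coeff_embed (P_poly n G k)) = to_fract (P_poly n G k) * ?\<Phi> r"
          by (rule apply_functional_coeff_embed_scale[OF \<phi>(1,2) field_adjoin_const P])
        moreover have "?\<Phi> (r * scalar_embed (P_poly n G k)) = to_fract (P_poly n G k) * ?\<Phi> r"
          unfolding scalar_embed_def by (subst mult.commute) (rule apply_functional_mconst)
        ultimately show ?thesis by (simp only: distrib_left apply_functional_add)
      qed
      also have "\<dots> = (1 + 1) * (to_fract (P_poly n G k) * ?\<Phi> r)" by (simp only: distrib_right mult_1_left)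
      finally show ?thesis by (simp only: two(3) mult_zero_left)
    qed
    then show ?thesis by (simp add: I_def)
  qed
  let ?u = "scalar_embed b * coeff_embed a + scalar_embed a * coeff_embed b"
  have "?\<Phi> ?u = to_fract b"
  proof -
    have "?\<Phi> (scalar_embed x * coeff_embed y) = to_fract x * \<phi> (to_fract y)" for x y
      using apply_functional_single_coeff_embed[OF \<phi>(1,2) field_adjoin_const, where m = 0 and c = "to_fract x" and p = y]
      by (simp add: scalar_embed_def mconst_def)
    then show ?thesis by (simp add: apply_functional_add \<phi>(3,4))
  qed
  then have "?\<Phi> (1 * ?u) \<noteq> 0" using b by (simp only: mult_1_left to_fract_eq_0_iff) simp
  then have "?u \<notin> I" unfolding I_def by blast
  then show thesis using that idealI P_rel by blast
qed

abbreviation scalar_rows :: "'a ratfun mpoly mat" where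
  "scalar_rows \<equiv> frobenius_rows CARD('a) n (\<lambda>j. scalar_embed (mvar j))"

abbreviation coeff_rows :: "'a ratfun mpoly mat" where
  "coeff_rows \<equiv> frobenius_rows CARD('a) n (\<lambda>j. coeff_embed (mvar j))"

abbreviation G_lift :: "'a ratfun mpoly mat" where
  "G_lift \<equiv> map_mat const_embed G"

lemma scalar_rows_inverse:
  obtains M' where "M' \<in> carrier_mat n n" "M' * scalar_rows = 1\<^sub>m n" "scalar_rows * M' = 1\<^sub>m n"
proof -
  let ?M = "mat n n (\<lambda>(i, j). to_fract (mvar j :: 'a mpoly) ^ (CARD('a) ^ i))"
  have "det ?M \<noteq> 0" by (rule moore_det_nonzero[OF char])
  then obtain K where K: "K \<in> carrier_mat n n" "K * ?M = 1\<^sub>m n" "?M * K = 1\<^sub>m n"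
    using det_non_zero_imp_unit[of ?M n "()"]
    by (auto simp: Units_def ring_mat_simps)
  interpret c: comm_ring_hom "mconst :: 'a ratfun \<Rightarrow> _" by (rule comm_ring_hom_mconst)
  have M: "scalar_rows = map_mat mconst ?M"
    by (rule eq_matI) (simp_all add: frobenius_rows_def scalar_embed_def c.hom_power)
  show thesis
  proof (rule that[of "map_mat mconst K"])
    show "map_mat mconst K * scalar_rows = 1\<^sub>m n" "scalar_rows * map_mat mconst K = 1\<^sub>m n"
      unfolding M using K c.mat_hom_mult[of K n n ?M n] c.mat_hom_mult[of ?M n n K n] c.mat_hom_one[of n]
      by simp_all
  qed (use K in simp)
qed

lemma form_char_two_lift:
  assumes "ideal_char_two I"
  shows "form_char_two I n G_lift"
proof -
  interpret ideal_char_two I n by fact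
  have polar_lift: "G_lift + transpose_mat G_lift = map_mat const_embed (G + transpose_mat G)"
    using carrier_matD[OF G_carrier] by (intro eq_matI) (simp_all add: \<kappa>.hom_add)
  have "(G_lift + transpose_mat G_lift) * (G_lift + transpose_mat G_lift) = 1\<^sub>m n"
    unfolding polar_lift using G_carrier polar_square
    by (simp add: \<kappa>.mat_hom_mult[of _ n n _ n, symmetric] \<kappa>.mat_hom_one)
  then show ?thesis
    by unfold_locales (use G_carrier in simp_all)
qed

context
  fixes I :: "'a ratfun mpoly set"
  assumes idealI: "ideal_char_two I"
    and P_rel: "\<And>k. k < n \<Longrightarrow> coeff_embed (P_poly n G k) + scalar_embed (P_poly n G k) \<in> I"
begin

interpretation I: form_char_two I n G_lift "G_lift + transpose_mat G_lift" "(G_lift + transpose_mat G_lift) * G_lift * (G_lift + transpose_mat G_lift)"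
  by (rule form_char_two_lift[OF idealI])

lemma gram_congruent:
  "I.alt (coeff_rows * G_lift * transpose_mat coeff_rows + scalar_rows * G_lift * transpose_mat scalar_rows)"
proof -
  let ?q = "CARD('a)"
  have q: "?q > 0" by (simp add: finite_UNIV_card_ge_0)
  note gram\<eta> = frobenius_rows_gram[OF \<eta>.comm_ring_hom_axioms two_ratfun_mpoly, unfolded coeff_embed_comp_mconst]
  note gram\<iota> = frobenius_rows_gram[OF \<iota>.comm_ring_hom_axioms two_ratfun_mpoly, folded const_embed_def]
  let ?D = "coeff_rows * G_lift * transpose_mat coeff_rows" and ?E = "scalar_rows * G_lift * transpose_mat scalar_rows"
  have DE: "?D \<in> carrier_mat n n" "?E \<in> carrier_mat n n" by simp_all
  have entry: "(?D + ?E) $$ (i, j) = ?D $$ (i, j) + ?E $$ (i, j)" if "i < n" "j < n" for i j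
    using that carrier_matD[OF DE(2)] by simp
  have rel: "coeff_embed (P_poly n G k) ^ (?q ^ i) + scalar_embed (P_poly n G k) ^ (?q ^ i) \<in> I" if "k < n" for k i
    using I.cong_power P_rel[OF that] unfolding I.cong_def by blast
  have off: "(?D + ?E) $$ (i, j) + (?D + ?E) $$ (j, i) \<in> I" if "i < j" "j < n" for i j
  proof -
    have "i < n" "j - i < n" using that by auto
    have "(?D + ?E) $$ (i, j) + (?D + ?E) $$ (j, i) =
        (?D $$ (i, j) + ?D $$ (j, i)) + (?E $$ (i, j) + ?E $$ (j, i))"
      unfolding entry[OF \<open>i < n\<close> that(2)] entry[OF that(2) \<open>i < n\<close>] by (simp only: ac_simps)
    also have "\<dots> \<in> I"
      unfolding gram\<eta>(2)[OF that] gram\<iota>(2)[OF that] by (rule rel[OF \<open>j - i < n\<close>])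
    finally show ?thesis .
  qed
  show ?thesis
    unfolding I.alt_def
  proof (intro conjI allI impI)
    show "?D + ?E \<in> carrier_mat n n" using DE by simp
    show "(?D + ?E) $$ (i, i) \<in> I" if "i < n" for i
      unfolding entry[OF that that] gram\<eta>(1)[OF that] gram\<iota>(1)[OF that] by (rule rel) (use that in simp)
    show "I.cong ((?D + ?E) $$ (i, j)) ((?D + ?E) $$ (j, i))" if "i < n" "j < n" for i j
      unfolding I.cong_def
    proof (cases i j rule: linorder_cases)
      case less
      then show "(?D + ?E) $$ (i, j) + (?D + ?E) $$ (j, i) \<in> I" using off that by blast
    next
      case equal
      then show "(?D + ?E) $$ (i, j) + (?D + ?E) $$ (j, i) \<in> I" by (simp only: I.add_self I.zero_mem)
    next
      case greater
      then show "(?D + ?E) $$ (i, j) + (?D + ?E) $$ (j, i) \<in> I" using off[of j i] that by (simp only: add.commute)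
    qed
  qed
qed

lemma transition_isom_frobenius:
  assumes M': "M' \<in> carrier_mat n n" "M' * scalar_rows = 1\<^sub>m n" "scalar_rows * M' = 1\<^sub>m n"
  shows "I.isom (M' * coeff_rows)"
    and "I.mcong (map_mat (\<lambda>x. x ^ CARD('a)) (M' * coeff_rows)) (M' * coeff_rows)"
proof -
  let ?q = "CARD('a)"
  have q: "?q > 0" by (simp add: finite_UNIV_card_ge_0)
  have rows: "frobenius_rows ?q n x $$ (Suc i, j) = frobenius_rows ?q n x $$ (i, j) ^ ?q"
    if "Suc i < n" "j < n" for i j and x :: "nat \<Rightarrow> 'a ratfun mpoly"
    using that by (simp add: frobenius_rows_def power_mult[symmetric] mult.commute)
  have G_fixed: "G_lift $$ (i, j) ^ ?q = G_lift $$ (i, j)" if "i < n" "j < n" for i j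
    using that carrier_matD[OF G_carrier] by (simp add: \<kappa>.hom_power[symmetric] finite_field_power_card)
  note core = I.transition_frobenius_fixed[OF q frobenius_add[OF char two_ratfun_mpoly] G_fixed
      frobenius_rows_carrier M'(1,2,3) frobenius_rows_carrier rows rows gram_congruent]
  show "I.isom (M' * coeff_rows)" by (rule core(1))
  show "I.mcong (map_mat (\<lambda>x. x ^ ?q) (M' * coeff_rows)) (M' * coeff_rows)" by (rule core(2))
qed

text \<open>
  Otherwise the element remains outside of some larger ideal \<open>J\<close> modulo which all
  entries of the transition matrix are elements of the finite field. These form an orthogonal
  matrix \<open>T\<^sub>0\<close>, since \<open>J\<close> contains no nonzero constants.
  Modulo \<open>J\<close> the substitution of \<open>Y\<close> for \<open>X\<close> is the
  action of \<open>T\<^sub>0\<close>, under which \<open>a / b\<close> is invariant, so the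
  element lies in \<open>J\<close> after all.
\<close>

lemma invariant_in_relation_ideal:
  assumes ab: "in_vars n a" "in_vars n b" "b \<noteq> 0"
    and inv: "\<And>T. T \<in> orthogonal_group n G \<Longrightarrow> \<sigma> n T (Fract a b) = Fract a b"
  shows "scalar_embed b * coeff_embed a + scalar_embed a * coeff_embed b \<in> I"
proof (rule ccontr)
  let ?q = "CARD('a)"
  define u where "u = scalar_embed b * coeff_embed a + scalar_embed a * coeff_embed b"
  assume "scalar_embed b * coeff_embed a + scalar_embed a * coeff_embed b \<notin> I"
  then have u: "u \<notin> I" unfolding u_def .
  obtain M' where M': "M' \<in> carrier_mat n n" "M' * scalar_rows = 1\<^sub>m n" "scalar_rows * M' = 1\<^sub>m n"
    by (rule scalar_rows_inverse)
  define T where "T = M' * coeff_rows"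
  have T [simp]: "T \<in> carrier_mat n n" using M' by (simp add: T_def)
  have MT: "scalar_rows * T = coeff_rows"
    using M' by (simp add: T_def assoc_mult_mat[symmetric, of _ n n _ n _ n] left_mult_one_mat[of _ n n] del: assoc_mult_mat)
  have isomT: "I.isom T" and TI: "I.mcong (map_mat (\<lambda>x. x ^ ?q) T) T"
    unfolding T_def by (rule transition_isom_frobenius[OF M'])+
  have tq: "t ^ ?q + t \<in> I" if t: "t \<in> (\<lambda>(i, j). T $$ (i, j)) ` ({..<n} \<times> {..<n})" for t
  proof -
    obtain i j where ij: "i < n" "j < n" "t = T $$ (i, j)" using t by auto
    have "I.cong (map_mat (\<lambda>x. x ^ ?q) T $$ (i, j)) (T $$ (i, j))"
      using TI ij(1,2) unfolding I.mcong_def by blast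
    then show ?thesis using ij carrier_matD[OF T] by (simp add: I.cong_def)
  qed
  have "\<exists>J. ideal_char_two J \<and> I \<subseteq> J \<and> u \<notin> J \<and>
      (\<forall>t\<in>(\<lambda>(i, j). T $$ (i, j)) ` ({..<n} \<times> {..<n}). \<exists>a. t + const_embed a \<in> J)"
    by (rule split_ideal_finite[OF char inj_const_embed \<kappa>.hom_mult \<kappa>.hom_one _ idealI u])
      (simp, rule tq)
  then obtain J where J: "ideal_char_two J" "I \<subseteq> J" "u \<notin> J"
    and entries: "\<forall>t\<in>(\<lambda>(i, j). T $$ (i, j)) ` ({..<n} \<times> {..<n}). \<exists>a. t + const_embed a \<in> J"
    by (elim exE conjE)
  interpret J: form_char_two J n G_lift "G_lift + transpose_mat G_lift" "(G_lift + transpose_mat G_lift) * G_lift * (G_lift + transpose_mat G_lift)"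
    by (rule form_char_two_lift[OF J(1)])
  define T0 where "T0 = mat n n (\<lambda>(i, j). SOME a. T $$ (i, j) + const_embed a \<in> J)"
  have T0 [simp]: "T0 \<in> carrier_mat n n" by (simp add: T0_def)
  have T_T0: "J.mcong T (map_mat const_embed T0)"
    unfolding J.mcong_def
  proof (intro conjI allI impI)
    fix i j assume ij: "i < n" "j < n"
    then have "\<exists>a. T $$ (i, j) + const_embed a \<in> J" using entries by auto
    then have "T $$ (i, j) + const_embed (SOME a. T $$ (i, j) + const_embed a \<in> J) \<in> J" by (rule someI_ex)
    then show "J.cong (T $$ (i, j)) (map_mat const_embed T0 $$ (i, j))"
      using ij by (simp add: J.cong_def T0_def)
  qed simp_all
  have \<kappa>_J: "c = 0" if "const_embed c \<in> J" for c
  proof (rule ccontr)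
    assume "c \<noteq> 0"
    have "(u * const_embed (inverse c)) * const_embed c \<in> J" by (rule J.mult_mem[OF that])
    also have "(u * const_embed (inverse c)) * const_embed c = u"
      using \<open>c \<noteq> 0\<close> by (simp add: mult.assoc \<kappa>.hom_mult[symmetric])
    finally show False using J(3) by contradiction
  qed
  have T0_isom: "base.isom T0"
  proof -
    let ?N = "T0 * G * transpose_mat T0 + G"
    have N: "?N \<in> carrier_mat n n" using G_carrier by simp
    have "J.alt (T * G_lift * transpose_mat T + G_lift)"
      using isomT J(2) unfolding I.isom_def I.alt_def J.alt_def I.cong_def J.cong_def by blast
    moreover have "J.mcong (T * G_lift * transpose_mat T + G_lift)
        (map_mat const_embed T0 * G_lift * transpose_mat (map_mat const_embed T0) + G_lift)"
      by (intro J.mcong_add J.mcong_mult J.mcong_transpose T_T0 J.mcong_refl J.G)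
    moreover have "map_mat const_embed T0 * G_lift * transpose_mat (map_mat const_embed T0) + G_lift = map_mat const_embed ?N"
    proof -
      have "map_mat const_embed ?N = map_mat const_embed (T0 * G * transpose_mat T0) + G_lift"
        using G_carrier by (intro \<kappa>.map_mat_add[of _ n]) simp_all
      then show ?thesis
        using G_carrier by (simp add: \<kappa>.mat_hom_mult[of _ n n _ n] map_mat_transpose)
    qed
    ultimately have alt: "J.alt (map_mat const_embed ?N)" using J.alt_mcong by metis
    have "base.alt ?N"
      unfolding base.alt_def
    proof (intro conjI allI impI N)
      fix i assume i: "i < n"
      then have "map_mat const_embed ?N $$ (i, i) \<in> J" using alt unfolding J.alt_def by blast
      then have "const_embed (?N $$ (i, i)) \<in> J" using i carrier_matD[OF N] by (simp only: index_map_mat)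
      then show "?N $$ (i, i) \<in> {0}" using \<kappa>_J by blast
    next
      fix i j assume ij: "i < n" "j < n"
      then have "map_mat const_embed ?N $$ (i, j) + map_mat const_embed ?N $$ (j, i) \<in> J"
        using alt unfolding J.alt_def J.cong_def by blast
      then have "const_embed (?N $$ (i, j) + ?N $$ (j, i)) \<in> J"
        using ij carrier_matD[OF N] by (simp only: index_map_mat \<kappa>.hom_add)
      then show "base.cong (?N $$ (i, j)) (?N $$ (j, i))"
        unfolding base.cong_def using \<kappa>_J by blast
    qed
    then show ?thesis by (simp add: base.isom_def)
  qed
  have T0_orth: "T0 \<in> orthogonal_group n G"
  proof -
    let ?A = "G + transpose_mat G"
    let ?S = "?A * transpose_mat T0 * ?A"
    have S: "?S \<in> carrier_mat n n" using G_carrier by simp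
    have left: "?S * T0 = 1\<^sub>m n"
    proof (rule eq_matI)
      fix i j assume "i < dim_row (1\<^sub>m n :: 'a mat)" "j < dim_col (1\<^sub>m n :: 'a mat)"
      then have ij: "i < n" "j < n" by simp_all
      have "\<forall>i<n. \<forall>j<n. (?S * T0) $$ (i, j) + 1\<^sub>m n $$ (i, j) \<in> {0}"
        using base.isom_left_inverse[OF T0_isom] unfolding base.mcong_def base.cong_def by (elim conjE)
      from this[rule_format, OF ij] have "(?S * T0) $$ (i, j) + 1\<^sub>m n $$ (i, j) = 0"
        by (rule singletonD)
      then show "(?S * T0) $$ (i, j) = 1\<^sub>m n $$ (i, j)"
        by (simp only: base.minus_char_two[symmetric] eq_iff_diff_eq_0[symmetric])
    qed (use carrier_matD[OF S] carrier_matD[OF T0] in simp_all)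
    have right: "T0 * ?S = 1\<^sub>m n" by (rule mat_mult_left_right_inverse[OF S T0 left])
    have "invertible_mat T0"
      unfolding invertible_mat_def inverts_mat_def
      using left right carrier_matD[OF T0] carrier_matD[OF S] by (intro conjI exI[of _ ?S]) simp_all
    then show ?thesis using T0_isom by (simp add: orthogonal_iff GL_def)
  qed
  have GL: "T0 \<in> GL n" using T0_orth by (rule orthogonal_isom(1))
  let ?s = "msubst (linear_subst n T0)"
  interpret s: comm_ring_hom ?s by (rule comm_ring_hom_msubst)
  have \<eta>_s: "J.cong (coeff_embed p) (scalar_embed (?s p))" if "in_vars n p" for p
    using that
  proof (induction rule: in_vars_induct)
    case (const c)
    have "coeff_embed (mconst c) = scalar_embed (mconst c)"
      using fun_cong[OF coeff_embed_comp_mconst, of c] by (simp add: const_embed_def)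
    then show ?case by simp
  next
    case (var i)
    have "coeff_embed (mvar i) = coeff_rows $$ (0, i)" using var by (simp add: frobenius_rows_def)
    also have "\<dots> = (\<Sum>k<n. scalar_rows $$ (0, k) * T $$ (k, i))"
      unfolding MT[symmetric] by (rule mat_mult_index) (use var in simp_all)
    also have "\<dots> = (\<Sum>k<n. scalar_embed (mvar k) * T $$ (k, i))"
      using var by (intro sum.cong) (auto simp: frobenius_rows_def)
    also have "J.cong \<dots> (\<Sum>k<n. scalar_embed (mvar k) * map_mat const_embed T0 $$ (k, i))"
      using T_T0 var by (intro J.cong_sum J.cong_mult J.cong_refl) (auto simp: J.mcong_def)
    also have "(\<Sum>k<n. scalar_embed (mvar k) * map_mat const_embed T0 $$ (k, i)) = scalar_embed (?s (mvar i))"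
      using var carrier_matD[OF T0]
      by (simp add: linear_subst_eq_sum[OF T0] \<iota>.hom_sum \<iota>.hom_mult const_embed_def)
    finally show ?case .
  next
    case (add p r)
    then show ?case by (simp only: \<eta>.hom_add s.hom_add \<iota>.hom_add) (rule J.cong_add)
  next
    case (mult p r)
    then show ?case by (simp only: \<eta>.hom_mult s.hom_mult \<iota>.hom_mult) (rule J.cong_mult)
  qed
  have "Fract (?s a) (?s b) = Fract a b"
    using \<sigma>_Fract[OF GL ab(3), of a] inv[OF T0_orth] by simp
  then have sab: "?s a * b = a * ?s b"
    using ab(3) msubst_linear_subst_eq_0_iff[OF GL, of b] by (simp add: eq_fract)
  have "J.cong u (scalar_embed b * scalar_embed (?s a) + scalar_embed a * scalar_embed (?s b))"
    unfolding u_def by (intro J.cong_add J.cong_mult J.cong_refl \<eta>_s ab)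
  also have "scalar_embed b * scalar_embed (?s a) + scalar_embed a * scalar_embed (?s b) = scalar_embed (?s a * b) + scalar_embed (a * ?s b)"
    by (simp only: \<iota>.hom_mult mult.commute)
  also have "\<dots> = 0" unfolding sab by (rule J.add_self)
  finally show False using J(3) by (simp only: J.cong_0_iff)
qed

end

theorem invariant_field_subset_P_field:
  "invariant_field n (orthogonal_group n G) \<subseteq> P_field"
proof
  fix f assume f: "f \<in> invariant_field n (orthogonal_group n G)"
  then obtain a b where ab: "in_vars n a" "in_vars n b" "b \<noteq> 0" and fab: "f = Fract a b"
    unfolding invariant_field_def using rational_function_field_cases by blast
  show "f \<in> P_field"
  proof (rule ccontr)
    assume "f \<notin> P_field"
    then obtain I where I: "ideal_char_two I"
      "\<And>k. k < n \<Longrightarrow> coeff_embed (P_poly n G k) + scalar_embed (P_poly n G k) \<in> I"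
      "scalar_embed b * coeff_embed a + scalar_embed a * coeff_embed b \<notin> I"
      using separating_ideal[OF ab(3), of a] unfolding fab by metis
    have "scalar_embed b * coeff_embed a + scalar_embed a * coeff_embed b \<in> I"
      by (rule invariant_in_relation_ideal[OF I(1,2) ab]) (use f fab in \<open>auto simp: invariant_field_def\<close>)
    with I(3) show False by contradiction
  qed
qed

end


section \<open>The two normal forms\<close>

lemma G_hyp_carrier: "G_hyp \<nu> \<in> carrier_mat (2 * \<nu>) (2 * \<nu>)"
  using four_block_carrier_mat[of "0\<^sub>m \<nu> \<nu> :: 'a mat" \<nu> \<nu> "0\<^sub>m \<nu> \<nu>" \<nu> \<nu> "1\<^sub>m \<nu>" "0\<^sub>m \<nu> \<nu>"]
  by (simp add: G_hyp_def mult_2)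

lemma G_hyp_polar:
  "G_hyp \<nu> + transpose_mat (G_hyp \<nu>) = (four_block_mat (0\<^sub>m \<nu> \<nu>) (1\<^sub>m \<nu>) (1\<^sub>m \<nu>) (0\<^sub>m \<nu> \<nu>) :: 'a::field mat)"
  unfolding G_hyp_def
  by (subst transpose_four_block_mat[of _ \<nu> \<nu> _ \<nu> _ \<nu>]; (subst add_four_block_mat[of _ \<nu> \<nu> _ \<nu> _ \<nu>])?) simp_all

lemma G_hyp_polar_square:
  "(G_hyp \<nu> + transpose_mat (G_hyp \<nu>)) * (G_hyp \<nu> + transpose_mat (G_hyp \<nu>)) = (1\<^sub>m (2 * \<nu>) :: 'a::field mat)"
  unfolding G_hyp_polar
  by (subst mult_four_block_mat[of _ \<nu> \<nu> _ \<nu> _ \<nu> _ _ \<nu> _ \<nu>]) (simp_all add: mult_2)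

lemma G_ell_char_two_form:
  fixes \<alpha> :: "'a::{field,finite}"
  assumes char: "CHAR('a) = 2" and "\<nu> \<ge> 1"
  shows "char_two_form (2 * \<nu>) (G_ell \<nu> \<alpha>)"
proof
  let ?m = "2 * (\<nu> - 1)" and ?D = "mat_of_rows_list 2 [[\<alpha>, 1], [0, \<alpha>]]" and ?H = "G_hyp (\<nu> - 1) :: 'a mat"
  have m: "?m + 2 = 2 * \<nu>" using assms(2) by simp
  have H [simp]: "?H \<in> carrier_mat ?m ?m" by (rule G_hyp_carrier)
  have D [simp]: "?D \<in> carrier_mat 2 2" by (rule carrier_matI) (simp_all add: mat_of_rows_list_def)
  have "\<alpha> + \<alpha> = (1 + 1) * \<alpha>" by (simp only: distrib_right mult_1_left)
  then have \<alpha>: "\<alpha> + \<alpha> = 0"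
    by (simp only: one_add_one_char_two(1)[OF char] mult_zero_left)
  have polar: "G_ell \<nu> \<alpha> + transpose_mat (G_ell \<nu> \<alpha>) =
      four_block_mat (?H + transpose_mat ?H) (0\<^sub>m ?m 2) (0\<^sub>m 2 ?m) (?D + transpose_mat ?D)"
    unfolding G_ell_def
    by (subst transpose_four_block_mat[of _ ?m ?m _ 2 _ 2]; (subst add_four_block_mat[of _ ?m ?m _ 2 _ 2])?)
      (simp_all add: G_hyp_carrier)
  let ?E = "?D + transpose_mat ?D"
  have E: "?E $$ (i, j) = (if i = j then 0 else 1)" if "i < 2" "j < 2" for i j
    using that \<alpha> carrier_matD[OF D]
    by (auto simp: less_2_cases_iff) (simp_all add: mat_of_rows_list_def)
  have DD: "?E * ?E = 1\<^sub>m 2"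
  proof (rule eq_matI)
    fix i j assume "i < dim_row (1\<^sub>m 2 :: 'a mat)" "j < dim_col (1\<^sub>m 2 :: 'a mat)"
    then have ij: "i < 2" "j < 2" by simp_all
    have "(?E * ?E) $$ (i, j) = (\<Sum>k<2. ?E $$ (i, k) * ?E $$ (k, j))"
      by (rule mat_mult_index) (use D ij in simp_all)
    also have "\<dots> = (\<Sum>k<2. (if i = k then 0 else 1) * (if k = j then 0 else 1))"
      by (intro sum.cong refl) (simp only: lessThan_iff E ij)
    also have "\<dots> = 1\<^sub>m 2 $$ (i, j)"
      using ij by (auto simp: less_2_cases_iff numeral_2_eq_2)
    finally show "(?E * ?E) $$ (i, j) = 1\<^sub>m 2 $$ (i, j)" .
  qed (use carrier_matD[OF D] in simp_all)
  show "CHAR('a) = 2" by fact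
  show "G_ell \<nu> \<alpha> \<in> carrier_mat (2 * \<nu>) (2 * \<nu>)"
    using four_block_carrier_mat[OF H D] unfolding G_ell_def m .
  show "(G_ell \<nu> \<alpha> + transpose_mat (G_ell \<nu> \<alpha>)) * (G_ell \<nu> \<alpha> + transpose_mat (G_ell \<nu> \<alpha>)) = 1\<^sub>m (2 * \<nu>)"
  proof -
    define K where "K = ?H + transpose_mat ?H"
    define E where "E = ?E"
    have K: "K \<in> carrier_mat ?m ?m" "K * K = 1\<^sub>m ?m" and E: "E \<in> carrier_mat 2 2" "E * E = 1\<^sub>m 2"
      using H D by (simp_all only: K_def E_def G_hyp_polar_square DD add_carrier_mat transpose_carrier_mat)
    have "four_block_mat K (0\<^sub>m ?m 2) (0\<^sub>m 2 ?m) E * four_block_mat K (0\<^sub>m ?m 2) (0\<^sub>m 2 ?m) E =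
        four_block_mat (1\<^sub>m ?m) (0\<^sub>m ?m 2) (0\<^sub>m 2 ?m) (1\<^sub>m 2)"
      using K E by (subst mult_four_block_mat[of _ ?m ?m _ 2 _ 2 _ _ ?m _ 2]) auto
    then have "(G_ell \<nu> \<alpha> + transpose_mat (G_ell \<nu> \<alpha>)) * (G_ell \<nu> \<alpha> + transpose_mat (G_ell \<nu> \<alpha>)) =
        four_block_mat (1\<^sub>m ?m) (0\<^sub>m ?m 2) (0\<^sub>m 2 ?m) (1\<^sub>m 2)"
      unfolding polar K_def E_def .
    then show ?thesis by (simp only: four_block_one_mat m)
  qed
qed

theorem theorem3p3:
  fixes G :: "'a::{field,finite} mat" and \<nu> n :: nat
  assumes "CHAR('a) = 2"
    and "\<nu> \<ge> 1" and "n = 2 * \<nu>"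
    and "G = G_hyp \<nu> \<or> (\<exists>\<alpha>. \<alpha> \<notin> {x + x ^ 2 |x. True} \<and> G = G_ell \<nu> \<alpha>)"
  shows "invariant_field n (orthogonal_group n G) =
    field_adjoin ((\<lambda>k. to_fract (P_poly n G k)) ` {..<n})"
proof -
  have "char_two_form (2 * \<nu>) G"
    using assms(4)
  proof (elim disjE exE conjE)
    assume "G = G_hyp \<nu>"
    then show ?thesis
      using assms(1) by (simp add: char_two_form_def G_hyp_carrier G_hyp_polar_square)
  next
    fix \<alpha> assume "G = G_ell \<nu> \<alpha>"
    then show ?thesis using G_ell_char_two_form[OF assms(1,2)] by simp
  qed
  then interpret char_two_form n G unfolding assms(3) .
  show ?thesis
    by (rule equalityI[OF invariant_field_subset_P_field field_adjoin_subset_invariant_field])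
qed

end
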